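(* Let $1<\delta<\gamma$, let $g=g_{\gamma,\delta}$ be the Double Hofbauer potential, and let $p(\beta)=P(\beta g)$. (i) If $1<\delta<\gamma<2$, then $p'(\beta)\to 0$ as $\beta\to 1$, $\beta<1$. (ii) If $\gamma>\delta>2$, then $$\lim_{\beta\to1^-}p(\beta)=\frac12\left(\lim_{\beta\to1^-}p_1(\beta)+\lim_{\beta\to1^-}p_2(\beta)\right).$$ Since $p(\beta)=0$ for $\beta>1$, the function $\beta\mapsto p(\beta)$ is (in these cases) not analytic at $\beta=1$.
   Context: $\Omega=\{0,1\}^{\mathbb N}$ with the left shift $\sigma$. For $n\ge1$, $L_n\subset\Omega$ is the set of sequences beginning with exactly $n$ zeros followed by a $1$, and $R_n$ the set of sequences beginning with exactly $n$ ones followed by a $0$. For real $1<\delta<\gamma$ and the Riemann zeta function $\zeta$, the Double Hofbauer potential $g=g_{\gamma,\delta}:\Omega\to\mathbb R$ is: $g(x)=-\gamma\log\frac{n}{n-1}$ if $x\in L_n$, $n\ge2$; $g(x)=-\delta\log\frac n{n-1}$ if $x\in R_n$, $n\ge2$; $g(x)=-\log\zeta(\gamma)$ if $x\in L_1$; $g(x)=-\log\zeta(\delta)$ if $x\in R_1$; $g(0^\infty)=g(1^\infty)=0$. For continuous $f:\Omega\to\mathbb R$ the pressure is $P(f)=\sup_{\mu}\{h(\mu)+\int_\Omega f\,d\mu\}$, the supremum over $\sigma$-invariant Borel probability measures $\mu$, with $h(\mu)$ the Kolmogorov–Sinai entropy. $p_1(\beta)$ and $p_2(\beta)$ denote the pressures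 at inverse temperature $\beta$ of the (single) Hofbauer models with parameters $\gamma$ and $\delta$ respectively; for $0<\beta<1$ they are determined by $\zeta(\gamma)^\beta=\sum_{n\ge1}\frac{e^{-n p_1(\beta)}}{n^{\gamma\beta}}$ and $\zeta(\delta)^\beta=\sum_{n\ge1}\frac{e^{-n p_2(\beta)}}{n^{\delta\beta}}$. *)

theory Defs
  imports "HOL-Probability.Probability"
begin

definition zeta :: "real \<Rightarrow> real" where
  "zeta s = (\<Sum>n. 1 / real (Suc n) powr s)"

text \<open>
  The full shift is the type \<open>nat \<Rightarrow> bool\<close> with its product topology; \<open>False\<close> is the symbol 0
  and \<open>True\<close> the symbol 1.
\<close>

type_synonym omega = "nat \<Rightarrow> bool"

definition shift :: "omega \<Rightarrow> omega" where
  "shift x = (\<lambda>i. x (Suc i))"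

definition initial_run :: "bool \<Rightarrow> nat \<Rightarrow> omega set" where
  "initial_run b n = {x. (\<forall>i<n. x i = b) \<and> x n = (\<not> b)}"

definition L :: "nat \<Rightarrow> omega set" where
  "L n = initial_run False n"

definition R :: "nat \<Rightarrow> omega set" where
  "R n = initial_run True n"

definition hofbauer_value :: "real \<Rightarrow> nat \<Rightarrow> real" where
  "hofbauer_value a n =
     (if n \<ge> 2 then - a * ln (real n / (real n - 1)) else - ln (zeta a))"

text \<open>
  The sets \<open>L n\<close> and \<open>R n\<close> with \<open>n \<ge> 1\<close> are pairwise disjoint, so the descriptions below are unique;
  they cover everything except the two fixed points of the shift.
\<close>

definition double_hofbauer :: "real \<Rightarrow> real \<Rightarrow> omega \<Rightarrow> real" where
  "double_hofbauer \<gamma> \<delta> x =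
     (if \<exists>n\<ge>1. x \<in> L n then hofbauer_value \<gamma> (THE n. n \<ge> 1 \<and> x \<in> L n)
      else if \<exists>n\<ge>1. x \<in> R n then hofbauer_value \<delta> (THE n. n \<ge> 1 \<and> x \<in> R n)
      else 0)"

text \<open>
  The classical Hofbauer potential: its value is \<open>hofbauer_value a n\<close> on the sequences that begin with
  exactly \<open>n - 1\<close> zeros followed by a one (\<open>n \<ge> 1\<close>), and it vanishes at \<open>0\<^sup>\<infinity>\<close>.  Its Birkhoff sum over
  a block of \<open>n - 1\<close> zeros followed by a one is \<open>- a ln n - ln (zeta a)\<close>, so for \<open>0 < \<beta> < 1\<close> the pressure \<open>P\<close>
  of \<open>\<beta>\<close> times it is the solution of
  \<open>zeta a powr \<beta> = (\<Sum>n\<ge>1. exp (- n * P) / n powr (a * \<beta>))\<close>.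
\<close>

definition hofbauer :: "real \<Rightarrow> omega \<Rightarrow> real" where
  "hofbauer a x =
     (if \<exists>n\<ge>1. x \<in> initial_run False (n - 1)
      then hofbauer_value a (THE n. n \<ge> 1 \<and> x \<in> initial_run False (n - 1))
      else 0)"

lemma initial_run_unique:
  assumes "x \<in> initial_run b m" "x \<in> initial_run b n"
  shows "m = n"
  using assms by (cases m n rule: linorder_cases) (auto simp: initial_run_def)

lemma double_hofbauer_L:
  assumes "n \<ge> 1" "x \<in> L n"
  shows "double_hofbauer \<gamma> \<delta> x = hofbauer_value \<gamma> n"
proof -
  have "(THE n. n \<ge> 1 \<and> x \<in> L n) = n"
    using assms by (intro the_equality) (auto simp: L_def intro: initial_run_unique)
  then show ?thesis
    using assms by (auto simp: double_hofbauer_def)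
qed

lemma double_hofbauer_R:
  assumes "n \<ge> 1" "x \<in> R n"
  shows "double_hofbauer \<gamma> \<delta> x = hofbauer_value \<delta> n"
proof -
  have "(THE n. n \<ge> 1 \<and> x \<in> R n) = n"
    using assms by (intro the_equality) (auto simp: R_def intro: initial_run_unique)
  moreover have "x \<notin> L m" if "m \<ge> 1" for m
    using assms that by (auto simp: L_def R_def initial_run_def dest!: spec[of _ 0])
  ultimately show ?thesis
    using assms by (auto simp: double_hofbauer_def)
qed

lemma double_hofbauer_fixed:
  "double_hofbauer \<gamma> \<delta> (\<lambda>_. b) = 0"
  by (cases b) (auto simp: double_hofbauer_def L_def R_def initial_run_def)

lemma hofbauer_run:
  assumes "n \<ge> 1" "x \<in> initial_run False (n - 1)"
  shows "hofbauer a x = hofbauer_value a n"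
proof -
  have "(THE n. n \<ge> 1 \<and> x \<in> initial_run False (n - 1)) = n"
    using assms by (intro the_equality) (auto dest: initial_run_unique)
  then show ?thesis
    using assms by (auto simp: hofbauer_def)
qed

definition partition_entropy :: "'a measure \<Rightarrow> 'a set set \<Rightarrow> real" where
  "partition_entropy M \<xi> = - (\<Sum>A\<in>\<xi>. measure M A * ln (measure M A))"

definition iterated_partition :: "'a measure \<Rightarrow> ('a \<Rightarrow> 'a) \<Rightarrow> 'a set set \<Rightarrow> nat \<Rightarrow> 'a set set" where
  "iterated_partition M T \<xi> n =
     common_refinement ((\<lambda>i. (\<lambda>A. (T ^^ i) -` A \<inter> space M) ` \<xi>) ` {..<n})"

definition partition_entropy_rate :: "'a measure \<Rightarrow> ('a \<Rightarrow> 'a) \<Rightarrow> 'a set set \<Rightarrow> real" where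
  "partition_entropy_rate M T \<xi> =
     lim (\<lambda>n. partition_entropy M (iterated_partition M T \<xi> n) / real n)"

definition ks_entropy :: "'a measure \<Rightarrow> ('a \<Rightarrow> 'a) \<Rightarrow> ereal" where
  "ks_entropy M T =
     (SUP \<xi> \<in> {\<xi>. finite \<xi> \<and> \<xi> \<subseteq> sets M \<and> partition_on (space M) \<xi>}.
        ereal (partition_entropy_rate M T \<xi>))"

definition invariant_measures :: "omega measure set" where
  "invariant_measures = {M. sets M = sets borel \<and> prob_space M \<and> distr M borel shift = M}"

definition topological_pressure :: "(omega \<Rightarrow> real) \<Rightarrow> ereal" where
  "topological_pressure f =
     (SUP M \<in> invariant_measures. ks_entropy M shift + ereal (\<integral>x. f x \<partial>M))"

text \<open>
  For continuous \<open>f\<close> the pressure lies between \<open>min f\<close> and \<open>ln 2 + max f\<close>, so the conversion to a real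
  number loses nothing.
\<close>

definition P :: "(omega \<Rightarrow> real) \<Rightarrow> real" where
  "P f = real_of_ereal (topological_pressure f)"

definition real_analytic_at :: "(real \<Rightarrow> real) \<Rightarrow> real \<Rightarrow> bool" where
  "real_analytic_at f x0 \<longleftrightarrow>
     (\<exists>a r. r > 0 \<and> (\<forall>x. \<bar>x - x0\<bar> < r \<longrightarrow> (\<lambda>n. a n * (x - x0) ^ n) sums f x))"

end

theory Submission
  imports Defs "HOL-Complex_Analysis.Cauchy_Integral_Formula"
begin

text \<open>
  The double Hofbauer potential depends on a sequence only through its first symbol and the length of
  its first run. Its Birkhoff sum over a complete run of \<open>n\<close> equal symbols is \<open>- run_cost a n\<close>, with
  \<open>a = \<gamma>\<close> for zeros and \<open>a = \<delta>\<close> for ones, and the numbers \<open>exp (- run_cost a n)\<close> form a probability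
  distribution. At inverse temperature \<open>\<beta>\<close> and trial pressure \<open>p\<close> a run therefore has the total weight
  \<open>run_sum a \<beta> p = (\<Sum>n\<ge>1. exp (- n p - \<beta> run_cost a n))\<close>, and a cycle, that is a run of zeros followed by
  a run of ones, has the weight \<open>run_sum \<gamma> \<beta> p * run_sum \<delta> \<beta> p\<close>. Renewal theory suggests that the
  pressure is the \<open>p\<close> that makes this product equal to 1, and for \<open>0 \<le> \<beta> < 1\<close> it is.

  Upper bound: if the product is at most 1 for some \<open>p > 0\<close>, then the transfer operator of the potential
  has a supersolution for the factor \<open>exp p\<close> that is bounded and bounded away from 0, and Gibbs'
  inequality turns this into \<open>entropy + integral \<le> p\<close> for every invariant measure
  (\<open>topological_pressure_le\<close>, \<open>double_hofbauer_pressure_le\<close>). Lower bound: if the product is 1, then the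
  stationary alternating renewal process whose run lengths have the normalised weights of the two run
  sums is an invariant measure for which cylinders have mass at most a constant times
  \<open>exp (Birkhoff sum - n p)\<close>, and hence \<open>entropy + integral \<ge> p\<close> (\<open>topological_pressure_ge\<close>,
  \<open>double_hofbauer_pressure_ge\<close>). Both bounds deal with words only. That no finite partition yields
  more entropy than the words is the Kolmogorov-Sinai theorem (\<open>ks_entropy_eq_word_entropy\<close>): every
  measurable partition is predicted by sufficiently long words up to a small error, and Fano's
  inequality bounds the entropy of the error.

  For \<open>\<beta> \<ge> 1\<close> both run sums are at most 1 for every \<open>p > 0\<close>, so the pressure is at most 0, and the
  fixed points of the shift show that it is 0. For \<open>\<beta> < 1\<close> the equation has a positive root
  (\<open>pressure_equation_solvable\<close>). A function that vanishes on the right of 1 and is positive on the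
  left of 1 is not analytic at 1. The pressure is Lipschitz in \<open>\<beta>\<close>, and so is the pressure of each
  single Hofbauer model, which also vanishes at \<open>\<beta> = 1\<close>; so the three limits in the second part
  are all 0.

  For the derivative, \<open>ln (run_sum \<gamma> \<beta> p) + ln (run_sum \<delta> \<beta> p)\<close> is convex in \<open>(\<beta>, p)\<close> and vanishes along
  the graph of the pressure, so its tangent planes (\<open>ln_run_sum_tangent\<close>) provide subgradients of the
  pressure: minus the mean cost of a cycle divided by its mean length. These are continuous in \<open>\<beta>\<close>, hence
  they are the derivative (\<open>derivative_of_subgradients\<close>). As \<open>\<beta>\<close> tends to 1 the mean cost stays bounded, but
  the mean length contains \<open>\<Sum>n. n * n powr (- \<delta>)\<close> in the limit, which diverges for \<open>\<delta> < 2\<close>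
  (\<open>length_moment_diverges\<close>); therefore the derivative tends to 0.
\<close>

section \<open>Entropy of finitely valued observables\<close>

text \<open>
  The entropy of the partition into the fibres of \<open>U\<close>, as the integral of the
  information function. In this form inequalities between entropies follow from inequalities that
  hold almost everywhere.
\<close>

definition shannon :: "'a measure \<Rightarrow> ('a \<Rightarrow> 'b) \<Rightarrow> real" where
  "shannon M U = (\<integral>x. - ln (measure M {y \<in> space M. U y = U x}) \<partial>M)"

lemma simple_function_fibre:
  assumes "simple_function M U"
  shows "{y \<in> space M. U y = v} \<in> sets M"
proof (cases "v \<in> U ` space M")
  case True
  have "{y \<in> space M. U y = v} = U -` {v} \<inter> space M" by auto
  then show ?thesis using assms True by (auto simp: simple_function_def)
next
  case False
  then have "{y \<in> space M. U y = v} = {}" by auto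
  then show ?thesis by (metis sets.empty_sets)
qed

context prob_space
begin

lemma simple_function_integral:
  fixes \<phi> :: "'b \<Rightarrow> real"
  assumes U: "simple_function M U"
  shows "integrable M (\<lambda>x. \<phi> (U x))"
    and "(\<integral>x. \<phi> (U x) \<partial>M) = (\<Sum>v\<in>U ` space M. \<phi> v * prob {y \<in> space M. U y = v})"
proof -
  have fin: "finite (U ` space M)" using U by (simp add: simple_function_def)
  have eq: "\<phi> (U x) = (\<Sum>v\<in>U ` space M. \<phi> v * indicator {y \<in> space M. U y = v} x)"
    if "x \<in> space M" for x
  proof -
    have "(\<Sum>v\<in>U ` space M. \<phi> v * indicator {y \<in> space M. U y = v} x)
        = (\<Sum>v\<in>U ` space M. if v = U x then \<phi> v else 0)"
      using that by (intro sum.cong) (auto simp: indicator_def)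
    then show ?thesis using fin that by simp
  qed
  have int: "has_bochner_integral M (\<lambda>x. \<Sum>v\<in>U ` space M. \<phi> v * indicator {y \<in> space M. U y = v} x)
      (\<Sum>v\<in>U ` space M. \<phi> v * prob {y \<in> space M. U y = v})"
    using simple_function_fibre[OF U]
    by (intro has_bochner_integral_sum has_bochner_integral_mult_right has_bochner_integral_real_indicator)
       (auto simp: less_top[symmetric])
  have "has_bochner_integral M (\<lambda>x. \<phi> (U x)) (\<Sum>v\<in>U ` space M. \<phi> v * prob {y \<in> space M. U y = v})"
    using int by (subst has_bochner_integral_cong[OF refl eq refl])
  then show "integrable M (\<lambda>x. \<phi> (U x))"
    and "(\<integral>x. \<phi> (U x) \<partial>M) = (\<Sum>v\<in>U ` space M. \<phi> v * prob {y \<in> space M. U y = v})"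
    by (auto simp: has_bochner_integral_iff)
qed

lemma sum_prob_fibres:
  assumes U: "simple_function M U"
  shows "(\<Sum>v\<in>U ` space M. prob {y \<in> space M. U y = v}) = 1"
  using simple_function_integral(2)[OF U, of "\<lambda>_. 1"] by (simp add: prob_space)

text \<open>
  There are finitely many fibres, so those of measure 0 form a null set; outside of it logarithms
  of, and quotients by, probabilities of fibres are harmless.
\<close>

lemma AE_fibre_pos:
  assumes U: "simple_function M U"
  shows "AE x in M. 0 < prob {y \<in> space M. U y = U x}"
proof -
  let ?N = "\<Union>v\<in>{v \<in> U ` space M. prob {y \<in> space M. U y = v} = 0}. {y \<in> space M. U y = v}"
  have fin: "finite (U ` space M)" using U by (simp add: simple_function_def)
  have "?N \<in> null_sets M"
    using simple_function_fibre[OF U] fin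
    by (intro null_sets_UN' countable_finite) (auto simp: null_sets_def emeasure_eq_measure)
  moreover have "{x \<in> space M. \<not> 0 < prob {y \<in> space M. U y = U x}} \<subseteq> ?N"
    by (auto simp: not_less measure_le_0_iff)
  ultimately show ?thesis by (intro AE_I') auto
qed

text \<open>
  Integrate \<open>ln t \<le> t - 1\<close> for \<open>t = q / r\<close>, where \<open>r\<close>
  is the distribution of \<open>U\<close>. All upper bounds for entropies below are instances for
  suitable reference weights \<open>q\<close>.
\<close>

lemma gibbs_inequality:
  assumes U: "simple_function M U"
    and q0: "\<And>v. v \<in> U ` space M \<Longrightarrow> 0 \<le> q v"
    and qpos: "AE x in M. 0 < q (U x)"
    and q1: "(\<Sum>v\<in>U ` space M. q v) \<le> 1"
  shows "shannon M U \<le> (\<integral>x. - ln (q (U x)) \<partial>M)"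
proof -
  define r where "r v = prob {y \<in> space M. U y = v}" for v
  have r0: "r v \<ge> 0" for v by (simp add: r_def)
  have S: "shannon M U = (\<integral>x. - ln (r (U x)) \<partial>M)" by (simp add: shannon_def r_def)
  have int: "integrable M (\<lambda>x. \<phi> (U x))" for \<phi> :: "'b \<Rightarrow> real"
    by (rule simple_function_integral(1)[OF U])
  have "(\<integral>x. - ln (r (U x)) \<partial>M) \<le> (\<integral>x. - ln (q (U x)) + (q (U x) / r (U x) - 1) \<partial>M)"
  proof (rule integral_mono_AE)
    show "integrable M (\<lambda>x. - ln (r (U x)))" by (rule int)
    show "integrable M (\<lambda>x. - ln (q (U x)) + (q (U x) / r (U x) - 1))"
      by (rule int[of "\<lambda>v. - ln (q v) + (q v / r v - 1)"])
    show "AE x in M. - ln (r (U x)) \<le> - ln (q (U x)) + (q (U x) / r (U x) - 1)"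
      using qpos AE_fibre_pos[OF U]
    proof eventually_elim
      case (elim x)
      then have "ln (q (U x) / r (U x)) \<le> q (U x) / r (U x) - 1"
        by (intro ln_le_minus_one) (auto simp: r_def)
      moreover have "ln (q (U x) / r (U x)) = ln (q (U x)) - ln (r (U x))"
        using elim by (simp add: ln_div r_def)
      ultimately show ?case by linarith
    qed
  qed
  also have "\<dots> = (\<integral>x. - ln (q (U x)) \<partial>M) + (\<integral>x. q (U x) / r (U x) - 1 \<partial>M)"
    by (intro Bochner_Integration.integral_add int[of "\<lambda>v. - ln (q v)"] int[of "\<lambda>v. q v / r v - 1"])
  also have "(\<integral>x. q (U x) / r (U x) - 1 \<partial>M) = (\<Sum>v\<in>U ` space M. (q v / r v - 1) * r v)"
    unfolding r_def by (rule simple_function_integral(2)[OF U])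
  also have "\<dots> \<le> (\<Sum>v\<in>U ` space M. q v - r v)"
    using q0 r0 by (intro sum_mono) (auto simp: field_simps)
  also have "\<dots> \<le> 0"
    using q1 sum_prob_fibres[OF U] by (simp add: sum_subtractf r_def)
  finally show ?thesis by (simp add: S)
qed

text \<open>
  A finer observable has smaller fibres, and thus more information at every point.
\<close>

lemma shannon_mono:
  assumes U: "simple_function M U" and V: "simple_function M V"
    and coarser: "\<And>x y. x \<in> space M \<Longrightarrow> y \<in> space M \<Longrightarrow> V x = V y \<Longrightarrow> U x = U y"
  shows "shannon M U \<le> shannon M V"
  unfolding shannon_def
proof (rule integral_mono_AE)
  show "integrable M (\<lambda>x. - ln (prob {y \<in> space M. U y = U x}))"
    using simple_function_integral(1)[OF U, of "\<lambda>v. - ln (prob {y \<in> space M. U y = v})"] .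
  show "integrable M (\<lambda>x. - ln (prob {y \<in> space M. V y = V x}))"
    using simple_function_integral(1)[OF V, of "\<lambda>v. - ln (prob {y \<in> space M. V y = v})"] .
  show "AE x in M. - ln (prob {y \<in> space M. U y = U x}) \<le> - ln (prob {y \<in> space M. V y = V x})"
    using AE_fibre_pos[OF V] AE_space
  proof eventually_elim
    case (elim x)
    have "prob {y \<in> space M. V y = V x} \<le> prob {y \<in> space M. U y = U x}"
      using elim coarser by (intro finite_measure_mono simple_function_fibre[OF U]) blast
    then show ?case using elim by simp
  qed
qed

lemma shannon_nonneg: "0 \<le> shannon M U"
  unfolding shannon_def
proof (rule integral_nonneg_AE, rule AE_I2)
  fix x
  have "prob {y \<in> space M. U y = U x} = 0 \<or> 0 < prob {y \<in> space M. U y = U x}"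
    by (simp add: less_le)
  then show "0 \<le> - ln (prob {y \<in> space M. U y = U x})"
    using prob_le_1[of "{y \<in> space M. U y = U x}"] by auto
qed

text \<open>
  Gibbs' inequality for the weights \<open>prob (V = v) * q u v\<close>. For conditional
  probabilities \<open>q\<close> this would be the chain rule. Weights that do not depend on
  \<open>v\<close> give subadditivity, and weights concentrated near a guess for \<open>u\<close>
  based on \<open>v\<close> give Fano's inequality.
\<close>

lemma shannon_Pair_le_cross_entropy:
  assumes U: "simple_function M U" and V: "simple_function M V"
    and q0: "\<And>u v. 0 \<le> q u v"
    and qpos: "AE x in M. 0 < q (U x) (V x)"
    and q1: "\<And>v. (\<Sum>u\<in>U ` space M. q u v) \<le> 1"
  shows "shannon M (\<lambda>x. (U x, V x)) \<le> shannon M V + (\<integral>x. - ln (q (U x) (V x)) \<partial>M)"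
proof -
  let ?W = "\<lambda>x. (U x, V x)" and ?r = "\<lambda>v. prob {y \<in> space M. V y = v}"
  have fin: "finite (U ` space M)" "finite (V ` space M)"
    using U V by (auto simp: simple_function_def)
  have W: "simple_function M ?W" using U V by (rule simple_function_Pair)
  have "shannon M ?W \<le> (\<integral>x. - ln ((\<lambda>(u, v). ?r v * q u v) (?W x)) \<partial>M)"
  proof (rule gibbs_inequality[OF W])
    show "AE x in M. 0 < (\<lambda>(u, v). ?r v * q u v) (?W x)"
      using AE_fibre_pos[OF V] qpos by eventually_elim auto
    have "(\<Sum>w\<in>?W ` space M. (\<lambda>(u, v). ?r v * q u v) w)
        \<le> (\<Sum>w\<in>U ` space M \<times> V ` space M. (\<lambda>(u, v). ?r v * q u v) w)"
      using fin q0 by (intro sum_mono2) auto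
    also have "\<dots> = (\<Sum>v\<in>V ` space M. ?r v * (\<Sum>u\<in>U ` space M. q u v))"
      unfolding sum.cartesian_product[symmetric] by (subst sum.swap) (simp add: sum_distrib_left)
    also have "\<dots> \<le> (\<Sum>v\<in>V ` space M. ?r v * 1)"
      by (intro sum_mono mult_left_mono q1) auto
    also have "\<dots> = 1" using sum_prob_fibres[OF V] by simp
    finally show "(\<Sum>w\<in>?W ` space M. (\<lambda>(u, v). ?r v * q u v) w) \<le> 1" .
  qed (use q0 in auto)
  also have "\<dots> = (\<integral>x. - ln (?r (V x)) + - ln (q (U x) (V x)) \<partial>M)"
  proof (rule integral_cong_AE)
    show "AE x in M. - ln ((\<lambda>(u, v). ?r v * q u v) (?W x)) = - ln (?r (V x)) + - ln (q (U x) (V x))"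
      using AE_fibre_pos[OF V] qpos
    proof eventually_elim
      case (elim x)
      have "ln (?r (V x) * q (U x) (V x)) = ln (?r (V x)) + ln (q (U x) (V x))"
        using elim by (simp add: ln_mult)
      then show ?case by simp
    qed
    show "(\<lambda>x. - ln ((\<lambda>(u, v). ?r v * q u v) (?W x))) \<in> borel_measurable M"
      using simple_function_integral(1)[OF W, of "\<lambda>w. - ln ((\<lambda>(u, v). ?r v * q u v) w)"] by simp
    show "(\<lambda>x. - ln (?r (V x)) + - ln (q (U x) (V x))) \<in> borel_measurable M"
      using simple_function_integral(1)[OF W, of "\<lambda>(u, v). - ln (?r v) + - ln (q u v)"] by simp
  qed
  also have "\<dots> = shannon M V + (\<integral>x. - ln (q (U x) (V x)) \<partial>M)"
    unfolding shannon_def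
    using simple_function_integral(1)[OF V, of "\<lambda>v. - ln (?r v)"]
      simple_function_integral(1)[OF W, of "\<lambda>(u, v). - ln (q u v)"]
    by (intro Bochner_Integration.integral_add) auto
  finally show ?thesis .
qed

end

section \<open>Itineraries and entropy rates\<close>

text \<open>
  The limit is the infimum of the averages: division with remainder by some \<open>k\<close> whose
  average is almost minimal controls all large averages.
\<close>

lemma fekete:
  fixes a :: "nat \<Rightarrow> real"
  assumes sub: "\<And>m n. a (m + n) \<le> a m + a n" and nonneg: "\<And>n. 0 \<le> a n"
  shows "convergent (\<lambda>n. a n / real n)"
proof -
  define S where "S = (\<lambda>n. a n / real n) ` {1..}"
  define l where "l = Inf S"
  have bdd: "bdd_below S"
    unfolding S_def by (rule bdd_belowI2[of _ 0]) (simp add: nonneg)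
  have ne: "S \<noteq> {}" by (auto simp: S_def)
  have lower: "l \<le> a n / real n" if "n \<ge> 1" for n
    unfolding l_def using that bdd by (intro cInf_lower) (auto simp: S_def)
  have mult: "a (q * k + r) \<le> real q * a k + a r" for q k r
  proof (induction q)
    case (Suc q)
    have "a (Suc q * k + r) \<le> a k + a (q * k + r)"
      using sub[of k "q * k + r"] by (simp add: add.assoc)
    with Suc show ?case by (simp add: algebra_simps)
  qed simp
  have "(\<lambda>n. a n / real n) \<longlonglongrightarrow> l"
  proof (rule order_tendstoI)
    fix y assume y: "y < l"
    show "\<forall>\<^sub>F n in sequentially. y < a n / real n"
      using eventually_ge_at_top[of 1]
    proof eventually_elim
      case (elim n)
      with lower[of n] y show ?case by linarith
    qed
  next
    fix y assume "l < y"
    then obtain k where k: "k \<ge> 1" "a k / real k < y"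
      using cInf_lessD[OF ne, of y] by (auto simp: l_def S_def)
    define C where "C = (\<Sum>r<k. a r)"
    have C: "a r \<le> C" if "r < k" for r
      unfolding C_def using that nonneg by (intro member_le_sum) auto
    have "((\<lambda>n. a k / real k + C / real n) \<longlongrightarrow> a k / real k + 0) sequentially"
      by (intro tendsto_add tendsto_const lim_const_over_n)
    then have "\<forall>\<^sub>F n in sequentially. a k / real k + C / real n < y"
      using k by (intro order_tendstoD(2)[where a = y]) auto
    then show "\<forall>\<^sub>F n in sequentially. a n / real n < y"
      using eventually_ge_at_top[of 1]
    proof eventually_elim
      case (elim n)
      have div_le: "real (n div k) \<le> real n / real k"
        using k div_times_less_eq_dividend[of n k]
        by (simp add: pos_le_divide_eq del: of_nat_mult add: of_nat_mult[symmetric])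
      have "a n \<le> real (n div k) * a k + a (n mod k)"
        using mult[of "n div k" k "n mod k"] by simp
      also have "\<dots> \<le> (real n / real k) * a k + C"
        using k nonneg by (intro add_mono mult_right_mono C) (auto simp: div_le)
      finally have "a n / real n \<le> ((real n / real k) * a k + C) / real n"
        by (intro divide_right_mono) auto
      also have "\<dots> = a k / real k + C / real n"
        using elim k by (simp add: field_simps)
      finally show ?case using elim by linarith
    qed
  qed
  then show ?thesis by (rule convergentI)
qed

definition itinerary :: "('a \<Rightarrow> 'a) \<Rightarrow> ('a \<Rightarrow> 'b) \<Rightarrow> nat \<Rightarrow> 'a \<Rightarrow> 'b list" where
  "itinerary T X n x = map (\<lambda>i. X ((T ^^ i) x)) [0..<n]"

lemma itinerary_eq_iff:
  "itinerary T X n x = itinerary T X n y \<longleftrightarrow> (\<forall>i<n. X ((T ^^ i) x) = X ((T ^^ i) y))"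
  by (auto simp: itinerary_def list_eq_iff_nth_eq)

lemma itinerary_0 [simp]: "itinerary T X 0 x = []"
  by (simp add: itinerary_def)

lemma itinerary_Suc: "itinerary T X (Suc n) x = X x # itinerary T X n (T x)"
  by (simp add: itinerary_def map_upt_Suc funpow_swap1 del: upt_Suc)

lemma itinerary_add: "itinerary T X (m + n) x = itinerary T X m x @ itinerary T X n ((T ^^ m) x)"
  by (induction m arbitrary: x) (simp_all add: itinerary_Suc funpow_swap1)

lemma simple_function_compose_measurable:
  assumes "simple_function M X" "T \<in> measurable M M"
  shows "simple_function M (\<lambda>x. X (T x))"
proof -
  have "(\<lambda>x. X (T x)) ` space M \<subseteq> X ` space M"
    using measurable_space[OF assms(2)] by auto
  then have "finite ((\<lambda>x. X (T x)) ` space M)"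
    using assms(1) finite_subset by (auto simp: simple_function_def)
  moreover have "(\<lambda>x. X (T x)) -` {v} \<inter> space M \<in> sets M" for v
  proof -
    have "(\<lambda>x. X (T x)) -` {v} \<inter> space M = T -` {y \<in> space M. X y = v} \<inter> space M"
      using measurable_space[OF assms(2)] by auto
    then show ?thesis
      using measurable_sets[OF assms(2) simple_function_fibre[OF assms(1)]] by simp
  qed
  ultimately show ?thesis by (simp add: simple_function_def)
qed

lemma measurable_funpow:
  assumes "T \<in> measurable M M" shows "(T ^^ n) \<in> measurable M M"
  by (induction n) (use assms in \<open>auto simp: measurable_comp\<close>)

lemma simple_function_itinerary:
  assumes X: "simple_function M X" and T: "T \<in> measurable M M"
  shows "simple_function M (itinerary T X n)"
proof (induction n)
  case 0
  show ?case by (simp add: itinerary_def[abs_def] simple_function_def)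
next
  case (Suc n)
  have "simple_function M (\<lambda>x. (\<lambda>(a, b). a # b) (X x, itinerary T X n (T x)))"
    using X simple_function_compose_measurable[OF Suc T]
    by (intro simple_function_compose1[OF simple_function_Pair])
  then show ?case by (simp add: itinerary_Suc[abs_def])
qed

definition cell :: "'a set set \<Rightarrow> 'a \<Rightarrow> 'a set" where
  "cell \<xi> x = (THE A. A \<in> \<xi> \<and> x \<in> A)"

lemma cell_eq:
  assumes "partition_on S \<xi>" "A \<in> \<xi>" "x \<in> A"
  shows "cell \<xi> x = A"
  unfolding cell_def using assms
  by (intro the_equality) (auto simp: partition_on_def disjoint_def)

lemma cell_in:
  assumes "partition_on S \<xi>" "x \<in> S"
  shows "cell \<xi> x \<in> \<xi>" "x \<in> cell \<xi> x"
proof -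
  obtain A where "A \<in> \<xi>" "x \<in> A" using assms by (auto simp: partition_on_def)
  with cell_eq[OF assms(1) this] show "cell \<xi> x \<in> \<xi>" "x \<in> cell \<xi> x" by auto
qed

lemma simple_function_cell:
  assumes "finite \<xi>" "\<xi> \<subseteq> sets M" "partition_on (space M) \<xi>"
  shows "simple_function M (cell \<xi>)"
  unfolding simple_function_def
proof safe
  have "cell \<xi> ` space M \<subseteq> \<xi>" using cell_in[OF assms(3)] by auto
  then show "finite (cell \<xi> ` space M)" using assms(1) finite_subset by auto
next
  fix x assume x: "x \<in> space M"
  have "cell \<xi> -` {cell \<xi> x} \<inter> space M = cell \<xi> x"
    using cell_in[OF assms(3)] cell_eq[OF assms(3)] x assms(3)
    by (auto simp: partition_on_def)
  then show "cell \<xi> -` {cell \<xi> x} \<inter> space M \<in> sets M"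
    using cell_in[OF assms(3) x] assms(2) by auto
qed

lemma (in prob_space) partition_entropy_fibres:
  assumes U: "simple_function M U"
  shows "partition_entropy M ((\<lambda>x. {y \<in> space M. U y = U x}) ` space M) = shannon M U"
proof -
  let ?f = "\<lambda>v. {y \<in> space M. U y = v}"
  have inj: "inj_on ?f (U ` space M)" by (rule inj_onI) auto
  have "(\<lambda>x. {y \<in> space M. U y = U x}) ` space M = ?f ` (U ` space M)" by auto
  then have "partition_entropy M ((\<lambda>x. {y \<in> space M. U y = U x}) ` space M)
      = (\<Sum>v\<in>U ` space M. - ln (prob (?f v)) * prob (?f v))"
    by (simp add: partition_entropy_def sum.reindex[OF inj] sum_negf mult.commute)
  then show ?thesis
    unfolding shannon_def
    using simple_function_integral(2)[OF U, of "\<lambda>v. - ln (prob (?f v))"] by simp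
qed

text \<open>
  A non-empty member of the common refinement contains a point \<open>x\<close>, and each of the
  sets that are intersected must be the one that contains \<open>x\<close>; so the members are the
  fibres of the itinerary. For \<open>n = 0\<close> the refinement of the empty family consists of
  the universe of the type instead of \<open>space M\<close>.
\<close>

lemma iterated_partition_eq_fibres:
  assumes \<xi>: "partition_on (space M) \<xi>" and T: "\<And>x. x \<in> space M \<Longrightarrow> T x \<in> space M" and n: "n > 0"
  shows "iterated_partition M T \<xi> n =
    (\<lambda>x. {y \<in> space M. itinerary T (cell \<xi>) n y = itinerary T (cell \<xi>) n x}) ` space M"
proof -
  define P where "P i = (\<lambda>A. (T ^^ i) -` A \<inter> space M) ` \<xi>" for i
  have Ti: "(T ^^ i) x \<in> space M" if "x \<in> space M" for i x
    by (induction i) (use that T in auto)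
  have memb: "B = (T ^^ i) -` cell \<xi> ((T ^^ i) x) \<inter> space M" if "B \<in> P i" "x \<in> B" for B i x
    using that cell_eq[OF \<xi>] by (auto simp: P_def)
  have inP: "(T ^^ i) -` cell \<xi> ((T ^^ i) x) \<inter> space M \<in> P i" if "x \<in> space M" for i x
    using cell_in(1)[OF \<xi> Ti[OF that]] by (auto simp: P_def)
  have self: "x \<in> (T ^^ i) -` cell \<xi> ((T ^^ i) x) \<inter> space M" if "x \<in> space M" for i x
    using cell_in(2)[OF \<xi> Ti[OF that]] that by auto
  have fibre: "{y \<in> space M. itinerary T (cell \<xi>) n y = itinerary T (cell \<xi>) n x}
      = (\<Inter>i<n. (T ^^ i) -` cell \<xi> ((T ^^ i) x) \<inter> space M)" if x: "x \<in> space M" for x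
  proof (intro set_eqI iffI)
    fix y assume "y \<in> {y \<in> space M. itinerary T (cell \<xi>) n y = itinerary T (cell \<xi>) n x}"
    then have "y \<in> space M" "\<And>i. i < n \<Longrightarrow> cell \<xi> ((T ^^ i) y) = cell \<xi> ((T ^^ i) x)"
      by (auto simp: itinerary_eq_iff)
    then show "y \<in> (\<Inter>i<n. (T ^^ i) -` cell \<xi> ((T ^^ i) x) \<inter> space M)"
      using self[of y] by auto
  next
    fix y assume y: "y \<in> (\<Inter>i<n. (T ^^ i) -` cell \<xi> ((T ^^ i) x) \<inter> space M)"
    then have "y \<in> space M" using n by blast
    moreover have "cell \<xi> ((T ^^ i) y) = cell \<xi> ((T ^^ i) x)" if "i < n" for i
    proof (rule cell_eq[OF \<xi> cell_in(1)[OF \<xi> Ti[OF x]]])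
      show "(T ^^ i) y \<in> cell \<xi> ((T ^^ i) x)" using y that by blast
    qed
    ultimately show "y \<in> {y \<in> space M. itinerary T (cell \<xi>) n y = itinerary T (cell \<xi>) n x}"
      by (auto simp: itinerary_eq_iff)
  qed
  have "iterated_partition M T \<xi> n = common_refinement (P ` {..<n})"
    by (simp add: iterated_partition_def P_def)
  also have "\<dots> = (\<lambda>x. \<Inter>i<n. (T ^^ i) -` cell \<xi> ((T ^^ i) x) \<inter> space M) ` space M"
  proof (intro set_eqI iffI)
    fix D assume "D \<in> common_refinement (P ` {..<n})"
    then obtain f where f: "\<And>i. i < n \<Longrightarrow> f (P i) \<in> P i" and D: "D = (\<Inter>i<n. f (P i))" and "D \<noteq> {}"
      by (auto simp: common_refinement)
    then obtain x where x: "x \<in> D" by auto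
    have "f (P 0) \<subseteq> space M" using f[OF n] by (auto simp: P_def)
    then have xM: "x \<in> space M" using x n by (auto simp: D)
    have "D = (\<Inter>i<n. (T ^^ i) -` cell \<xi> ((T ^^ i) x) \<inter> space M)"
      unfolding D using f x by (intro INF_cong refl memb) (auto simp: D)
    then show "D \<in> (\<lambda>x. \<Inter>i<n. (T ^^ i) -` cell \<xi> ((T ^^ i) x) \<inter> space M) ` space M"
      using xM by blast
  next
    fix D assume "D \<in> (\<lambda>x. \<Inter>i<n. (T ^^ i) -` cell \<xi> ((T ^^ i) x) \<inter> space M) ` space M"
    then obtain x where x: "x \<in> space M" and D: "D = (\<Inter>i<n. (T ^^ i) -` cell \<xi> ((T ^^ i) x) \<inter> space M)"
      by blast
    define f where "f Q = (SOME B. B \<in> Q \<and> x \<in> B)" for Q :: "'a set set"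
    have f: "f (P i) \<in> P i \<and> x \<in> f (P i)" for i
      unfolding f_def by (rule someI_ex) (use inP[OF x] self[OF x] in blast)
    have feq: "f (P i) = (T ^^ i) -` cell \<xi> ((T ^^ i) x) \<inter> space M" for i
      using f memb by auto
    have "D = \<Inter> (f ` (P ` {..<n}))" unfolding D image_image feq by (rule refl)
    moreover have "D \<noteq> {}" using self[OF x] unfolding D by blast
    ultimately show "D \<in> common_refinement (P ` {..<n})"
      using f by (auto simp: common_refinement)
  qed
  also have "\<dots> = (\<lambda>x. {y \<in> space M. itinerary T (cell \<xi>) n y = itinerary T (cell \<xi>) n x}) ` space M"
    using fibre by (intro image_cong) auto
  finally show ?thesis .
qed

locale measure_preserving = prob_space M for M :: "'a measure" +
  fixes T :: "'a \<Rightarrow> 'a"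
  assumes T_measurable [measurable]: "T \<in> measurable M M"
    and T_invariant: "distr M M T = M"
begin

lemma integral_compose:
  fixes f :: "'a \<Rightarrow> real"
  assumes [measurable]: "f \<in> borel_measurable M"
  shows "(\<integral>x. f (T x) \<partial>M) = (\<integral>x. f x \<partial>M)"
  using integral_distr[OF T_measurable, of f] by (simp add: T_invariant)

lemma integrable_compose:
  fixes f :: "'a \<Rightarrow> real"
  assumes "integrable M f"
  shows "integrable M (\<lambda>x. f (T x))"
  using integrable_distr[OF T_measurable, of f] assms by (simp add: T_invariant)

lemma prob_compose:
  assumes "{y \<in> space M. Q y} \<in> sets M"
  shows "prob {y \<in> space M. Q (T y)} = prob {y \<in> space M. Q y}"
proof -
  have "prob {y \<in> space M. Q y} = measure (distr M M T) {y \<in> space M. Q y}"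
    by (simp add: T_invariant)
  also have "\<dots> = prob (T -` {y \<in> space M. Q y} \<inter> space M)"
    using assms by (intro measure_distr) auto
  also have "T -` {y \<in> space M. Q y} \<inter> space M = {y \<in> space M. Q (T y)}"
    using measurable_space[OF T_measurable] by auto
  finally show ?thesis by simp
qed

lemma funpow: "measure_preserving M (T ^^ n)"
proof (induction n)
  case 0
  show ?case by unfold_locales (auto simp: id_def distr_id)
next
  case (Suc n)
  interpret S: measure_preserving M "T ^^ n" by fact
  show ?case
  proof unfold_locales
    show *: "T ^^ Suc n \<in> measurable M M" by (rule measurable_funpow) simp
    have "distr M M (T ^^ Suc n) = distr (distr M M (T ^^ n)) M T"
      by (subst distr_distr) (auto simp: comp_def)
    then show "distr M M (T ^^ Suc n) = M" by (simp add: S.T_invariant T_invariant)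
  qed
qed

lemma shannon_compose:
  assumes U: "simple_function M U"
  shows "shannon M (\<lambda>x. U (T x)) = shannon M U"
proof -
  have "shannon M (\<lambda>x. U (T x)) = (\<integral>x. - ln (prob {y \<in> space M. U y = U (T x)}) \<partial>M)"
    unfolding shannon_def using prob_compose[OF simple_function_fibre[OF U]] by simp
  also have "\<dots> = shannon M U"
    unfolding shannon_def
    using simple_function_integral(1)[OF U, of "\<lambda>v. - ln (prob {y \<in> space M. U y = v})"]
    by (intro integral_compose) auto
  finally show ?thesis .
qed

text \<open>
  The second part of an itinerary of length \<open>m + n\<close> is an itinerary of length
  \<open>n\<close> of a shifted point, which has the same entropy by invariance.
\<close>

lemma shannon_itinerary_subadditive:
  assumes X: "simple_function M X"
  shows "shannon M (itinerary T X (m + n)) \<le> shannon M (itinerary T X m) + shannon M (itinerary T X n)"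
proof -
  interpret S: measure_preserving M "T ^^ m" by (rule funpow)
  let ?U = "\<lambda>x. itinerary T X n ((T ^^ m) x)" and ?V = "itinerary T X m"
  have U: "simple_function M ?U" and V: "simple_function M ?V"
    using simple_function_itinerary[OF X T_measurable]
      simple_function_compose_measurable[OF simple_function_itinerary[OF X T_measurable] S.T_measurable]
    by auto
  have "shannon M (itinerary T X (m + n)) \<le> shannon M (\<lambda>x. (?U x, ?V x))"
    by (rule shannon_mono[OF simple_function_itinerary[OF X T_measurable] simple_function_Pair[OF U V]])
      (auto simp: itinerary_add)
  also have "\<dots> \<le> shannon M ?V + (\<integral>x. - ln (prob {y \<in> space M. ?U y = ?U x}) \<partial>M)"
    using AE_fibre_pos[OF U] sum_prob_fibres[OF U]
    by (intro shannon_Pair_le_cross_entropy[OF U V, of "\<lambda>u v. prob {y \<in> space M. ?U y = u}"]) auto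
  also have "(\<integral>x. - ln (prob {y \<in> space M. ?U y = ?U x}) \<partial>M) = shannon M (itinerary T X n)"
    using S.shannon_compose[OF simple_function_itinerary[OF X T_measurable]] by (simp add: shannon_def)
  finally show ?thesis .
qed

lemma entropy_rate_converges:
  assumes X: "simple_function M X"
  shows "convergent (\<lambda>n. shannon M (itinerary T X n) / real n)"
  by (intro fekete shannon_itinerary_subadditive X shannon_nonneg)

text \<open>
  The entropy rate is defined by \<open>lim\<close>, which says nothing before convergence is
  known; Fekete's lemma supplies it.
\<close>

lemma partition_entropy_rate_tendsto:
  assumes "finite \<xi>" "\<xi> \<subseteq> sets M" "partition_on (space M) \<xi>"
  shows "(\<lambda>n. shannon M (itinerary T (cell \<xi>) n) / real n) \<longlonglongrightarrow> partition_entropy_rate M T \<xi>"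
proof -
  have X: "simple_function M (cell \<xi>)" by (rule simple_function_cell[OF assms])
  have "partition_entropy M (iterated_partition M T \<xi> n) / real n
      = shannon M (itinerary T (cell \<xi>) n) / real n" for n
  proof (cases "n = 0")
    case False
    then have "partition_entropy M (iterated_partition M T \<xi> n) = shannon M (itinerary T (cell \<xi>) n)"
      using measurable_space[OF T_measurable]
      by (simp add: iterated_partition_eq_fibres[OF assms(3)]
          partition_entropy_fibres[OF simple_function_itinerary[OF X T_measurable]])
    then show ?thesis by simp
  qed simp
  then have "partition_entropy_rate M T \<xi> = lim (\<lambda>n. shannon M (itinerary T (cell \<xi>) n) / real n)"
    unfolding partition_entropy_rate_def by (rule arg_cong[OF ext])
  then show ?thesis
    using entropy_rate_converges[OF X] by (simp add: convergent_LIMSEQ_iff)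
qed

end

section \<open>The shift space\<close>

definition initial_word :: "nat \<Rightarrow> omega \<Rightarrow> bool list" where
  "initial_word n x = map x [0..<n]"

definition cylinder :: "bool list \<Rightarrow> omega set" where
  "cylinder w = {x. initial_word (length w) x = w}"

lemma length_initial_word [simp]: "length (initial_word n x) = n"
  by (simp add: initial_word_def)

lemma initial_word_eq_iff: "initial_word n x = initial_word n y \<longleftrightarrow> (\<forall>i<n. x i = y i)"
  by (auto simp: initial_word_def list_eq_iff_nth_eq)

lemma initial_word_0 [simp]: "initial_word 0 x = []"
  by (simp add: initial_word_def)

lemma initial_word_Suc: "initial_word (Suc n) x = x 0 # initial_word n (shift x)"
  by (simp only: initial_word_def shift_def map_upt_Suc)

lemma initial_word_Suc_append: "initial_word (Suc n) x = initial_word n x @ [x n]"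
  by (simp add: initial_word_def)

lemma shift_funpow: "(shift ^^ n) x i = x (n + i)"
proof (induction n arbitrary: i)
  case (Suc n)
  have "(shift ^^ Suc n) x i = (shift ^^ n) x (Suc i)"
    by (simp only: funpow.simps comp_apply shift_def)
  then show ?case using Suc by simp
qed simp

lemma take_initial_word: "n \<le> m \<Longrightarrow> take n (initial_word m x) = initial_word n x"
  by (simp only: initial_word_def take_map take_upt add_0)

lemma take_drop_initial_word: "k + n \<le> m \<Longrightarrow> take n (drop k (initial_word m x)) = initial_word n ((shift ^^ k) x)"
  by (rule nth_equalityI) (simp_all add: initial_word_def shift_funpow)

lemma itinerary_head: "itinerary shift (\<lambda>x. x 0) n x = initial_word n x"
  unfolding itinerary_def initial_word_def shift_funpow by simp

lemma in_cylinder_iff: "x \<in> cylinder w \<longleftrightarrow> (\<forall>i<length w. x i = w ! i)"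
  unfolding cylinder_def initial_word_def mem_Collect_eq list_eq_iff_nth_eq by simp

lemma initial_word_in_cylinder [simp]: "x \<in> cylinder (initial_word n x)"
  by (simp add: cylinder_def)

lemma open_cylinder: "open (cylinder w)"
proof -
  have *: "open ((\<lambda>x::omega. x i) -` {b})" for i b
  proof (rule open_vimage)
    show "open {b}" by (rule discrete_topology_class.open_discrete)
    show "continuous_on UNIV (\<lambda>x::omega. x i)" by (rule continuous_on_product_coordinates)
  qed
  have "cylinder w = (\<Inter>i\<in>{..<length w}. (\<lambda>x. x i) -` {w ! i})"
    unfolding set_eq_iff INT_iff vimage_singleton_eq in_cylinder_iff Ball_def lessThan_iff by blast
  moreover have "open (\<Inter>i\<in>{..<length w}. (\<lambda>x::omega. x i) -` {w ! i})"
    by (intro open_INT finite_lessThan ballI *)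
  ultimately show ?thesis by (simp only:)
qed

text \<open>
  A basic open set of the product topology restricts finitely many coordinates only.
\<close>

lemma open_contains_cylinder:
  assumes "open U" "x \<in> U"
  shows "\<exists>n. cylinder (initial_word n x) \<subseteq> U"
proof -
  have "openin (product_topology (\<lambda>_::nat. euclidean :: bool topology) UNIV) U"
    using assms(1) by (simp add: open_fun_def)
  from product_topology_open_contains_basis[OF this assms(2)]
  obtain X where x: "x \<in> Pi\<^sub>E UNIV X" and fin: "finite {i. X i \<noteq> UNIV}" and U: "Pi\<^sub>E UNIV X \<subseteq> U"
    by auto
  from fin have "\<exists>n. {i. X i \<noteq> UNIV} \<subseteq> {..<n}"
    by (simp only: finite_nat_iff_bounded)
  then obtain n where "{i. X i \<noteq> UNIV} \<subseteq> {..<n}" by (rule exE)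
  then have n: "i < n" if "X i \<noteq> UNIV" for i using that by blast
  have "cylinder (initial_word n x) \<subseteq> Pi\<^sub>E UNIV X"
  proof
    fix y assume y: "y \<in> cylinder (initial_word n x)"
    have "y i \<in> X i" for i
    proof (cases "X i = UNIV")
      case False
      then have "y i = x i" using n[of i] y by (simp add: in_cylinder_iff initial_word_def)
      then show ?thesis using PiE_mem[OF x, of i] by simp
    qed simp
    then show "y \<in> Pi\<^sub>E UNIV X" by (simp add: PiE_iff)
  qed
  with U show ?thesis by blast
qed

text \<open>
  There are countably many words, so every open set is a countable union of cylinders.
\<close>

lemma sets_borel_cylinders: "sets (borel :: omega measure) = sigma_sets UNIV (range cylinder)"
proof
  have "U \<in> sigma_sets UNIV (range cylinder)" if "open U" for U
  proof -
    have "U = \<Union> (cylinder ` {w. cylinder w \<subseteq> U})"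
      using open_contains_cylinder[OF that] initial_word_in_cylinder by blast
    moreover have "\<Union> (cylinder ` {w. cylinder w \<subseteq> U}) \<in> sigma_sets UNIV (range cylinder)"
      by (rule sigma_sets_UNION) (use sigma_sets.Basic in blast)+
    ultimately show ?thesis by metis
  qed
  then show "sets (borel :: omega measure) \<subseteq> sigma_sets UNIV (range cylinder)"
    unfolding borel_def using sigma_sets_mono[of "{S. open S}" UNIV "range cylinder"] by auto
  have "range cylinder \<subseteq> sets (borel :: omega measure)"
    using open_cylinder by auto
  then show "sigma_sets UNIV (range cylinder) \<subseteq> sets (borel :: omega measure)"
    by (metis sets.sigma_sets_subset space_borel)
qed

text \<open>
  Two cylinders that meet are nested.
\<close>

lemma Int_stable_cylinders: "Int_stable (insert {} (range cylinder))"
proof -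
  have "cylinder v \<inter> cylinder w \<in> insert {} (range cylinder)" for v w
  proof (cases "cylinder v \<inter> cylinder w = {}")
    case False
    then obtain x where x: "x \<in> cylinder v" "x \<in> cylinder w" by blast
    define m where "m = max (length v) (length w)"
    have vw: "i < m \<longleftrightarrow> i < length v \<or> i < length w" for i
      by (auto simp: m_def)
    have "y \<in> cylinder v \<inter> cylinder w \<longleftrightarrow> y \<in> cylinder (initial_word m x)" for y
    proof -
      have "y \<in> cylinder v \<inter> cylinder w \<longleftrightarrow> (\<forall>i<length v. y i = x i) \<and> (\<forall>i<length w. y i = x i)"
        using x by (simp add: in_cylinder_iff)
      also have "\<dots> \<longleftrightarrow> (\<forall>i<m. y i = x i)" using vw by blast
      also have "\<dots> \<longleftrightarrow> y \<in> cylinder (initial_word m x)"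
        by (simp add: in_cylinder_iff initial_word_def)
      finally show ?thesis .
    qed
    then have "cylinder v \<inter> cylinder w = cylinder (initial_word m x)" by blast
    then show ?thesis by blast
  qed simp
  then show ?thesis by (simp add: Int_stable_def)
qed

lemma shift_measurable [measurable]: "shift \<in> borel_measurable borel"
proof -
  have "continuous_on UNIV (\<lambda>x. shift x i)" for i
    unfolding shift_def by (rule continuous_on_product_coordinates)
  then show ?thesis
    by (rule borel_measurable_continuous_onI[OF continuous_on_coordinatewise_then_product])
qed

lemma simple_function_initial_word:
  assumes "sets M = sets borel"
  shows "simple_function M (initial_word n)"
proof -
  have sp: "space M = UNIV" using sets_eq_imp_space_eq[OF assms] by simp
  have "range (initial_word n) \<subseteq> {w. set w \<subseteq> UNIV \<and> length w = n}"
    by (simp add: image_subset_iff)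
  then have fin: "finite (range (initial_word n))"
    by (rule finite_subset[OF _ finite_lists_length_eq[OF finite]])
  have "initial_word n -` {initial_word n x} \<inter> space M \<in> sets M" for x
  proof -
    have "initial_word n -` {initial_word n x} \<inter> space M = cylinder (initial_word n x)"
      by (simp only: cylinder_def vimage_def sp length_initial_word Int_UNIV_right singleton_iff)
    then show ?thesis using borel_open[OF open_cylinder] by (simp only: assms)
  qed
  then show ?thesis
    unfolding simple_function_def using fin by (simp only: sp ball_simps simp_thms image_iff) blast
qed

locale shift_system =
  fixes M :: "omega measure"
  assumes invariant: "M \<in> invariant_measures"

sublocale shift_system \<subseteq> measure_preserving M shift
proof -
  have M: "sets M = sets borel" "prob_space M" "distr M borel shift = M"
    using invariant by (auto simp: invariant_measures_def)
  interpret prob_space M by fact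
  show "measure_preserving M shift"
  proof unfold_locales
    show "shift \<in> measurable M M"
      using shift_measurable by (simp add: measurable_cong_sets[OF M(1) M(1)])
    have "distr M M shift = distr M borel shift"
      by (intro distr_cong) (simp_all add: M)
    then show "distr M M shift = M" by (simp add: M)
  qed
qed

context shift_system
begin

lemma sets_M [simp]: "sets M = sets borel"
  using invariant by (auto simp: invariant_measures_def)

lemma space_M [simp]: "space M = UNIV"
  using sets_eq_imp_space_eq[OF sets_M] by simp

lemma simple_initial_word: "simple_function M (initial_word n)"
  by (rule simple_function_initial_word) simp

lemma initial_word_set_measurable: "{x. initial_word n x \<in> D} \<in> sets M"
proof -
  have "{x. initial_word n x \<in> D} = initial_word n -` D \<inter> space M" by auto
  then show ?thesis using simple_functionD(2)[OF simple_initial_word] by metis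
qed

text \<open>
  The sets with this property form a sigma-algebra. For a countable union, continuity from below
  leaves finitely many members up to \<open>e / 2\<close>, and each of these is approximated with
  a share of the remaining \<open>e / 2\<close>.
\<close>

lemma approximate_by_cylinders:
  assumes "A \<in> sets M" "e > 0"
  shows "\<exists>n D. prob (sym_diff A {x. initial_word n x \<in> D}) < e"
proof -
  have meas: "sym_diff A {x. initial_word n x \<in> D} \<in> sets M" if "A \<in> sets M" for n D A
    using that initial_word_set_measurable by (intro sets.Un sets.Diff)
  have "A \<in> sigma_sets UNIV (range cylinder)"
    using assms(1) by (simp add: sets_borel_cylinders)
  then show ?thesis using assms(2)
  proof (induction arbitrary: e rule: sigma_sets.induct)
    case (Basic a)
    then obtain w where "a = cylinder w" by blast
    then have "sym_diff a {x. initial_word (length w) x \<in> {w}} = {}"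
      by (simp add: cylinder_def)
    then have "prob (sym_diff a {x. initial_word (length w) x \<in> {w}}) < e"
      using Basic(2) by (simp only: measure_empty)
    then show ?case by blast
  next
    case Empty
    have "sym_diff {} {x. initial_word 0 x \<in> {}} = {}" by simp
    then have "prob (sym_diff {} {x. initial_word 0 x \<in> {}}) < e"
      using Empty by (simp only: measure_empty)
    then show ?case by blast
  next
    case (Compl a)
    then obtain n D where "prob (sym_diff a {x. initial_word n x \<in> D}) < e" by blast
    moreover have "sym_diff (UNIV - a) {x. initial_word n x \<in> - D} = sym_diff a {x. initial_word n x \<in> D}"
      by blast
    ultimately have "prob (sym_diff (UNIV - a) {x. initial_word n x \<in> - D}) < e" by (simp only:)
    then show ?case by blast
  next
    case (Union a)
    have a: "a i \<in> sets M" for i using Union.hyps by (simp add: sets_borel_cylinders)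
    let ?B = "\<lambda>k. (\<Union>i<k. a i)"
    have "(\<lambda>k. prob (?B k)) \<longlonglongrightarrow> prob (\<Union>k. ?B k)"
    proof (rule finite_Lim_measure_incseq)
      show "range ?B \<subseteq> sets M" using a by (intro image_subsetI sets.finite_UN) auto
      show "incseq ?B" by (intro monoI UN_mono) auto
    qed
    moreover have "(\<Union>k. ?B k) = (\<Union>i. a i)" by blast
    ultimately have "\<forall>\<^sub>F k in sequentially. prob (\<Union>i. a i) - e / 2 < prob (?B k)"
      using Union.prems by (intro order_tendstoD) auto
    then obtain k where k: "prob (\<Union>i. a i) - e / 2 < prob (?B k)"
      by (auto simp: eventually_sequentially)
    have "\<exists>n D. prob (sym_diff (a i) {x. initial_word n x \<in> D}) < e / (2 * real (Suc k))" for i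
      using Union.IH[of "e / (2 * real (Suc k))" i] Union.prems by simp
    then obtain n D where nD: "\<And>i. prob (sym_diff (a i) {x. initial_word (n i) x \<in> D i}) < e / (2 * real (Suc k))"
      by metis
    define N where "N = (\<Sum>i<k. n i)"
    define E where "E = {w. \<exists>i<k. take (n i) w \<in> D i}"
    have nN: "n i \<le> N" if "i < k" for i
      unfolding N_def using that by (intro member_le_sum) auto
    have E: "initial_word N x \<in> E \<longleftrightarrow> (\<exists>i<k. initial_word (n i) x \<in> D i)" for x
      using nN by (auto simp: E_def take_initial_word)
    have m1: "(\<Union>i. a i) - ?B k \<in> sets M"
      using a by (intro sets.Diff sets.finite_UN sets.countable_nat_UN image_subsetI) auto
    have m2: "(\<Union>i<k. sym_diff (a i) {x. initial_word (n i) x \<in> D i}) \<in> sets M"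
      using meas[OF a] by (rule sets.finite_UN[OF finite_lessThan])
    have "prob (sym_diff (\<Union>i. a i) {x. initial_word N x \<in> E})
      \<le> prob (((\<Union>i. a i) - ?B k) \<union> (\<Union>i<k. sym_diff (a i) {x. initial_word (n i) x \<in> D i}))"
    proof (rule finite_measure_mono[OF subsetI sets.Un[OF m1 m2]])
      fix x assume "x \<in> sym_diff (\<Union>i. a i) {x. initial_word N x \<in> E}"
      then consider (1) i where "x \<in> a i" "\<And>i. i < k \<Longrightarrow> initial_word (n i) x \<notin> D i"
        | (2) i where "i < k" "initial_word (n i) x \<in> D i" "x \<notin> a i"
        by (simp only: E Un_iff Diff_iff mem_Collect_eq UN_iff) blast
      then show "x \<in> ((\<Union>i. a i) - ?B k) \<union> (\<Union>i<k. sym_diff (a i) {x. initial_word (n i) x \<in> D i})"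
      proof cases
        case 1
        show ?thesis
        proof (cases "\<exists>j<k. x \<in> a j")
          case True
          then obtain j where "j < k" "x \<in> a j" by blast
          then have "x \<in> (\<Union>i<k. sym_diff (a i) {x. initial_word (n i) x \<in> D i})"
            using 1(2) by (intro UN_I[of j]) simp_all
          then show ?thesis by (rule UnI2)
        next
          case False
          then have "x \<in> (\<Union>i. a i) - ?B k" using 1(1) by blast
          then show ?thesis by (rule UnI1)
        qed
      next
        case 2
        then have "x \<in> (\<Union>i<k. sym_diff (a i) {x. initial_word (n i) x \<in> D i})"
          by (intro UN_I[of i]) simp_all
        then show ?thesis by (rule UnI2)
      qed
    qed
    also have "\<dots> \<le> prob ((\<Union>i. a i) - ?B k) + prob (\<Union>i<k. sym_diff (a i) {x. initial_word (n i) x \<in> D i})"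
      by (rule measure_Un_le[OF m1 m2])
    finally have 1: "prob (sym_diff (\<Union>i. a i) {x. initial_word N x \<in> E})
      \<le> prob ((\<Union>i. a i) - ?B k) + prob (\<Union>i<k. sym_diff (a i) {x. initial_word (n i) x \<in> D i})" .
    have "prob (\<Union>i<k. sym_diff (a i) {x. initial_word (n i) x \<in> D i})
        \<le> (\<Sum>i<k. prob (sym_diff (a i) {x. initial_word (n i) x \<in> D i}))"
      using meas[OF a] by (rule measure_UNION_le[OF finite_lessThan])
    also have "\<dots> \<le> (\<Sum>i<k. e / (2 * real (Suc k)))"
      using nD by (intro sum_mono less_imp_le)
    also have "\<dots> < e / 2" using Union.prems by (simp add: field_simps)
    finally have 2: "prob (\<Union>i<k. sym_diff (a i) {x. initial_word (n i) x \<in> D i}) < e / 2" .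
    have "prob ((\<Union>i. a i) - ?B k) = prob (\<Union>i. a i) - prob (?B k)"
    proof (rule finite_measure_Diff)
      show "(\<Union>i. a i) \<in> sets M" using a by (intro sets.countable_nat_UN image_subsetI)
      show "?B k \<in> sets M" using a by (rule sets.finite_UN[OF finite_lessThan])
    qed blast
    then have "prob (sym_diff (\<Union>i. a i) {x. initial_word N x \<in> E}) < e" using k 1 2 by linarith
    then show ?case by blast
  qed
qed

text \<open>
  Approximate every fibre of \<open>X\<close> by a set of words. Where all approximations are
  correct, exactly one of the sets contains the initial word, and it names the value of
  \<open>X\<close>.
\<close>

lemma predict_from_initial_word:
  assumes X: "simple_function M X" and e: "e > 0"
  shows "\<exists>n f. prob {x. X x \<noteq> f (initial_word n x)} < e"
proof -
  have fin: "finite (range X)" using X by (simp add: simple_function_def)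
  define c where "c = e / real (Suc (card (range X)))"
  have c: "c > 0" using e by (simp add: c_def)
  have fibre: "{x. X x = v} \<in> sets M" for v
    using simple_function_fibre[OF X] by simp
  obtain n D where nD: "\<And>v. prob (sym_diff {x. X x = v} {x. initial_word (n v) x \<in> D v}) < c"
    using approximate_by_cylinders[OF fibre c] by metis
  define N where "N = (\<Sum>v\<in>range X. n v)"
  define f where "f w = (SOME v. v \<in> range X \<and> take (n v) w \<in> D v)" for w
  have nN: "n v \<le> N" if "v \<in> range X" for v
    unfolding N_def using that fin by (intro member_le_sum) auto
  have meas: "sym_diff {x. X x = v} {x. initial_word (n v) x \<in> D v} \<in> sets M" for v
    by (intro sets.Un sets.Diff initial_word_set_measurable fibre)
  have sub: "{x. X x \<noteq> f (initial_word N x)} \<subseteq> (\<Union>v\<in>range X. sym_diff {x. X x = v} {x. initial_word (n v) x \<in> D v})"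
  proof (rule subsetI, rule ccontr)
    fix x assume x: "x \<in> {x. X x \<noteq> f (initial_word N x)}"
      and "x \<notin> (\<Union>v\<in>range X. sym_diff {x. X x = v} {x. initial_word (n v) x \<in> D v})"
    then have "X x = v \<longleftrightarrow> initial_word (n v) x \<in> D v" if "v \<in> range X" for v
      using that by blast
    then have "(v \<in> range X \<and> take (n v) (initial_word N x) \<in> D v) \<longleftrightarrow> v = X x" for v
      using nN take_initial_word by (metis rangeI)
    then have "f (initial_word N x) = X x" by (simp add: f_def)
    with x show False by simp
  qed
  have "prob {x. X x \<noteq> f (initial_word N x)}
      \<le> prob (\<Union>v\<in>range X. sym_diff {x. X x = v} {x. initial_word (n v) x \<in> D v})"
    by (rule finite_measure_mono[OF sub sets.finite_UN[OF fin meas]])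
  also have "\<dots> \<le> (\<Sum>v\<in>range X. prob (sym_diff {x. X x = v} {x. initial_word (n v) x \<in> D v}))"
    using meas by (rule measure_UNION_le[OF fin])
  also have "\<dots> \<le> (\<Sum>v\<in>range X. c)" using nD by (intro sum_mono less_imp_le)
  also have "\<dots> < e" using e by (simp add: c_def field_simps)
  finally show ?thesis by blast
qed

end

section \<open>The entropy of the shift\<close>

text \<open>
  The conditional weights give \<open>1 - \<epsilon>\<close> to the guess \<open>f v\<close> and
  distribute \<open>\<epsilon>\<close> uniformly, so that only a wrong guess costs more than
  \<open>- ln (1 - \<epsilon>)\<close>.
\<close>

lemma (in prob_space) fano_inequality:
  assumes X: "simple_function M X" and V: "simple_function M V"
    and \<epsilon>: "0 < \<epsilon>" "\<epsilon> < 1" and k: "card (X ` space M) \<le> k" "k \<ge> 1"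
  shows "shannon M (\<lambda>x. (X x, V x))
    \<le> shannon M V - ln (1 - \<epsilon>) + prob {x \<in> space M. X x \<noteq> f (V x)} * ln (real k / \<epsilon>)"
proof -
  define q where "q u v = (if u = f v then 1 - \<epsilon> else \<epsilon> / real k)" for u v
  let ?W = "\<lambda>x. (X x, V x)"
  have W: "simple_function M ?W" by (rule simple_function_Pair[OF X V])
  have fin: "finite (X ` space M)" using X by (simp add: simple_function_def)
  have q0: "0 < q u v" for u v using \<epsilon> k by (simp add: q_def)
  have q1: "(\<Sum>u\<in>X ` space M. q u v) \<le> 1" for v
  proof -
    have "(\<Sum>u\<in>X ` space M. q u v)
        \<le> (\<Sum>u\<in>X ` space M. (if u = f v then 1 - \<epsilon> else 0) + \<epsilon> / real k)"
      using \<epsilon> by (intro sum_mono) (simp add: q_def)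
    also have "\<dots> = (if f v \<in> X ` space M then 1 - \<epsilon> else 0) + real (card (X ` space M)) * (\<epsilon> / real k)"
      using fin by (simp add: sum.distrib)
    also have "real (card (X ` space M)) * (\<epsilon> / real k) \<le> real k * (\<epsilon> / real k)"
      using \<epsilon> k by (intro mult_right_mono) auto
    also have "real k * (\<epsilon> / real k) = \<epsilon>" using k by simp
    finally show ?thesis using \<epsilon> by (simp split: if_splits)
  qed
  define \<phi> where "\<phi> w = (case w of (u, v) \<Rightarrow> if u = f v then 0 else (1::real))" for w
  have \<phi>: "integrable M (\<lambda>x. \<phi> (?W x))" by (rule simple_function_integral(1)[OF W])
  have B: "{x \<in> space M. X x \<noteq> f (V x)} \<in> sets M"
  proof -
    have eq: "{x \<in> space M. X x \<noteq> f (V x)} = ?W -` {(u, v). u \<noteq> f v} \<inter> space M" by auto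
    show ?thesis unfolding eq by (rule simple_functionD(2)[OF W])
  qed
  have "(\<integral>x. \<phi> (?W x) \<partial>M) = (\<integral>x. indicator {x \<in> space M. X x \<noteq> f (V x)} x \<partial>M)"
    by (intro Bochner_Integration.integral_cong) (auto simp: \<phi>_def indicator_def)
  then have \<phi>2: "(\<integral>x. \<phi> (?W x) \<partial>M) = prob {x \<in> space M. X x \<noteq> f (V x)}"
    using B by simp
  have kle: "ln (real k / \<epsilon>) \<ge> 0" "- ln (1 - \<epsilon>) \<ge> 0"
    using \<epsilon> k by auto
  have "(\<integral>x. - ln (q (X x) (V x)) \<partial>M) \<le> (\<integral>x. - ln (1 - \<epsilon>) + \<phi> (?W x) * ln (real k / \<epsilon>) \<partial>M)"
  proof (rule integral_mono)
    show "integrable M (\<lambda>x. - ln (q (X x) (V x)))"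
      using simple_function_integral(1)[OF W, of "\<lambda>(u, v). - ln (q u v)"] by simp
    show "integrable M (\<lambda>x. - ln (1 - \<epsilon>) + \<phi> (?W x) * ln (real k / \<epsilon>))"
      using \<phi> by simp
    fix x assume "x \<in> space M"
    show "- ln (q (X x) (V x)) \<le> - ln (1 - \<epsilon>) + \<phi> (?W x) * ln (real k / \<epsilon>)"
    proof (cases "X x = f (V x)")
      case True
      then show ?thesis by (simp add: q_def \<phi>_def)
    next
      case False
      have "- ln (\<epsilon> / real k) = ln (real k / \<epsilon>)" using \<epsilon> k by (simp add: ln_div)
      then show ?thesis using False kle by (simp add: q_def \<phi>_def)
    qed
  qed
  also have "\<dots> = - ln (1 - \<epsilon>) + prob {x \<in> space M. X x \<noteq> f (V x)} * ln (real k / \<epsilon>)"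
    using \<phi> by (simp add: \<phi>2 prob_space)
  finally show ?thesis
    using shannon_Pair_le_cross_entropy[OF X V, of q] q0 q1 by (simp add: less_imp_le)
qed

context shift_system
begin

text \<open>
  The word of length \<open>n + N\<close> contains the \<open>N\<close> symbols after each of the
  times \<open>0, \<dots>, n - 1\<close>, and these predict the entry of the itinerary at that
  time. By Fano's inequality each entry adds at most \<open>\<kappa>\<close> to the entropy of the
  word.
\<close>

lemma itinerary_entropy_le_word_entropy:
  fixes X :: "omega \<Rightarrow> 'b"
  assumes X: "simple_function M X" and \<kappa>: "\<kappa> > 0"
  shows "\<exists>N. \<forall>n. shannon M (itinerary shift X n) \<le> shannon M (initial_word (n + N)) + real n * \<kappa>"
proof -
  define k where "k = card (range X) + 1"
  \<comment> \<open>With these constants each of the two error terms in Fano's inequality is at most \<open>\<kappa> / 2\<close>.\<close>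
  define \<epsilon> where "\<epsilon> = 1 - exp (- \<kappa> / 2)"
  have \<epsilon>: "0 < \<epsilon>" "\<epsilon> < 1" and ln\<epsilon>: "- ln (1 - \<epsilon>) = \<kappa> / 2"
    using \<kappa> by (auto simp: \<epsilon>_def)
  define l where "l = ln (real k / \<epsilon>)"
  have l0: "l \<ge> 0" using \<epsilon> by (simp add: l_def k_def)
  define \<eta> where "\<eta> = \<kappa> / 2 / (l + 1)"
  have \<eta>: "\<eta> > 0" "\<eta> * l \<le> \<kappa> / 2"
    using \<kappa> l0 by (auto simp: \<eta>_def field_simps)
  obtain N f where Nf: "prob {x. X x \<noteq> f (initial_word N x)} < \<eta>"
    using predict_from_initial_word[OF X \<eta>(1)] by (elim exE)
  have step: "shannon M (\<lambda>x. (X ((shift ^^ j) x), V x)) \<le> shannon M V + \<kappa>"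
    if V: "simple_function M V"
      and det: "\<And>x y. V x = V y \<Longrightarrow> initial_word N ((shift ^^ j) x) = initial_word N ((shift ^^ j) y)"
    for V :: "omega \<Rightarrow> 'c" and j
  proof -
    interpret S: measure_preserving M "shift ^^ j" by (rule funpow)
    have Xj: "simple_function M (\<lambda>x. X ((shift ^^ j) x))"
      by (rule simple_function_compose_measurable[OF X S.T_measurable])
    have "card ((\<lambda>x. X ((shift ^^ j) x)) ` space M) \<le> card (range X)"
      using X by (intro card_mono) (auto simp: simple_function_def)
    then have card: "card ((\<lambda>x. X ((shift ^^ j) x)) ` space M) \<le> k" "k \<ge> 1"
      by (simp_all add: k_def)
    \<comment> \<open>The choice of \<open>x\<close> does not matter, because \<open>V\<close> determines the \<open>N\<close> symbols from time \<open>j\<close> on.\<close>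
    define f' where "f' v = f (initial_word N ((shift ^^ j) (SOME x. V x = v)))" for v
    have f': "f' (V x) = f (initial_word N ((shift ^^ j) x))" for x
    proof -
      have "V (SOME y. V y = V x) = V x" by (rule someI[of "\<lambda>y. V y = V x" x]) (rule refl)
      from det[OF this] show ?thesis by (simp only: f'_def)
    qed
    have W: "simple_function M (\<lambda>x. (X x, initial_word N x))"
      by (rule simple_function_Pair[OF X simple_initial_word])
    have eq: "{x \<in> space M. X x \<noteq> f (initial_word N x)}
        = (\<lambda>x. (X x, initial_word N x)) -` {(u, w). u \<noteq> f w} \<inter> space M" by auto
    have "{x \<in> space M. X x \<noteq> f (initial_word N x)} \<in> sets M"
      unfolding eq by (rule simple_functionD(2)[OF W])
    from S.prob_compose[OF this]
    have "prob {x \<in> space M. X ((shift ^^ j) x) \<noteq> f' (V x)} < \<eta>"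
      using Nf by (simp add: f')
    then have "prob {x \<in> space M. X ((shift ^^ j) x) \<noteq> f' (V x)} * l \<le> \<eta> * l"
      using l0 by (intro mult_right_mono) auto
    then show ?thesis
      using fano_inequality[OF Xj V \<epsilon> card, of f'] ln\<epsilon> \<eta>(2) unfolding l_def[symmetric] by linarith
  qed
  \<comment> \<open>The start \<open>j\<close> is arbitrary, because the induction removes the first entry of the itinerary.\<close>
  have claim: "shannon M (\<lambda>x. (itinerary shift X n ((shift ^^ j) x), Z x)) \<le> shannon M Z + real n * \<kappa>"
    if Z: "simple_function M Z"
      and det: "\<And>i x y. i < n \<Longrightarrow> Z x = Z y \<Longrightarrow>
        initial_word N ((shift ^^ (j + i)) x) = initial_word N ((shift ^^ (j + i)) y)"
    for Z :: "omega \<Rightarrow> bool list" and n j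
    using det
  proof (induction n arbitrary: j)
    case 0
    have "shannon M (\<lambda>x. (itinerary shift X 0 ((shift ^^ j) x), Z x)) \<le> shannon M Z"
      by (rule shannon_mono[OF _ Z]) (use simple_function_Pair[OF simple_function_const[of M "[]"] Z] in \<open>simp_all\<close>)
    then show ?case by simp
  next
    case (Suc n)
    let ?V = "\<lambda>x. (itinerary shift X n ((shift ^^ Suc j) x), Z x)"
    interpret Sj: measure_preserving M "shift ^^ j" by (rule funpow)
    interpret S: measure_preserving M "shift ^^ Suc j" by (rule funpow)
    have V: "simple_function M ?V"
      by (rule simple_function_Pair[OF simple_function_compose_measurable[OF
            simple_function_itinerary[OF X T_measurable] S.T_measurable] Z])
    have Xj: "simple_function M (\<lambda>x. X ((shift ^^ j) x))"
      by (rule simple_function_compose_measurable[OF X Sj.T_measurable])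
    have U: "simple_function M (\<lambda>x. (itinerary shift X (Suc n) ((shift ^^ j) x), Z x))"
      by (rule simple_function_Pair[OF simple_function_compose_measurable[OF
            simple_function_itinerary[OF X T_measurable] Sj.T_measurable] Z])
    have "shannon M (\<lambda>x. (itinerary shift X (Suc n) ((shift ^^ j) x), Z x))
        \<le> shannon M (\<lambda>x. (X ((shift ^^ j) x), ?V x))"
      by (rule shannon_mono[OF U simple_function_Pair[OF Xj V]]) (simp add: itinerary_Suc)
    also have "\<dots> \<le> shannon M ?V + \<kappa>"
    proof (rule step[OF V])
      fix x y assume "?V x = ?V y"
      then show "initial_word N ((shift ^^ j) x) = initial_word N ((shift ^^ j) y)"
        using Suc.prems[of 0 x y] by simp
    qed
    also have "shannon M ?V \<le> shannon M Z + real n * \<kappa>"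
    proof (rule Suc.IH)
      fix i x y assume "i < n" "Z x = Z y"
      then show "initial_word N ((shift ^^ (Suc j + i)) x) = initial_word N ((shift ^^ (Suc j + i)) y)"
        using Suc.prems[of "Suc i" x y] by simp
    qed
    finally show ?case by (simp add: algebra_simps)
  qed
  have "shannon M (itinerary shift X n) \<le> shannon M (initial_word (n + N)) + real n * \<kappa>" for n
  proof -
    let ?Z = "initial_word (n + N)"
    have Y: "simple_function M (itinerary shift X n)"
      by (rule simple_function_itinerary[OF X T_measurable])
    have "shannon M (itinerary shift X n) \<le> shannon M (\<lambda>x. (itinerary shift X n x, ?Z x))"
      by (rule shannon_mono[OF Y simple_function_Pair[OF Y simple_initial_word]]) simp
    also have "\<dots> = shannon M (\<lambda>x. (itinerary shift X n ((shift ^^ 0) x), ?Z x))" by simp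
    also have "\<dots> \<le> shannon M ?Z + real n * \<kappa>"
    proof (rule claim[OF simple_initial_word])
      fix i x y assume i: "i < n" and eq: "?Z x = ?Z y"
      have "i + N \<le> n + N" using i by simp
      from take_drop_initial_word[OF this, of x] take_drop_initial_word[OF this, of y] eq
      show "initial_word N ((shift ^^ (0 + i)) x) = initial_word N ((shift ^^ (0 + i)) y)"
        by simp
    qed
    finally show ?thesis .
  qed
  then show ?thesis by blast
qed

definition word_entropy :: real where
  "word_entropy = lim (\<lambda>n. shannon M (initial_word n) / real n)"

lemma simple_head: "simple_function M (\<lambda>x. x 0)"
proof -
  have "simple_function M (\<lambda>x. hd (initial_word 1 x))"
    by (rule simple_function_compose1[OF simple_initial_word])
  then show ?thesis by (simp add: initial_word_Suc)
qed

lemma word_entropy_tendsto: "(\<lambda>n. shannon M (initial_word n) / real n) \<longlonglongrightarrow> word_entropy"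
  unfolding word_entropy_def
  using entropy_rate_converges[OF simple_head]
  by (simp only: itinerary_head[abs_def] convergent_LIMSEQ_iff)

lemma partition_entropy_rate_le_word_entropy:
  assumes "finite \<xi>" "\<xi> \<subseteq> sets M" "partition_on (space M) \<xi>"
  shows "partition_entropy_rate M shift \<xi> \<le> word_entropy"
proof (rule field_le_epsilon)
  fix \<kappa> :: real assume \<kappa>: "\<kappa> > 0"
  have X: "simple_function M (cell \<xi>)" by (rule simple_function_cell[OF assms])
  obtain N where N: "\<And>n. shannon M (itinerary shift (cell \<xi>) n) \<le> shannon M (initial_word (n + N)) + real n * \<kappa>"
    using itinerary_entropy_le_word_entropy[OF X \<kappa>] by blast
  have 1: "(\<lambda>n. shannon M (initial_word (n + N)) / real (n + N)) \<longlonglongrightarrow> word_entropy"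
    by (rule LIMSEQ_ignore_initial_segment[OF word_entropy_tendsto])
  have 2: "(\<lambda>n. 1 + real N / real n) \<longlonglongrightarrow> 1 + 0"
    by (intro tendsto_add tendsto_const lim_const_over_n)
  have lim: "(\<lambda>n. shannon M (initial_word (n + N)) / real (n + N) * (1 + real N / real n) + \<kappa>)
      \<longlonglongrightarrow> word_entropy * (1 + 0) + \<kappa>"
    by (rule tendsto_add[OF tendsto_mult[OF 1 2] tendsto_const])
  have "partition_entropy_rate M shift \<xi> \<le> word_entropy * (1 + 0) + \<kappa>"
  proof (rule LIMSEQ_le[OF partition_entropy_rate_tendsto[OF assms] lim], intro exI allI impI)
    fix n :: nat assume n: "1 \<le> n"
    have "shannon M (itinerary shift (cell \<xi>) n) / real n
        \<le> (shannon M (initial_word (n + N)) + real n * \<kappa>) / real n"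
      using N by (intro divide_right_mono) auto
    also have "\<dots> = shannon M (initial_word (n + N)) / real (n + N) * (1 + real N / real n) + \<kappa>"
    proof -
      have "1 + real N / real n = real (n + N) / real n" using n by (simp add: field_simps)
      then show ?thesis using n by (simp add: add_divide_distrib del: of_nat_add)
    qed
    finally show "shannon M (itinerary shift (cell \<xi>) n) / real n
        \<le> shannon M (initial_word (n + N)) / real (n + N) * (1 + real N / real n) + \<kappa>" .
  qed
  then show "partition_entropy_rate M shift \<xi> \<le> word_entropy + \<kappa>" by simp
qed

text \<open>
  The theorem of Kolmogorov and Sinai for the shift: the partition by the first symbol is a
  generator, and it attains the supremum over all finite measurable partitions.
\<close>

theorem ks_entropy_eq_word_entropy: "ks_entropy M shift = ereal word_entropy"
proof (rule antisym)
  show "ks_entropy M shift \<le> ereal word_entropy"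
    unfolding ks_entropy_def
    by (rule SUP_least) (auto intro: partition_entropy_rate_le_word_entropy simp del: sets_M space_M)
  define \<xi> where "\<xi> = cylinder ` {[False], [True]}"
  have cyl: "cylinder [b] = {x. x 0 = b}" for b
    by (rule set_eqI) (simp add: in_cylinder_iff)
  have part: "partition_on (space M) \<xi>"
    unfolding \<xi>_def partition_on_def disjoint_def
    by (simp add: cyl set_eq_iff)
      (rule conjI, rule exI[of _ "\<lambda>_. False"], simp, rule exI[of _ "\<lambda>_. True"], simp)
  have fin: "finite \<xi>" by (simp add: \<xi>_def)
  have meas: "\<xi> \<subseteq> sets M" using borel_open[OF open_cylinder] by (simp add: \<xi>_def)
  have cell: "cell \<xi> x = {y. y 0 = x 0}" for x
    by (rule cell_eq[OF part]) (cases "x 0"; simp add: \<xi>_def cyl)+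
  have X: "simple_function M (cell \<xi>)" by (rule simple_function_cell[OF fin meas part])
  have "shannon M (itinerary shift (cell \<xi>) n) = shannon M (initial_word n)" for n
  proof (rule antisym)
    have eq: "itinerary shift (cell \<xi>) n x = itinerary shift (cell \<xi>) n y \<longleftrightarrow> initial_word n x = initial_word n y" for x y
    proof -
      have "cell \<xi> u = cell \<xi> v \<longleftrightarrow> u 0 = v 0" for u v
      proof
        assume "cell \<xi> u = cell \<xi> v"
        then have "u \<in> {y. y 0 = v 0}" unfolding cell by blast
        then show "u 0 = v 0" by simp
      qed (simp add: cell)
      then show ?thesis unfolding itinerary_eq_iff initial_word_eq_iff by (simp add: shift_funpow)
    qed
    have Y: "simple_function M (itinerary shift (cell \<xi>) n)"
      by (rule simple_function_itinerary[OF X T_measurable])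
    show "shannon M (itinerary shift (cell \<xi>) n) \<le> shannon M (initial_word n)"
      by (rule shannon_mono[OF Y simple_initial_word]) (simp only: eq)
    show "shannon M (initial_word n) \<le> shannon M (itinerary shift (cell \<xi>) n)"
      by (rule shannon_mono[OF simple_initial_word Y]) (simp only: eq)
  qed
  then have "partition_entropy_rate M shift \<xi> = word_entropy"
    using partition_entropy_rate_tendsto[OF fin meas part] word_entropy_tendsto
    by (simp add: LIMSEQ_unique)
  then show "ereal word_entropy \<le> ks_entropy M shift"
    unfolding ks_entropy_def using fin meas part by (intro SUP_upper2[of \<xi>]) auto
qed

end

section \<open>Pressure bounds for regular potentials\<close>

lemma average_tendsto_0:
  fixes v :: "nat \<Rightarrow> real"
  assumes v: "v \<longlonglongrightarrow> 0"
  shows "(\<lambda>n. (\<Sum>k<n. v k) / real n) \<longlonglongrightarrow> 0"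
proof (rule LIMSEQ_I)
  fix e :: real assume e: "e > 0"
  obtain m where m: "\<And>k. k \<ge> m \<Longrightarrow> \<bar>v k\<bar> < e / 2"
    using LIMSEQ_D[OF v, of "e / 2"] e by auto
  define C where "C = (\<Sum>k<m. \<bar>v k\<bar>)"
  have "(\<lambda>n. C / real n) \<longlonglongrightarrow> 0" by (rule lim_const_over_n)
  then obtain m' where m': "\<And>n. n \<ge> m' \<Longrightarrow> \<bar>C / real n\<bar> < e / 2"
    using LIMSEQ_D[of "\<lambda>n. C / real n" 0 "e / 2"] e by auto
  show "\<exists>no. \<forall>n\<ge>no. norm ((\<Sum>k<n. v k) / real n - 0) < e"
  proof (intro exI allI impI)
    fix n assume n: "n \<ge> max (max m m') 1"
    have "(\<Sum>k<n. \<bar>v k\<bar>) = C + (\<Sum>k\<in>{m..<n}. \<bar>v k\<bar>)"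
      using sum.atLeastLessThan_concat[of 0 m n "\<lambda>k. \<bar>v k\<bar>"] n
      by (simp add: C_def atLeast0LessThan)
    also have "(\<Sum>k\<in>{m..<n}. \<bar>v k\<bar>) \<le> (\<Sum>k\<in>{m..<n}. e / 2)"
    proof (rule sum_mono)
      fix k assume "k \<in> {m..<n}"
      then show "\<bar>v k\<bar> \<le> e / 2" using m[of k] by simp
    qed
    also have "\<dots> \<le> real n * (e / 2)" using e by (simp add: mult_right_mono)
    finally have "\<bar>\<Sum>k<n. v k\<bar> \<le> C + real n * (e / 2)"
      using sum_abs[of v "{..<n}"] by linarith
    then have "\<bar>\<Sum>k<n. v k\<bar> / real n \<le> (C + real n * (e / 2)) / real n"
      by (intro divide_right_mono) auto
    also have "\<dots> = C / real n + e / 2" using n by (simp add: add_divide_distrib)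
    also have "\<dots> < e"
    proof -
      have "n \<ge> m'" using n by simp
      from m'[OF this] show ?thesis by linarith
    qed
    finally show "norm ((\<Sum>k<n. v k) / real n - 0) < e" by simp
  qed
qed

abbreviation push :: "bool \<Rightarrow> omega \<Rightarrow> omega" where
  "push b x \<equiv> case_nat b x"

primrec prepend :: "bool list \<Rightarrow> omega \<Rightarrow> omega" where
  "prepend [] x = x"
| "prepend (b # w) x = push b (prepend w x)"

lemma shift_push [simp]: "shift (push b x) = x"
  by (simp add: shift_def)

lemma initial_word_prepend: "initial_word (length w) (prepend w x) = w"
  by (induction w) (simp_all add: initial_word_Suc)

primrec birkhoff_sum :: "(omega \<Rightarrow> real) \<Rightarrow> nat \<Rightarrow> omega \<Rightarrow> real" where
  "birkhoff_sum f 0 x = 0"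
| "birkhoff_sum f (Suc n) x = f x + birkhoff_sum f n (shift x)"

lemma sum_words_Suc:
  fixes F :: "bool list \<Rightarrow> real"
  shows "(\<Sum>w | length w = Suc n. F w) = (\<Sum>w | length w = n. F (False # w) + F (True # w))"
proof -
  have fin: "finite {w :: bool list. length w = n}"
    using finite_lists_length_eq[of "UNIV :: bool set" n] by simp
  have "{w :: bool list. length w = Suc n} = (#) False ` {w. length w = n} \<union> (#) True ` {w. length w = n}"
  proof (rule set_eqI)
    fix w :: "bool list"
    show "w \<in> {w. length w = Suc n} \<longleftrightarrow> w \<in> (#) False ` {w. length w = n} \<union> (#) True ` {w. length w = n}"
      by (cases w) (auto simp: image_iff)
  qed
  then have "(\<Sum>w | length w = Suc n. F w)
      = (\<Sum>w\<in>(#) False ` {w. length w = n}. F w) + (\<Sum>w\<in>(#) True ` {w. length w = n}. F w)"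
    by (simp only:) (rule sum.union_disjoint; use fin in auto)
  also have "\<dots> = (\<Sum>w | length w = n. F (False # w)) + (\<Sum>w | length w = n. F (True # w))"
    by (simp add: sum.reindex)
  finally show ?thesis by (simp add: sum.distrib)
qed

text \<open>
  The hypothesis says \<open>L h \<le> exp p * h\<close> for the transfer operator \<open>L h x =
  (\<Sum>b. exp (f (b x)) * h (b x))\<close>. Since \<open>L\<close> is positive, the inequality
  can be iterated.
\<close>

lemma transfer_operator_iterate:
  assumes sup: "\<And>x. (\<Sum>b\<in>UNIV. exp (f (push b x)) * h (push b x)) \<le> exp p * h x"
  shows "(\<Sum>w | length w = n. exp (birkhoff_sum f n (prepend w x)) * h (prepend w x)) \<le> exp (real n * p) * h x"
proof (induction n)
  case (Suc n)
  have "(\<Sum>w | length w = Suc n. exp (birkhoff_sum f (Suc n) (prepend w x)) * h (prepend w x))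
      = (\<Sum>w | length w = n. exp (birkhoff_sum f n (prepend w x)) *
          (\<Sum>b\<in>UNIV. exp (f (push b (prepend w x))) * h (push b (prepend w x))))"
    unfolding sum_words_Suc by (intro sum.cong refl) (simp add: UNIV_bool exp_add algebra_simps)
  also have "\<dots> \<le> (\<Sum>w | length w = n. exp (birkhoff_sum f n (prepend w x)) * (exp p * h (prepend w x)))"
    by (intro sum_mono mult_left_mono sup) simp
  also have "\<dots> = exp p * (\<Sum>w | length w = n. exp (birkhoff_sum f n (prepend w x)) * h (prepend w x))"
    by (simp add: sum_distrib_left mult_ac)
  also have "\<dots> \<le> exp p * (exp (real n * p) * h x)"
    by (intro mult_left_mono Suc.IH) simp
  also have "\<dots> = exp (real (Suc n) * p) * h x"
    by (simp add: exp_add algebra_simps)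
  finally show ?case .
qed simp

text \<open>
  The number \<open>v k\<close> bounds the oscillation of \<open>f\<close> on cylinders of length
  \<open>k\<close>; in particular \<open>v 0\<close> bounds its total oscillation.
\<close>

locale regular_potential =
  fixes f :: "omega \<Rightarrow> real" and v :: "nat \<Rightarrow> real"
  assumes variation: "\<And>x y k. initial_word k x = initial_word k y \<Longrightarrow> \<bar>f x - f y\<bar> \<le> v k"
    and variation_lim: "v \<longlonglongrightarrow> 0"
begin

lemma measurable [measurable]: "f \<in> borel_measurable borel"
proof (rule borel_measurable_LIMSEQ_real)
  let ?u = "\<lambda>n x. f (prepend (initial_word n x) (\<lambda>_. False))"
  show "(\<lambda>n. ?u n x) \<longlonglongrightarrow> f x" for x
  proof (rule LIM_zero_cancel, rule Lim_null_comparison[OF _ variation_lim], rule always_eventually, rule allI)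
    fix n
    have "initial_word n (prepend (initial_word n x) (\<lambda>_. False)) = initial_word n x"
      using initial_word_prepend[of "initial_word n x"] by simp
    from variation[OF this] show "norm (?u n x - f x) \<le> v n" by simp
  qed
  fix n
  have "simple_function borel (?u n)"
    by (rule simple_function_compose1[OF simple_function_initial_word[OF refl]])
  then show "?u n \<in> borel_measurable borel" by (rule borel_measurable_simple_function)
qed

lemma bounded: "\<bar>f x\<bar> \<le> \<bar>f (\<lambda>_. False)\<bar> + v 0"
  using variation[of 0 x "\<lambda>_. False"] by simp

text \<open>
  After \<open>i\<close> steps the two points still agree on \<open>n - i\<close> symbols.
\<close>

lemma birkhoff_distortion:
  "initial_word n x = initial_word n y \<Longrightarrow>
    \<bar>birkhoff_sum f n x - birkhoff_sum f n y\<bar> \<le> (\<Sum>k<n. v (Suc k))"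
proof (induction n arbitrary: x y)
  case (Suc n)
  have "\<bar>f x - f y\<bar> \<le> v (Suc n)" by (rule variation[OF Suc.prems])
  moreover have "\<bar>birkhoff_sum f n (shift x) - birkhoff_sum f n (shift y)\<bar> \<le> (\<Sum>k<n. v (Suc k))"
    by (rule Suc.IH) (use Suc.prems in \<open>simp add: initial_word_Suc\<close>)
  ultimately show ?case by simp
qed simp

end

lemma (in shift_system) prob_UNIV [simp]: "prob UNIV = 1"
  using prob_space by simp

lemma (in shift_system) integral_birkhoff_sum:
  assumes "integrable M f"
  shows "integrable M (birkhoff_sum f n)"
    and "(\<integral>x. birkhoff_sum f n x \<partial>M) = real n * (\<integral>x. f x \<partial>M)"
proof -
  have "integrable M (birkhoff_sum f n) \<and> (\<integral>x. birkhoff_sum f n x \<partial>M) = real n * (\<integral>x. f x \<partial>M)"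
  proof (induction n)
    case (Suc n)
    have eq: "birkhoff_sum f (Suc n) = (\<lambda>x. f x + birkhoff_sum f n (shift x))"
      by (rule ext) simp
    have 1: "integrable M (\<lambda>x. birkhoff_sum f n (shift x))"
      using Suc by (intro integrable_compose) simp
    have "(\<integral>x. birkhoff_sum f n (shift x) \<partial>M) = (\<integral>x. birkhoff_sum f n x \<partial>M)"
      using Suc by (intro integral_compose borel_measurable_integrable) simp
    then show ?case
      unfolding eq using assms 1 Suc by (simp add: algebra_simps)
  next
    case 0
    have "birkhoff_sum f 0 = (\<lambda>x. 0)" by (rule ext) simp
    then show ?case by simp
  qed
  then show "integrable M (birkhoff_sum f n)"
    and "(\<integral>x. birkhoff_sum f n x \<partial>M) = real n * (\<integral>x. f x \<partial>M)" by auto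
qed

lemma (in regular_potential) integrable:
  assumes "M \<in> invariant_measures"
  shows "integrable M f"
proof -
  interpret shift_system M by unfold_locales (rule assms)
  have "f \<in> borel_measurable M" using measurable by (simp add: measurable_cong_sets[OF sets_M refl])
  then show ?thesis
    by (rule integrable_const_bound[where B = "\<bar>f (\<lambda>_. False)\<bar> + v 0", rotated])
      (rule AE_I2, use bounded in simp)
qed



text \<open>
  Fix a tail. By the supersolution, the weights \<open>exp (birkhoff_sum f n - n p) * h / h
  tail\<close> of the words of length \<open>n\<close>, each continued by that tail, have a sum of
  at most 1. Gibbs' inequality for these weights bounds the entropy of words, with an error that
  consists of the distortion, which is small compared to \<open>n\<close>, and the constant
  \<open>ln (C / c)\<close>.
\<close>

theorem (in regular_potential) topological_pressure_le:
  assumes sup: "\<And>x. (\<Sum>b\<in>UNIV. exp (f (push b x)) * h (push b x)) \<le> exp p * h x"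
    and h: "\<And>x. c \<le> h x" "\<And>x. h x \<le> C" and c: "c > 0"
  shows "topological_pressure f \<le> ereal p"
  unfolding topological_pressure_def
proof (rule SUP_least)
  fix M assume M: "M \<in> invariant_measures"
  interpret shift_system M by unfold_locales (rule M)
  have hpos: "h x > 0" for x using h(1)[of x] c by linarith
  let ?o = "(\<lambda>_. False) :: omega"
  define D where "D n = (\<Sum>k<n. v (Suc k))" for n
  have int: "integrable M f" by (rule integrable[OF M])
  have bound: "shannon M (initial_word n) + real n * (\<integral>x. f x \<partial>M) \<le> real n * p + (D n + ln (C / c))" for n
  proof -
    define q where "q w = exp (birkhoff_sum f n (prepend w ?o) - real n * p) * h (prepend w ?o) / h ?o" for w
    have q: "q w > 0" for w by (simp add: q_def hpos)
    have fin: "finite {w :: bool list. length w = n}"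
      using finite_lists_length_eq[of "UNIV :: bool set" n] by simp
    have "(\<Sum>w\<in>initial_word n ` space M. q w) \<le> (\<Sum>w | length w = n. q w)"
      by (rule sum_mono2[OF fin]) (use q in \<open>auto simp: less_imp_le\<close>)
    also have "\<dots> = (\<Sum>w | length w = n. exp (birkhoff_sum f n (prepend w ?o)) * h (prepend w ?o)) / (exp (real n * p) * h ?o)"
      unfolding q_def exp_diff sum_divide_distrib by (intro sum.cong refl) simp
    also have "\<dots> \<le> 1"
      using transfer_operator_iterate[OF sup, of n ?o] hpos[of ?o] by (simp add: divide_le_eq)
    finally have "shannon M (initial_word n) \<le> (\<integral>x. - ln (q (initial_word n x)) \<partial>M)"
      using q by (intro gibbs_inequality[OF simple_initial_word]) (auto simp: less_imp_le)
    also have "\<dots> \<le> (\<integral>x. real n * p + (D n + ln (C / c)) - birkhoff_sum f n x \<partial>M)"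
    proof (rule integral_mono)
      show "integrable M (\<lambda>x. - ln (q (initial_word n x)))"
        using simple_function_integral(1)[OF simple_initial_word, of "\<lambda>w. - ln (q w)"] .
      show "integrable M (\<lambda>x. real n * p + (D n + ln (C / c)) - birkhoff_sum f n x)"
        using integral_birkhoff_sum(1)[OF int] by simp
      fix x
      let ?y = "prepend (initial_word n x) ?o"
      have "initial_word n x = initial_word n ?y"
        using initial_word_prepend[of "initial_word n x"] by simp
      from birkhoff_distortion[OF this]
      have "birkhoff_sum f n ?y \<ge> birkhoff_sum f n x - D n" unfolding D_def by linarith
      moreover have "ln (h ?o / h ?y) \<le> ln (C / c)"
        using h hpos c less_le_trans[OF hpos h(2)] by (intro ln_mono frac_le) (auto simp: less_imp_le)
      moreover have "- ln (q (initial_word n x)) = real n * p - birkhoff_sum f n ?y + ln (h ?o / h ?y)"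
        using hpos[THEN less_imp_neq, THEN not_sym] hpos by (simp add: q_def ln_mult ln_div)
      ultimately show "- ln (q (initial_word n x)) \<le> real n * p + (D n + ln (C / c)) - birkhoff_sum f n x"
        by linarith
    qed
    also have "\<dots> = real n * p + (D n + ln (C / c)) - real n * (\<integral>x. f x \<partial>M)"
      using integral_birkhoff_sum[OF int] by (simp add: prob_space)
    finally show ?thesis by linarith
  qed
  have "(\<lambda>n. v (Suc n)) \<longlonglongrightarrow> 0" using variation_lim by (rule LIMSEQ_Suc)
  then have "(\<lambda>n. D n / real n) \<longlonglongrightarrow> 0" unfolding D_def by (rule average_tendsto_0)
  then have lim: "(\<lambda>n. p + (D n / real n + ln (C / c) / real n)) \<longlonglongrightarrow> p + (0 + 0)"
    by (intro tendsto_add tendsto_const lim_const_over_n)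
  have "word_entropy + (\<integral>x. f x \<partial>M) \<le> p + (0 + 0)"
  proof (rule LIMSEQ_le[OF tendsto_add[OF word_entropy_tendsto tendsto_const] lim], intro exI allI impI)
    fix n :: nat assume n: "1 \<le> n"
    have "(shannon M (initial_word n) + real n * (\<integral>x. f x \<partial>M)) / real n
        \<le> (real n * p + (D n + ln (C / c))) / real n"
      by (intro divide_right_mono bound) simp
    then show "shannon M (initial_word n) / real n + (\<integral>x. f x \<partial>M) \<le> p + (D n / real n + ln (C / c) / real n)"
      using n by (simp add: add_divide_distrib)
  qed
  then show "ks_entropy M shift + ereal (\<integral>x. f x \<partial>M) \<le> ereal p"
    by (simp add: ks_entropy_eq_word_entropy)
qed

text \<open>
  An upper bound for the mass of cylinders is a lower bound for their information.
\<close>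

theorem (in regular_potential) topological_pressure_ge:
  assumes M: "M \<in> invariant_measures"
    and gibbs: "\<And>x n. n > 0 \<Longrightarrow> measure M (cylinder (initial_word n x)) \<le> C * exp (birkhoff_sum f n x - real n * p)"
  shows "ereal p \<le> topological_pressure f"
proof -
  interpret shift_system M by unfold_locales (rule M)
  have int: "integrable M f" by (rule integrable[OF M])
  have bound: "real n * p - ln (max C 1) \<le> shannon M (initial_word n) + real n * (\<integral>x. f x \<partial>M)"
    if n: "n > 0" for n
  proof -
    have cyl: "{y \<in> space M. initial_word n y = initial_word n x} = cylinder (initial_word n x)" for x
      by (simp add: cylinder_def)
    have "real n * p - ln (max C 1) - real n * (\<integral>x. f x \<partial>M)
        = (\<integral>x. real n * p - ln (max C 1) - birkhoff_sum f n x \<partial>M)"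
      using integral_birkhoff_sum[OF int] by (simp add: prob_space)
    also have "\<dots> \<le> shannon M (initial_word n)"
      unfolding shannon_def
    proof (rule integral_mono_AE)
      show "integrable M (\<lambda>x. real n * p - ln (max C 1) - birkhoff_sum f n x)"
        using integral_birkhoff_sum(1)[OF int] by simp
      show "integrable M (\<lambda>x. - ln (prob {y \<in> space M. initial_word n y = initial_word n x}))"
        using simple_function_integral(1)[OF simple_initial_word,
            of "\<lambda>w. - ln (prob {y \<in> space M. initial_word n y = w})"] .
      show "AE x in M. real n * p - ln (max C 1) - birkhoff_sum f n x
          \<le> - ln (prob {y \<in> space M. initial_word n y = initial_word n x})"
        using AE_fibre_pos[OF simple_initial_word, of n]
      proof eventually_elim
        case (elim x)
        have "prob (cylinder (initial_word n x)) \<le> max C 1 * exp (birkhoff_sum f n x - real n * p)"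
          by (rule order_trans[OF gibbs[OF n]]) (rule mult_right_mono; simp)
        then have "ln (prob (cylinder (initial_word n x))) \<le> ln (max C 1 * exp (birkhoff_sum f n x - real n * p))"
          using elim unfolding cyl by (intro ln_mono) auto
        also have "\<dots> = ln (max C 1) + (birkhoff_sum f n x - real n * p)"
          using ln_mult_pos[of "max C 1" "exp (birkhoff_sum f n x - real n * p)"] by simp
        finally show ?case unfolding cyl by linarith
      qed
    qed
    finally show ?thesis by linarith
  qed
  have lim: "(\<lambda>n. p - ln (max C 1) / real n) \<longlonglongrightarrow> p - 0"
    by (intro tendsto_diff tendsto_const lim_const_over_n)
  have "p - 0 \<le> word_entropy + (\<integral>x. f x \<partial>M)"
  proof (rule LIMSEQ_le[OF lim tendsto_add[OF word_entropy_tendsto tendsto_const]], intro exI allI impI)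
    fix n :: nat assume n: "1 \<le> n"
    have "(real n * p - ln (max C 1)) / real n \<le> (shannon M (initial_word n) + real n * (\<integral>x. f x \<partial>M)) / real n"
      using n by (intro divide_right_mono bound) auto
    then show "p - ln (max C 1) / real n \<le> shannon M (initial_word n) / real n + (\<integral>x. f x \<partial>M)"
      using n by (simp add: add_divide_distrib diff_divide_distrib)
  qed
  then have "ereal p \<le> ks_entropy M shift + ereal (\<integral>x. f x \<partial>M)"
    by (simp add: ks_entropy_eq_word_entropy)
  also have "\<dots> \<le> topological_pressure f"
    unfolding topological_pressure_def by (rule SUP_upper[OF M])
  finally show ?thesis .
qed

lemma (in shift_system) word_entropy_nonneg: "0 \<le> word_entropy"
  by (rule LIMSEQ_le_const[OF word_entropy_tendsto])
    (intro exI allI impI divide_nonneg_nonneg shannon_nonneg of_nat_0_le_iff)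

text \<open>
  The Dirac measure at the fixed point has a non-negative entropy.
\<close>

lemma (in regular_potential) topological_pressure_ge_fixed_point:
  assumes "shift x = x"
  shows "ereal (f x) \<le> topological_pressure f"
proof -
  let ?M = "return borel x :: omega measure"
  have "distr ?M borel shift = return borel (shift x)"
    by (rule distr_return[OF shift_measurable]) simp
  then have M: "?M \<in> invariant_measures"
    using assms by (simp add: invariant_measures_def prob_space_return)
  interpret shift_system ?M by unfold_locales (rule M)
  have "(\<integral>x. f x \<partial>?M) = f x"
    using measurable by (intro integral_return) auto
  then have "ereal (f x) \<le> ks_entropy ?M shift + ereal (\<integral>x. f x \<partial>?M)"
    using word_entropy_nonneg by (simp add: ks_entropy_eq_word_entropy)
  also have "\<dots> \<le> topological_pressure f"
    unfolding topological_pressure_def by (rule SUP_upper[OF M])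
  finally show ?thesis .
qed

text \<open>
  The entropy does not involve the potential, and the integrals differ by at most \<open>\<bar>a -
  b\<bar> * K\<close>.
\<close>

lemma topological_pressure_scale_lipschitz:
  assumes f: "f \<in> borel_measurable borel" and K: "\<And>x. \<bar>f x\<bar> \<le> K"
  shows "topological_pressure (\<lambda>x. a * f x) \<le> topological_pressure (\<lambda>x. b * f x) + ereal (\<bar>a - b\<bar> * K)"
  unfolding topological_pressure_def[of "\<lambda>x. a * f x"]
proof (rule SUP_least)
  fix M assume M: "M \<in> invariant_measures"
  interpret shift_system M by unfold_locales (rule M)
  have "f \<in> borel_measurable M" using f by (simp add: measurable_cong_sets[OF sets_M refl])
  then have int: "integrable M f"
    by (rule integrable_const_bound[where B = K, rotated]) (rule AE_I2, use K in simp)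
  have "(\<integral>x. a * f x \<partial>M) - (\<integral>x. b * f x \<partial>M) = (\<integral>x. (a - b) * f x \<partial>M)"
    using int by (simp add: left_diff_distrib)
  also have "\<dots> \<le> (\<integral>x. \<bar>a - b\<bar> * K \<partial>M)"
  proof (rule integral_mono)
    fix x
    have "(a - b) * f x \<le> \<bar>a - b\<bar> * \<bar>f x\<bar>" by (metis abs_ge_self abs_mult)
    also have "\<dots> \<le> \<bar>a - b\<bar> * K" by (intro mult_left_mono K) simp
    finally show "(a - b) * f x \<le> \<bar>a - b\<bar> * K" .
  qed (use int in auto)
  also have "\<dots> = \<bar>a - b\<bar> * K" by (simp add: prob_space)
  finally have "ks_entropy M shift + ereal (\<integral>x. a * f x \<partial>M)
      \<le> (ks_entropy M shift + ereal (\<integral>x. b * f x \<partial>M)) + ereal (\<bar>a - b\<bar> * K)"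
    by (simp add: ks_entropy_eq_word_entropy)
  also have "\<dots> \<le> topological_pressure (\<lambda>x. b * f x) + ereal (\<bar>a - b\<bar> * K)"
    unfolding topological_pressure_def by (intro add_right_mono SUP_upper[OF M])
  finally show "ks_entropy M shift + ereal (\<integral>x. a * f x \<partial>M)
      \<le> topological_pressure (\<lambda>x. b * f x) + ereal (\<bar>a - b\<bar> * K)" .
qed

section \<open>Invariant measures from stationary word weights\<close>

text \<open>
  The words of length \<open>n\<close> label consecutive half-open intervals that partition the
  unit interval, the interval of \<open>w\<close> having length \<open>m w\<close> and this left
  end point.
\<close>

definition left_end :: "(bool list \<Rightarrow> real) \<Rightarrow> bool list \<Rightarrow> real" where
  "left_end m w = (\<Sum>i<length w. if w ! i then m (take i w @ [False]) else 0)"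

text \<open>
  The word of length \<open>n\<close> whose interval contains \<open>u\<close>: the next digit
  tells in which of the two parts of the interval \<open>u\<close> lies.
\<close>

primrec digits :: "(bool list \<Rightarrow> real) \<Rightarrow> real \<Rightarrow> nat \<Rightarrow> bool list" where
  "digits m u 0 = []"
| "digits m u (Suc n) = digits m u n @ [left_end m (digits m u n) + m (digits m u n @ [False]) \<le> u]"

definition digit_point :: "(bool list \<Rightarrow> real) \<Rightarrow> real \<Rightarrow> omega" where
  "digit_point m u n = last (digits m u (Suc n))"

lemma initial_word_digit_point: "initial_word n (digit_point m u) = digits m u n"
  by (induction n) (simp_all add: initial_word_Suc_append digit_point_def)

lemma length_digits [simp]: "length (digits m u n) = n"
  by (induction n) simp_all

lemma left_end_append:
  "left_end m (w @ [b]) = left_end m w + (if b then m (w @ [False]) else 0)"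
proof -
  have "(\<Sum>i<length w. if (w @ [b]) ! i then m (take i (w @ [b]) @ [False]) else 0)
      = (\<Sum>i<length w. if w ! i then m (take i w @ [False]) else 0)"
    by (rule sum.cong) (simp_all add: nth_append)
  then show ?thesis by (simp add: left_end_def)
qed

lemma sigma_sets_insert_empty: "sigma_sets UNIV (insert {} (range cylinder)) = sigma_sets UNIV (range cylinder)"
  by (rule sigma_sets_eqI) (auto intro: sigma_sets.Basic sigma_sets.Empty)

text \<open>
  The measure is the distribution of the digits of a uniformly distributed point of the unit
  interval. Consistency of the weights under appending a symbol makes the intervals nested, and
  consistency under prepending a symbol is invariance on cylinders.
\<close>

theorem stationary_weights_measure:
  fixes m :: "bool list \<Rightarrow> real"
  assumes m0: "m [] = 1" and nonneg: "\<And>w. 0 \<le> m w"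
    and right: "\<And>w. m (w @ [False]) + m (w @ [True]) = m w"
    and left: "\<And>w. m (False # w) + m (True # w) = m w"
  obtains M where "M \<in> invariant_measures" "\<And>w. measure M (cylinder w) = m w"
proof -
  let ?I = "{0..<1} :: real set"
  define U where "U = restrict_space (lborel :: real measure) ?I"
  have spU: "space U = ?I" by (simp add: U_def space_restrict_space)
  have setsU: "A \<in> sets U" if "A \<in> sets borel" "A \<subseteq> ?I" for A
    using that by (simp add: U_def sets_restrict_space_iff)
  have emU: "emeasure U A = emeasure lborel A" if "A \<subseteq> ?I" for A
    unfolding U_def using that by (intro emeasure_restrict_space) auto
  interpret U: prob_space U
    by standard (simp add: spU emU)
  have inside: "0 \<le> left_end m w \<and> left_end m w + m w \<le> 1" for w
  proof (induction w rule: rev_induct)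
    case Nil
    show ?case by (simp add: left_end_def m0)
  next
    case (snoc b w)
    then show ?case using right[of w] nonneg[of "w @ [False]"] nonneg[of "w @ [True]"]
      by (cases b) (simp_all add: left_end_append)
  qed
  have digits_iff: "digits m u (length w) = w \<longleftrightarrow> left_end m w \<le> u \<and> u < left_end m w + m w"
    if u: "u \<in> ?I" for u w
  proof (induction w rule: rev_induct)
    case Nil
    show ?case using u by (simp add: left_end_def m0)
  next
    case (snoc b w)
    have "digits m u (length (w @ [b])) = w @ [b] \<longleftrightarrow>
        digits m u (length w) = w \<and> (left_end m w + m (w @ [False]) \<le> u) = b"
      by auto
    also have "\<dots> \<longleftrightarrow> (left_end m w \<le> u \<and> u < left_end m w + m w) \<and> (left_end m w + m (w @ [False]) \<le> u) = b"
      using snoc by simp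
    also have "\<dots> \<longleftrightarrow> left_end m (w @ [b]) \<le> u \<and> u < left_end m (w @ [b]) + m (w @ [b])"
      using right[of w] nonneg[of "w @ [False]"] nonneg[of "w @ [True]"]
      by (cases b) (auto simp: left_end_append)
    finally show ?case .
  qed
  have preimage: "digit_point m -` cylinder w \<inter> space U = {left_end m w..<left_end m w + m w}" for w
  proof (rule set_eqI)
    fix u
    have "u \<in> digit_point m -` cylinder w \<inter> space U \<longleftrightarrow> u \<in> ?I \<and> digits m u (length w) = w"
      by (simp add: cylinder_def initial_word_digit_point spU conj_commute)
    also have "\<dots> \<longleftrightarrow> u \<in> {left_end m w..<left_end m w + m w}"
    proof (cases "u \<in> ?I")
      case True
      then show ?thesis using digits_iff[OF True] by simp
    next
      case False
      then show ?thesis using inside[of w] by auto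
    qed
    finally show "u \<in> digit_point m -` cylinder w \<inter> space U \<longleftrightarrow> u \<in> {left_end m w..<left_end m w + m w}" .
  qed
  have sub: "{left_end m w..<left_end m w + m w} \<subseteq> ?I" for w
    using inside[of w] by auto
  have meas: "digit_point m \<in> measurable U borel"
  proof (rule measurable_sigma_sets[OF sets_borel_cylinders])
    fix A assume "A \<in> range cylinder"
    then obtain w where A: "A = cylinder w" by blast
    show "digit_point m -` A \<inter> space U \<in> sets U"
      unfolding A preimage by (rule setsU[OF _ sub]) simp
  qed simp_all
  define M where "M = distr U borel (digit_point m)"
  have setsM: "sets M = sets borel" by (simp add: M_def)
  interpret M: prob_space M unfolding M_def by (rule U.prob_space_distr[OF meas])
  have em: "emeasure M (cylinder w) = ennreal (m w)" for w
    unfolding M_def using nonneg[of w]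
    by (simp add: emeasure_distr[OF meas borel_open[OF open_cylinder]] preimage emU[OF sub])
  have weight: "measure M (cylinder w) = m w" for w
    unfolding measure_def em using nonneg by simp
  have shiftM: "shift \<in> measurable M borel"
    using shift_measurable by (simp add: measurable_cong_sets[OF setsM refl])
  have "M = distr M borel shift"
  proof (rule measure_eqI_generator_eq[OF Int_stable_cylinders])
    show "insert {} (range cylinder) \<subseteq> Pow UNIV" by simp
    show "sets M = sigma_sets UNIV (insert {} (range cylinder))"
      by (simp only: setsM sets_borel_cylinders sigma_sets_insert_empty)
    show "sets (distr M borel shift) = sigma_sets UNIV (insert {} (range cylinder))"
      by (simp only: sets_distr sets_borel_cylinders sigma_sets_insert_empty)
    show "range (\<lambda>i::nat. cylinder []) \<subseteq> insert {} (range cylinder)" by blast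
    show "(\<Union>i::nat. cylinder []) = UNIV" by (simp add: cylinder_def)
    show "emeasure M (cylinder []) \<noteq> \<infinity>" for i :: nat by (simp add: em)
    fix A assume "A \<in> insert {} (range cylinder)"
    then consider "A = {}" | w where "A = cylinder w" by blast
    then show "emeasure M A = emeasure (distr M borel shift) A"
    proof cases
      case 2
      have spM: "space M = UNIV" using sets_eq_imp_space_eq[OF setsM] by simp
      have "emeasure (distr M borel shift) A = emeasure M (shift -` cylinder w)"
        unfolding 2 by (simp add: emeasure_distr[OF shiftM borel_open[OF open_cylinder]] spM)
      also have "shift -` cylinder w = cylinder (False # w) \<union> cylinder (True # w)"
        by (rule set_eqI) (simp add: cylinder_def initial_word_Suc, blast)
      also have "emeasure M \<dots> = emeasure M (cylinder (False # w)) + emeasure M (cylinder (True # w))"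
      proof (rule plus_emeasure[symmetric])
        show "cylinder (False # w) \<inter> cylinder (True # w) = {}"
          by (rule set_eqI) (simp add: cylinder_def initial_word_Suc)
      qed (simp_all add: setsM borel_open[OF open_cylinder])
      also have "\<dots> = emeasure M A"
        unfolding 2 em using left[of w] nonneg by (simp flip: ennreal_plus)
      finally show ?thesis by simp
    qed simp
  qed
  then have "M \<in> invariant_measures"
    by (simp add: invariant_measures_def setsM M.prob_space_axioms)
  then show thesis using that weight by blast
qed

section \<open>The Hofbauer potentials and the upper bound\<close>

lemma zeta_summable:
  assumes "a > 1" shows "summable (\<lambda>n. 1 / real (Suc n) powr a)"
proof -
  have "summable (\<lambda>n. 1 / real n powr a)"
    using summable_real_powr_iff[of "- a"] assms by (simp add: powr_minus_divide)
  then show ?thesis by (subst summable_Suc_iff)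
qed

lemma zeta_gt_1:
  assumes "a > 1" shows "zeta a > 1"
proof -
  have "sum (\<lambda>n. 1 / real (Suc n) powr a) {..<2} \<le> zeta a"
    unfolding zeta_def by (rule sum_le_suminf[OF zeta_summable[OF assms]]) simp_all
  moreover have "sum (\<lambda>n. 1 / real (Suc n) powr a) {..<2} = 1 + 1 / 2 powr a"
    by (simp add: numeral_2_eq_2)
  moreover have "1 / 2 powr a > (0::real)" by simp
  ultimately show ?thesis by linarith
qed

text \<open>
  The value \<open>- run_cost a n\<close> is the Birkhoff sum of the potential over a complete run
  of length \<open>n\<close>, and \<open>exp (- run_cost a n)\<close> is the probability \<open>n
  powr (- a) / zeta a\<close>.
\<close>

definition run_cost :: "real \<Rightarrow> nat \<Rightarrow> real" where
  "run_cost a n = a * ln (real n) + ln (zeta a)"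

definition run_sum :: "real \<Rightarrow> real \<Rightarrow> real \<Rightarrow> real" where
  "run_sum a \<beta> p = (\<Sum>n. exp (- real (Suc n) * p - \<beta> * run_cost a (Suc n)))"

lemma run_cost_nonneg: "a > 1 \<Longrightarrow> n \<ge> 1 \<Longrightarrow> 0 \<le> run_cost a n"
  using zeta_gt_1[of a] by (simp add: run_cost_def)

lemma exp_run_cost: "n \<ge> 1 \<Longrightarrow> a > 1 \<Longrightarrow> exp (- run_cost a n) = real n powr (- a) / zeta a"
  using zeta_gt_1[of a] by (simp add: run_cost_def exp_diff exp_minus powr_def field_simps exp_add)

lemma run_cost_sums_1:
  assumes "a > 1" shows "(\<lambda>n. exp (- run_cost a (Suc n))) sums 1"
proof -
  have "(\<lambda>n. 1 / real (Suc n) powr a / zeta a) sums (zeta a / zeta a)"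
    unfolding zeta_def by (intro sums_divide summable_sums zeta_summable[OF assms])
  then show ?thesis
    using zeta_gt_1[OF assms] assms by (simp add: exp_run_cost powr_minus_divide)
qed

lemma geometric_summable:
  fixes p :: real
  assumes "p > 0" shows "summable (\<lambda>n. exp (- real (Suc n) * p))" "(\<Sum>n. exp (- real (Suc n) * p)) = 1 / (exp p - 1)"
proof -
  have eq: "exp (- real (Suc n) * p) = exp (- p) * exp (- p) ^ n" for n
    by (simp add: exp_of_nat_mult[symmetric] exp_add[symmetric] algebra_simps)
  have "(\<lambda>n. exp (- p) * exp (- p) ^ n) sums (exp (- p) * (1 / (1 - exp (- p))))"
    using assms by (intro sums_mult geometric_sums) simp
  moreover have "exp (- p) * (1 / (1 - exp (- p))) = 1 / (exp p - 1)"
    using assms by (simp add: exp_minus field_simps)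
  ultimately show "summable (\<lambda>n. exp (- real (Suc n) * p))" "(\<Sum>n. exp (- real (Suc n) * p)) = 1 / (exp p - 1)"
    unfolding eq by (auto simp: sums_iff)
qed

lemma run_term_le:
  assumes "a > 1" "\<beta> \<ge> 0"
  shows "exp (- real (Suc n) * p - \<beta> * run_cost a (Suc n)) \<le> exp (- real (Suc n) * p)"
  using run_cost_nonneg[of a "Suc n"] assms by simp

lemma run_sum_summable:
  assumes "a > 1" "\<beta> \<ge> 0" "p > 0"
  shows "summable (\<lambda>n. exp (- real (Suc n) * p - \<beta> * run_cost a (Suc n)))"
  by (rule summable_comparison_test'[OF geometric_summable(1)[OF assms(3)], of 0])
    (use run_term_le[OF assms(1,2)] in simp)

lemma run_sum_pos:
  assumes "a > 1" "\<beta> \<ge> 0" "p > 0"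
  shows "run_sum a \<beta> p > 0"
  unfolding run_sum_def by (rule suminf_pos[OF run_sum_summable[OF assms]]) simp

lemma run_sum_le_1:
  assumes "a > 1" "\<beta> \<ge> 1" "p > 0"
  shows "run_sum a \<beta> p \<le> 1"
proof -
  have "run_sum a \<beta> p \<le> (\<Sum>n. exp (- run_cost a (Suc n)))"
    unfolding run_sum_def
  proof (rule suminf_le)
    fix n
    have "run_cost a (Suc n) \<le> \<beta> * run_cost a (Suc n)"
      using mult_right_mono[OF assms(2) run_cost_nonneg[of a "Suc n"]] assms by simp
    moreover have "- real (Suc n) * p \<le> 0" using assms by (intro mult_nonpos_nonneg) auto
    ultimately show "exp (- real (Suc n) * p - \<beta> * run_cost a (Suc n)) \<le> exp (- run_cost a (Suc n))"
      unfolding exp_le_cancel_iff by linarith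
  qed (use assms run_sum_summable run_cost_sums_1[of a] in \<open>auto simp: sums_iff\<close>)
  then show ?thesis using run_cost_sums_1[OF assms(1)] by (simp add: sums_iff)
qed

text \<open>
  The value \<open>None\<close> stands for an infinite run.
\<close>

definition run_length :: "bool \<Rightarrow> omega \<Rightarrow> nat option" where
  "run_length b x = (if \<exists>i. x i \<noteq> b then Some (LEAST i. x i \<noteq> b) else None)"

lemma run_length_Some: "run_length b x = Some n \<longleftrightarrow> x \<in> initial_run b n"
proof
  assume "run_length b x = Some n"
  then have n: "n = (LEAST i. x i \<noteq> b)" and ex: "\<exists>i. x i \<noteq> b"
    by (auto simp: run_length_def split: if_splits)
  have "x n \<noteq> b" unfolding n by (rule LeastI_ex[OF ex])
  moreover have "x i = b" if "i < n" for i
    using not_less_Least[of i "\<lambda>i. x i \<noteq> b"] that unfolding n by blast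
  ultimately show "x \<in> initial_run b n" by (simp add: initial_run_def)
next
  assume x: "x \<in> initial_run b n"
  have "(LEAST i. x i \<noteq> b) = n"
  proof (rule Least_equality)
    fix i assume "x i \<noteq> b"
    then show "n \<le> i" using x by (simp add: initial_run_def) (meson not_less)
  qed (use x in \<open>simp add: initial_run_def\<close>)
  moreover have "\<exists>i. x i \<noteq> b" using x by (intro exI[of _ n]) (simp add: initial_run_def)
  ultimately show "run_length b x = Some n" by (simp add: run_length_def)
qed

lemma run_length_None: "run_length b x = None \<longleftrightarrow> x = (\<lambda>_. b)"
  by (simp add: run_length_def fun_eq_iff)

lemma push_in_initial_run: "push b x \<in> initial_run b (Suc n) \<longleftrightarrow> x \<in> initial_run b n"
  by (simp add: initial_run_def All_less_Suc2)

lemma run_length_push_same: "run_length b (push b x) = map_option Suc (run_length b x)"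
proof (cases "run_length b x")
  case None
  then have "push b x = (\<lambda>_. b)" by (simp add: run_length_None fun_eq_iff split: nat.splits)
  then show ?thesis using None run_length_None[of b "push b x"] by simp
next
  case (Some n)
  then show ?thesis using run_length_Some[of b "push b x" "Suc n"] run_length_Some[of b x n]
    by (simp add: push_in_initial_run)
qed

lemma run_length_other: "x 0 \<noteq> b \<Longrightarrow> run_length b x = Some 0"
  unfolding run_length_Some by (simp add: initial_run_def)

fun run_value :: "real \<Rightarrow> nat option \<Rightarrow> real" where
  "run_value a None = 0"
| "run_value a (Some n) = hofbauer_value a n"

abbreviation run_exponent :: "real \<Rightarrow> real \<Rightarrow> bool \<Rightarrow> real" where
  "run_exponent \<gamma> \<delta> b \<equiv> (if b then \<delta> else \<gamma>)"

lemma double_hofbauer_eq: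
  "double_hofbauer \<gamma> \<delta> x = run_value (run_exponent \<gamma> \<delta> (x 0)) (run_length (x 0) x)"
proof (cases "run_length (x 0) x")
  case None
  then have "x = (\<lambda>_. x 0)" by (simp only: run_length_None)
  then have "double_hofbauer \<gamma> \<delta> x = 0" by (metis double_hofbauer_fixed)
  then show ?thesis using None by simp
next
  case (Some n)
  then have n: "x \<in> initial_run (x 0) n" by (simp only: run_length_Some)
  then have "n \<noteq> 0" by (rule_tac notI) (simp add: initial_run_def)
  then have n1: "n \<ge> 1" by simp
  show ?thesis
  proof (cases "x 0")
    case True
    then show ?thesis using Some double_hofbauer_R[OF n1, of x] n by (simp add: R_def)
  next
    case False
    then show ?thesis using Some double_hofbauer_L[OF n1, of x] n by (simp add: L_def)
  qed
qed

text \<open>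
  The single potential treats \<open>n - 1\<close> zeros followed by a one as a block of length
  \<open>n\<close>, which explains the successor.
\<close>

lemma hofbauer_eq: "hofbauer a x = run_value a (map_option Suc (run_length False x))"
proof (cases "run_length False x")
  case None
  then have "x = (\<lambda>_. False)" by (simp only: run_length_None)
  then have "hofbauer a x = 0" by (simp add: hofbauer_def initial_run_def)
  then show ?thesis using None by simp
next
  case (Some n)
  then have "x \<in> initial_run False (Suc n - 1)" by (simp add: run_length_Some)
  then show ?thesis using Some hofbauer_run[of "Suc n" x a] by simp
qed

text \<open>
  A bound for the values on runs of length at least \<open>k\<close>. For \<open>k \<le> 1\<close>
  it also has to cover the value \<open>- ln (zeta a)\<close> on runs of length 1.
\<close>

definition run_variation :: "real \<Rightarrow> nat \<Rightarrow> real" where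
  "run_variation a k = (if k \<ge> 2 then a * ln (real k / (real k - 1)) else a * ln 2 + ln (zeta a))"

lemma run_variation_nonneg:
  assumes "a > 1" shows "0 \<le> run_variation a k"
  using assms zeta_gt_1[OF assms] by (simp add: run_variation_def)

lemma run_variation_tendsto_0: "run_variation a \<longlonglongrightarrow> 0"
proof -
  have "(\<lambda>k. a * ln (real (Suc k) / real k)) \<longlonglongrightarrow> a * ln 1"
    by (intro tendsto_mult tendsto_const tendsto_ln LIMSEQ_Suc_n_over_n) simp
  moreover have "\<forall>\<^sub>F k in sequentially. a * ln (real (Suc k) / real k) = run_variation a (Suc k)"
    using eventually_ge_at_top[of 1] by eventually_elim (simp add: run_variation_def)
  ultimately have "(\<lambda>k. run_variation a (Suc k)) \<longlonglongrightarrow> 0"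
    by (simp add: Lim_transform_eventually)
  then show ?thesis by (rule LIMSEQ_imp_Suc)
qed

lemma hofbauer_value_bounds:
  assumes a: "a > 1" and n: "n \<ge> 1" "n \<ge> k"
  shows "- run_variation a k \<le> hofbauer_value a n" "hofbauer_value a n \<le> 0"
proof -
  have z: "ln (zeta a) > 0" using zeta_gt_1[OF a] by simp
  have mono: "a * ln (real n / (real n - 1)) \<le> a * ln (real j / (real j - 1))" if "2 \<le> j" "j \<le> n" for j
    using that a by (intro mult_left_mono ln_mono) (auto simp: field_simps)
  have pos: "0 \<le> a * ln (real n / (real n - 1))" if "2 \<le> n"
    using that a by (intro mult_nonneg_nonneg ln_ge_zero) (auto simp: field_simps)
  show "hofbauer_value a n \<le> 0" using z pos by (simp add: hofbauer_value_def)
  show "- run_variation a k \<le> hofbauer_value a n"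
  proof (cases "n \<ge> 2")
    case True
    then have "a * ln (real n / (real n - 1)) \<le> a * ln 2" using mono[of 2] by simp
    then have "a * ln (real n / (real n - 1)) \<le> a * ln 2 + ln (zeta a)" using z by linarith
    then show ?thesis using True mono[of k] n by (simp add: hofbauer_value_def run_variation_def)
  next
    case False
    then have "\<not> k \<ge> 2" using n by simp
    moreover have "0 \<le> a * ln 2" using a by simp
    ultimately show ?thesis using False by (simp add: hofbauer_value_def run_variation_def)
  qed
qed

text \<open>
  Two points of a cylinder either have the same value or both lie in a long run, where the values
  are in \<open>[- v k, 0]\<close>.
\<close>

lemma regular_potential_I:
  assumes "\<And>x y k. initial_word k x = initial_word k y \<Longrightarrow>
      f x = f y \<or> (- v k \<le> f x \<and> f x \<le> 0 \<and> - v k \<le> f y \<and> f y \<le> 0)"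
    and "\<And>k. 0 \<le> v k" and "v \<longlonglongrightarrow> 0"
  shows "regular_potential f v"
proof
  fix x y k assume "initial_word k x = initial_word k y"
  from assms(1)[OF this] assms(2)[of k] show "\<bar>f x - f y\<bar> \<le> v k" by auto
qed (fact assms(3))

lemma run_length_agree:
  assumes "initial_word k x = initial_word k y" "run_length b x = Some n" "n < k"
  shows "run_length b y = Some n"
  using assms unfolding run_length_Some initial_word_eq_iff initial_run_def by simp

lemma run_value_bounds:
  assumes a: "a > 1" and l: "\<And>n. l = Some n \<Longrightarrow> n \<ge> 1 \<and> n \<ge> k"
  shows "- run_variation a k \<le> run_value a l \<and> run_value a l \<le> 0"
  using hofbauer_value_bounds[OF a] run_variation_nonneg[OF a] l by (cases l) auto

lemma double_hofbauer_regular: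
  assumes "\<gamma> > 1" "\<delta> > 1"
  shows "regular_potential (double_hofbauer \<gamma> \<delta>) (\<lambda>k. run_variation \<gamma> k + run_variation \<delta> k)"
proof (rule regular_potential_I)
  let ?v = "\<lambda>k. run_variation \<gamma> k + run_variation \<delta> k"
  note nn = run_variation_nonneg[OF assms(1)] run_variation_nonneg[OF assms(2)]
  have pos: "n \<ge> 1" if "run_length (x 0) x = Some n" for n and x :: omega
    using that by (cases n) (auto simp: run_length_Some initial_run_def)
  have bound: "- ?v k \<le> double_hofbauer \<gamma> \<delta> x \<and> double_hofbauer \<gamma> \<delta> x \<le> 0"
    if "\<And>n. run_length (x 0) x = Some n \<Longrightarrow> n \<ge> k" for x k
  proof -
    have "- run_variation (run_exponent \<gamma> \<delta> (x 0)) k \<le> double_hofbauer \<gamma> \<delta> x \<and> double_hofbauer \<gamma> \<delta> x \<le> 0"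
      unfolding double_hofbauer_eq by (rule run_value_bounds) (use assms that pos in auto)
    then show ?thesis using nn[of k] by (auto split: if_splits)
  qed
  fix x y k assume eq: "initial_word k x = initial_word k y"
  show "double_hofbauer \<gamma> \<delta> x = double_hofbauer \<gamma> \<delta> y \<or>
    (- ?v k \<le> double_hofbauer \<gamma> \<delta> x \<and> double_hofbauer \<gamma> \<delta> x \<le> 0 \<and>
     - ?v k \<le> double_hofbauer \<gamma> \<delta> y \<and> double_hofbauer \<gamma> \<delta> y \<le> 0)"
  proof (cases "\<exists>n<k. run_length (x 0) x = Some n \<or> run_length (y 0) y = Some n")
    case True
    then have "k > 0" by auto
    then have "x 0 = y 0" using eq by (simp add: initial_word_eq_iff)
    moreover from True obtain n where n: "n < k"
      and "run_length (x 0) x = Some n \<or> run_length (y 0) y = Some n" by blast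
    then have "run_length (x 0) x = run_length (y 0) y"
    proof (elim disjE)
      assume "run_length (x 0) x = Some n"
      with run_length_agree[OF eq this n] \<open>x 0 = y 0\<close> show ?thesis by simp
    next
      assume "run_length (y 0) y = Some n"
      with run_length_agree[OF eq[symmetric] this n] \<open>x 0 = y 0\<close> show ?thesis by simp
    qed
    ultimately show ?thesis by (simp add: double_hofbauer_eq)
  next
    case False
    have "k \<le> n" if "run_length (x 0) x = Some n" for n using False that by (meson not_le)
    moreover have "k \<le> n" if "run_length (y 0) y = Some n" for n using False that by (meson not_le)
    ultimately show ?thesis using bound[of x k] bound[of y k] by blast
  qed
qed (use assms run_variation_nonneg tendsto_add[OF run_variation_tendsto_0 run_variation_tendsto_0]
    in \<open>simp_all add: add_nonneg_nonneg\<close>)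

lemma hofbauer_regular:
  assumes "a > 1"
  shows "regular_potential (hofbauer a) (run_variation a)"
proof (rule regular_potential_I)
  have bound: "- run_variation a k \<le> hofbauer a x \<and> hofbauer a x \<le> 0"
    if "\<And>n. run_length False x = Some n \<Longrightarrow> n \<ge> k" for x k
    unfolding hofbauer_eq by (rule run_value_bounds[OF assms]) (use that in force)
  fix x y k assume eq: "initial_word k x = initial_word k y"
  show "hofbauer a x = hofbauer a y \<or>
    (- run_variation a k \<le> hofbauer a x \<and> hofbauer a x \<le> 0 \<and>
     - run_variation a k \<le> hofbauer a y \<and> hofbauer a y \<le> 0)"
  proof (cases "\<exists>n<k. run_length False x = Some n \<or> run_length False y = Some n")
    case True
    then obtain n where n: "n < k" and "run_length False x = Some n \<or> run_length False y = Some n"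
      by blast
    then have "run_length False x = run_length False y"
    proof (elim disjE)
      assume "run_length False x = Some n"
      with run_length_agree[OF eq this n] show ?thesis by simp
    next
      assume "run_length False y = Some n"
      with run_length_agree[OF eq[symmetric] this n] show ?thesis by simp
    qed
    then show ?thesis by (simp add: hofbauer_eq)
  next
    case False
    have "k \<le> n" if "run_length False x = Some n" for n using False that by (meson not_le)
    moreover have "k \<le> n" if "run_length False y = Some n" for n using False that by (meson not_le)
    ultimately show ?thesis using bound[of x k] bound[of y k] by blast
  qed
qed (rule run_variation_nonneg[OF assms], rule run_variation_tendsto_0)

lemma (in regular_potential) scale: "regular_potential (\<lambda>x. c * f x) (\<lambda>k. \<bar>c\<bar> * v k)"
proof
  fix x y k assume "initial_word k x = initial_word k y"
  from mult_left_mono[OF variation[OF this], of "\<bar>c\<bar>"]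
  show "\<bar>c * f x - c * f y\<bar> \<le> \<bar>c\<bar> * v k"
    by (simp add: abs_mult[symmetric] right_diff_distrib)
next
  show "(\<lambda>k. \<bar>c\<bar> * v k) \<longlonglongrightarrow> 0"
    using tendsto_mult_left[OF variation_lim, of "\<bar>c\<bar>"] by simp
qed

text \<open>
  The values on runs of length \<open>n\<close> of the supersolution for the upper bound: sum over
  the number \<open>j\<close> of symbols by which the run is extended to the left before the
  symbol changes. The bracket is the weight \<open>exp (\<beta> * Birkhoff sum)\<close> of these
  \<open>j\<close> extensions, with \<open>a\<close> standing for \<open>\<beta>\<close> times the
  exponent.
\<close>

definition profile_sum :: "real \<Rightarrow> real \<Rightarrow> nat \<Rightarrow> real" where
  "profile_sum a p n = (\<Sum>j. exp (- real (Suc j) * p) * (real n / real (n + j)) powr a)"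

lemma profile_sum_summable:
  assumes "a \<ge> 0" "p > 0"
  shows "summable (\<lambda>j. exp (- real (Suc j) * p) * (real n / real (n + j)) powr a)"
proof (rule summable_comparison_test'[OF geometric_summable(1)[OF assms(2)], of 0])
  fix j
  have "(real n / real (n + j)) powr a \<le> 1"
    using assms(1) by (intro powr_le1) (auto simp: divide_le_eq)
  then show "norm (exp (- real (Suc j) * p) * (real n / real (n + j)) powr a) \<le> exp (- real (Suc j) * p)"
    using mult_left_mono[of "(real n / real (n + j)) powr a" 1 "exp (- real (Suc j) * p)"] by simp
qed

lemma profile_sum_bounds:
  assumes "a \<ge> 0" "p > 0" "n \<ge> 1"
  shows "exp (- p) \<le> profile_sum a p n" "profile_sum a p n \<le> 1 / (exp p - 1)"
proof -
  have "sum (\<lambda>j. exp (- real (Suc j) * p) * (real n / real (n + j)) powr a) {..<1} \<le> profile_sum a p n"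
    unfolding profile_sum_def by (rule sum_le_suminf[OF profile_sum_summable[OF assms(1,2)]]) simp_all
  then show "exp (- p) \<le> profile_sum a p n" using assms by simp
  have "profile_sum a p n \<le> (\<Sum>j. exp (- real (Suc j) * p))"
    unfolding profile_sum_def
  proof (rule suminf_le[OF _ profile_sum_summable[OF assms(1,2)] geometric_summable(1)[OF assms(2)]])
    fix j
    have "(real n / real (n + j)) powr a \<le> 1"
      using assms(1) by (intro powr_le1) (auto simp: divide_le_eq)
    then show "exp (- real (Suc j) * p) * (real n / real (n + j)) powr a \<le> exp (- real (Suc j) * p)"
      using mult_left_mono[of "(real n / real (n + j)) powr a" 1 "exp (- real (Suc j) * p)"] by simp
  qed
  then show "profile_sum a p n \<le> 1 / (exp p - 1)"
    using geometric_summable(2)[OF assms(2)] by simp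
qed

lemma profile_sum_step:
  assumes "a \<ge> 0" "p > 0" "n \<ge> 1"
  shows "exp p * profile_sum a p n = 1 + (real n / real (Suc n)) powr a * profile_sum a p (Suc n)"
proof -
  let ?t = "\<lambda>n j. exp (- real (Suc j) * p) * (real n / real (n + j)) powr a"
  have s: "summable (?t m)" for m by (rule profile_sum_summable[OF assms(1,2)])
  have "exp p * profile_sum a p n = (\<Sum>j. exp p * ?t n j)"
    unfolding profile_sum_def by (rule suminf_mult[OF s, symmetric])
  also have "\<dots> = exp p * ?t n 0 + (\<Sum>j. exp p * ?t n (Suc j))"
    using suminf_split_head[OF summable_mult[OF s[of n], of "exp p"]] by simp
  also have "exp p * ?t n 0 = 1" using assms by (simp add: exp_minus)
  also have "(\<Sum>j. exp p * ?t n (Suc j)) = (\<Sum>j. (real n / real (Suc n)) powr a * ?t (Suc n) j)"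
  proof (rule suminf_cong)
    fix j
    have E: "exp p * exp (- real (Suc (Suc j)) * p) = exp (- real (Suc j) * p)"
      by (simp add: exp_add[symmetric] algebra_simps)
    have "real n / real (n + Suc j) = (real n / real (Suc n)) * (real (Suc n) / real (Suc n + j))"
      using assms by simp
    then have "(real n / real (n + Suc j)) powr a
        = (real n / real (Suc n)) powr a * (real (Suc n) / real (Suc n + j)) powr a"
      by (simp only: powr_mult)
    then have "exp p * ?t n (Suc j) = exp p * exp (- real (Suc (Suc j)) * p) *
        ((real n / real (Suc n)) powr a * (real (Suc n) / real (Suc n + j)) powr a)"
      by (simp only: mult.assoc)
    then show "exp p * ?t n (Suc j) = (real n / real (Suc n)) powr a * ?t (Suc n) j"
      unfolding E by (simp only: mult.left_commute)
  qed
  also have "\<dots> = (real n / real (Suc n)) powr a * profile_sum a p (Suc n)"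
    unfolding profile_sum_def by (rule suminf_mult[OF s])
  finally show ?thesis .
qed

fun run_profile :: "real \<Rightarrow> real \<Rightarrow> nat option \<Rightarrow> real" where
  "run_profile a p None = 1 / (exp p - 1)"
| "run_profile a p (Some n) = profile_sum a p n"

lemma run_profile_bounds:
  assumes "a \<ge> 0" "p > 0" "\<And>n. l = Some n \<Longrightarrow> n \<ge> 1"
  shows "exp (- p) \<le> run_profile a p l" "run_profile a p l \<le> 1 / (exp p - 1)"
  using assms profile_sum_bounds[OF assms(1,2)]
  by (cases l; simp add: exp_minus field_simps)+

text \<open>
  The eigenvalue equation: of the two preimages of a sequence, one extends its first run, and the
  other one, which starts a new run, contributes the constant 1.
\<close>

lemma run_profile_step:
  assumes "a > 1" "\<beta> \<ge> 0" "p > 0" "\<And>n. l = Some n \<Longrightarrow> n \<ge> 1"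
  shows "exp (\<beta> * run_value a (map_option Suc l)) * run_profile (\<beta> * a) p (map_option Suc l) + 1
    = exp p * run_profile (\<beta> * a) p l"
proof (cases l)
  case None
  then show ?thesis using assms(3) by (simp add: field_simps)
next
  case (Some n)
  then have n: "n \<ge> 1" using assms by simp
  have "\<beta> * hofbauer_value a (Suc n) = \<beta> * a * ln (real n / real (Suc n))"
    using n by (simp add: hofbauer_value_def ln_div)
      (simp add: algebra_simps)
  then have "exp (\<beta> * hofbauer_value a (Suc n)) = (real n / real (Suc n)) powr (\<beta> * a)"
    using n by (simp add: powr_def)
  then show ?thesis
    using profile_sum_step[of "\<beta> * a" p n] assms n by (simp add: Some)
qed

lemma run_profile_1:
  assumes "a > 1" "\<beta> \<ge> 0" "p > 0"
  shows "exp (\<beta> * run_value a (Some 1)) * run_profile (\<beta> * a) p (Some 1) = run_sum a \<beta> p"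
proof -
  have "run_sum a \<beta> p = (\<Sum>j. exp (- \<beta> * ln (zeta a)) * (exp (- real (Suc j) * p) * (1 / real (1 + j)) powr (\<beta> * a)))"
    unfolding run_sum_def
  proof (rule suminf_cong)
    fix j
    have "(1 / real (1 + j)) powr (\<beta> * a) = exp (- (\<beta> * a * ln (real (Suc j))))"
      by (simp add: powr_def ln_div)
    then show "exp (- real (Suc j) * p - \<beta> * run_cost a (Suc j))
        = exp (- \<beta> * ln (zeta a)) * (exp (- real (Suc j) * p) * (1 / real (1 + j)) powr (\<beta> * a))"
      by (simp only: exp_add[symmetric]) (simp add: run_cost_def algebra_simps)
  qed
  also have "\<dots> = exp (- \<beta> * ln (zeta a)) * profile_sum (\<beta> * a) p 1"
    unfolding profile_sum_def using assms profile_sum_summable[of "\<beta> * a" p 1]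
    by (subst suminf_mult) simp_all
  finally show ?thesis by (simp add: hofbauer_value_def)
qed

text \<open>
  The supersolution is \<open>t s\<close> times the profile of the first run, where
  \<open>s\<close> is the first symbol. A preimage that starts a new run of the other symbol
  contributes \<open>t (\<not> s)\<close> times the run sum of that symbol, and this must be at
  most \<open>t s\<close>. The choice \<open>t True = 1\<close>, \<open>t False = run_sum \<delta>
  \<beta> p\<close> makes the two conditions hold, one of them by equality and the other one by
  the hypothesis on the product.
\<close>

theorem double_hofbauer_pressure_le:
  assumes \<gamma>\<delta>: "\<gamma> > 1" "\<delta> > 1" and \<beta>: "\<beta> \<ge> 0" and p: "p > 0"
    and le: "run_sum \<gamma> \<beta> p * run_sum \<delta> \<beta> p \<le> 1"
  shows "topological_pressure (\<lambda>x. \<beta> * double_hofbauer \<gamma> \<delta> x) \<le> ereal p"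
proof -
  let ?g = "double_hofbauer \<gamma> \<delta>" and ?e = "run_exponent \<gamma> \<delta>"
  interpret G: regular_potential ?g "\<lambda>k. run_variation \<gamma> k + run_variation \<delta> k"
    by (rule double_hofbauer_regular[OF \<gamma>\<delta>])
  interpret F: regular_potential "\<lambda>x. \<beta> * ?g x" "\<lambda>k. \<bar>\<beta>\<bar> * (run_variation \<gamma> k + run_variation \<delta> k)"
    by (rule G.scale)
  define t where "t s = (if s then 1 else run_sum \<delta> \<beta> p)" for s
  have e1: "?e s > 1" for s using \<gamma>\<delta> by simp
  have t0: "t s > 0" for s using run_sum_pos[OF \<gamma>\<delta>(2) \<beta> p] by (simp add: t_def)
  \<comment> \<open>This is what the preimage that starts a new run requires.\<close>
  have balance: "run_sum (?e (\<not> s)) \<beta> p * t (\<not> s) \<le> t s" for s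
    using le by (cases s) (simp_all add: t_def)
  define \<phi> where "\<phi> s l = t s * run_profile (\<beta> * ?e s) p l" for s l
  define h where "h x = \<phi> (x 0) (run_length (x 0) x)" for x
  have pos: "n \<ge> 1" if "run_length (x 0) x = Some n" for n and x :: omega
    using that by (cases n) (auto simp: run_length_Some initial_run_def)
  have be: "\<beta> * ?e s \<ge> 0" for s using \<beta> e1[of s] by (intro mult_nonneg_nonneg) auto
  have \<phi>_bounds: "t s * exp (- p) \<le> \<phi> s l" "\<phi> s l \<le> t s * (1 / (exp p - 1))"
    if "\<And>n. l = Some n \<Longrightarrow> n \<ge> 1" for s l
    unfolding \<phi>_def using run_profile_bounds[OF be p that] t0[of s]
    by (intro mult_left_mono; auto)+
  show ?thesis
  proof (rule F.topological_pressure_le)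
    let ?c = "min (t True) (t False) * exp (- p)"
    let ?C = "max (t True) (t False) * (1 / (exp p - 1))"
    show "?c > 0" using t0 by simp
    fix x :: omega
    have "min (t True) (t False) \<le> t (x 0)" "t (x 0) \<le> max (t True) (t False)"
      by (cases "x 0"; simp)+
    note t_le = this
    have "?c \<le> t (x 0) * exp (- p)" by (rule mult_right_mono[OF t_le(1)]) simp
    also have "\<dots> \<le> h x" unfolding h_def by (rule \<phi>_bounds(1)[OF pos])
    finally show "?c \<le> h x" .
    have "h x \<le> t (x 0) * (1 / (exp p - 1))" unfolding h_def by (rule \<phi>_bounds(2)[OF pos])
    also have "\<dots> \<le> ?C" by (rule mult_right_mono[OF t_le(2)]) (use p in simp)
    finally show "h x \<le> ?C" .
    define s l where "s = x 0" and "l = run_length s x"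
    have same: "exp (\<beta> * ?g (push s x)) * h (push s x)
        = t s * (exp (\<beta> * run_value (?e s) (map_option Suc l)) * run_profile (\<beta> * ?e s) p (map_option Suc l))"
      by (simp only: double_hofbauer_eq h_def \<phi>_def old.nat.simps(4) run_length_push_same l_def mult_ac)
    have "run_length (\<not> s) x = Some 0" by (rule run_length_other) (simp add: s_def)
    then have other_len: "run_length (\<not> s) (push (\<not> s) x) = Some 1" by (simp add: run_length_push_same)
    have other: "exp (\<beta> * ?g (push (\<not> s) x)) * h (push (\<not> s) x)
        = t (\<not> s) * (exp (\<beta> * run_value (?e (\<not> s)) (Some 1)) * run_profile (\<beta> * ?e (\<not> s)) p (Some 1))"
      by (simp only: double_hofbauer_eq h_def \<phi>_def old.nat.simps(4) other_len mult_ac)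
    have "(\<Sum>b\<in>UNIV. exp (\<beta> * ?g (push b x)) * h (push b x))
        = exp (\<beta> * ?g (push s x)) * h (push s x) + exp (\<beta> * ?g (push (\<not> s) x)) * h (push (\<not> s) x)"
      by (cases s) (simp_all only: UNIV_bool sum.insert finite.intros, simp_all)
    also have "\<dots> \<le> t s * (exp (\<beta> * run_value (?e s) (map_option Suc l)) * run_profile (\<beta> * ?e s) p (map_option Suc l)) + t s"
      unfolding same other run_profile_1[OF e1 \<beta> p] using balance[of s] by (simp only: mult.commute add_left_mono)
    also have "\<dots> = t s * (exp p * run_profile (\<beta> * ?e s) p l)"
    proof -
      have "\<And>n. l = Some n \<Longrightarrow> n \<ge> 1" unfolding l_def s_def by (rule pos)
      from run_profile_step[OF e1[of s] \<beta> p this, symmetric] show ?thesis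
        by (simp only: distrib_left mult_1_right)
    qed
    also have "\<dots> = exp p * h x" by (simp add: h_def \<phi>_def l_def s_def)
    finally show "(\<Sum>b\<in>UNIV. exp (\<beta> * ?g (push b x)) * h (push b x)) \<le> exp p * h x" .
  qed
qed

text \<open>
  The same argument with a single profile; it works because the run sum at \<open>\<beta> =
  1\<close> is at most 1 for all \<open>p > 0\<close>.
\<close>

theorem hofbauer_pressure_le:
  assumes a: "a > 1" and p: "p > 0"
  shows "topological_pressure (hofbauer a) \<le> ereal p"
proof -
  interpret F: regular_potential "hofbauer a" "run_variation a" by (rule hofbauer_regular[OF a])
  define h where "h x = run_profile a p (map_option Suc (run_length False x))" for x
  have pos: "n \<ge> 1" if "map_option Suc l = Some n" for n l
    using that by auto
  have a0: "a \<ge> 0" using a by simp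
  show ?thesis
  proof (rule F.topological_pressure_le)
    show "exp (- p) > (0 :: real)" by simp
    fix x :: omega
    show "exp (- p) \<le> h x" unfolding h_def by (rule run_profile_bounds(1)[OF a0 p pos])
    show "h x \<le> 1 / (exp p - 1)" unfolding h_def by (rule run_profile_bounds(2)[OF a0 p pos])
    define l where "l = map_option Suc (run_length False x)"
    have same: "exp (hofbauer a (push False x)) * h (push False x)
        = exp (1 * run_value a (map_option Suc l)) * run_profile (1 * a) p (map_option Suc l)"
      by (simp only: hofbauer_eq h_def l_def run_length_push_same mult_1)
    have "run_length False (push True x) = Some 0" by (rule run_length_other) simp
    then have other: "exp (hofbauer a (push True x)) * h (push True x)
        = exp (1 * run_value a (Some 1)) * run_profile (1 * a) p (Some 1)"
      by (simp add: hofbauer_eq h_def)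
    have "(\<Sum>b\<in>UNIV. exp (hofbauer a (push b x)) * h (push b x))
        = exp (hofbauer a (push False x)) * h (push False x) + exp (hofbauer a (push True x)) * h (push True x)"
      by (simp add: UNIV_bool)
    also have "\<dots> \<le> exp (1 * run_value a (map_option Suc l)) * run_profile (1 * a) p (map_option Suc l) + 1"
      unfolding same other run_profile_1[OF a zero_le_one p]
      using run_sum_le_1[OF a order_refl p] by simp
    also have "\<dots> = exp p * run_profile (1 * a) p l"
      unfolding l_def by (rule run_profile_step[OF a zero_le_one p pos])
    also have "\<dots> = exp p * h x" by (simp add: h_def l_def)
    finally show "(\<Sum>b\<in>UNIV. exp (hofbauer a (push b x)) * h (push b x)) \<le> exp p * h x" .
  qed
qed

section \<open>An equilibrium measure and the lower bound\<close>

text \<open>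
  Runs of zeros and of ones alternate, and \<open>w s k\<close> is the probability that a run of
  \<open>s\<close> has length \<open>k\<close>. The numbers \<open>r s k\<close> are the tail sums
  of \<open>w s\<close>, and \<open>R s k\<close> are the tail sums of \<open>r s\<close>.

  In the stationary process a word is seen through a window: its inner runs are complete, the last
  run may continue to the right and the first one to the left, so that both carry the factor
  \<open>r\<close>. A word that consists of a single run may continue on both sides and carries
  the factor \<open>R\<close>. Division by the mean length of a cycle normalises.
\<close>

locale alternating_renewal =
  fixes w r R :: "bool \<Rightarrow> nat \<Rightarrow> real"
  assumes w_nonneg: "0 \<le> w s k" and r_nonneg: "0 \<le> r s k" and R_nonneg: "0 \<le> R s k"
    and r_step: "k \<ge> 1 \<Longrightarrow> r s k = w s k + r s (Suc k)"
    and R_step: "k \<ge> 1 \<Longrightarrow> R s k = r s k + R s (Suc k)"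
    and r_1: "r s 1 = 1"
begin

text \<open>
  The weight of the rest of a word, given that a run of \<open>s\<close> began inside the window
  and that \<open>k\<close> of its symbols have been read.
\<close>

primrec later_weight :: "bool list \<Rightarrow> bool \<Rightarrow> nat \<Rightarrow> real" where
  "later_weight [] = (\<lambda>s k. r s k)"
| "later_weight (b # u) = (\<lambda>s k. if b = s then later_weight u s (Suc k) else w s k * later_weight u b 1)"

text \<open>
  The same for the first run of the window, which may have begun before the window.
\<close>

primrec first_weight :: "bool list \<Rightarrow> bool \<Rightarrow> nat \<Rightarrow> real" where
  "first_weight [] = (\<lambda>s k. R s k)"
| "first_weight (b # u) = (\<lambda>s k. if b = s then first_weight u s (Suc k) else r s k * later_weight u b 1)"

definition mean_length :: real where
  "mean_length = R False 1 + R True 1"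

primrec word_weight :: "bool list \<Rightarrow> real" where
  "word_weight [] = 1"
| "word_weight (s # u) = first_weight u s 1 / mean_length"

lemma mean_length_ge_1: "mean_length \<ge> 1"
  using R_step[of 1 False] r_1[of False] R_nonneg[of False 2] R_nonneg[of True 1]
  by (simp add: mean_length_def numeral_2_eq_2)

lemma later_weight_nonneg: "0 \<le> later_weight u s k"
  by (induction u arbitrary: s k) (simp_all add: w_nonneg r_nonneg)

lemma first_weight_nonneg: "0 \<le> first_weight u s k"
  by (induction u arbitrary: s k) (simp_all add: r_nonneg R_nonneg later_weight_nonneg)

lemma later_weight_snoc:
  "k \<ge> 1 \<Longrightarrow> later_weight (u @ [False]) s k + later_weight (u @ [True]) s k = later_weight u s k"
proof (induction u arbitrary: s k)
  case Nil
  then show ?case using r_step[of k s] r_1 by (cases s) simp_all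
next
  case (Cons b u)
  then show ?case by (simp add: distrib_left[symmetric])
qed

lemma first_weight_snoc:
  "k \<ge> 1 \<Longrightarrow> first_weight (u @ [False]) s k + first_weight (u @ [True]) s k = first_weight u s k"
proof (induction u arbitrary: s k)
  case Nil
  then show ?case using R_step[of k s] r_1 by (cases s) simp_all
next
  case (Cons b u)
  then show ?case
    using later_weight_snoc[of 1 u b] by (cases "b = s") (simp_all add: distrib_left[symmetric] del: One_nat_def)
qed

text \<open>
  Either the first run extends to the left of the window, or it begins exactly there.
\<close>

lemma first_weight_step:
  "k \<ge> 1 \<Longrightarrow> first_weight u s (Suc k) + later_weight u s k = first_weight u s k"
proof (induction u arbitrary: s k)
  case Nil
  then show ?case using R_step[of k s] by simp
next
  case (Cons b u)
  then show ?case using r_step[of k s] by (simp add: distrib_right[symmetric])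
qed

lemma word_weight_measure:
  obtains M where "M \<in> invariant_measures" "\<And>u. measure M (cylinder u) = word_weight u"
proof (rule stationary_weights_measure)
  show "word_weight [] = 1" by simp
  show "0 \<le> word_weight u" for u
    using mean_length_ge_1 first_weight_nonneg by (cases u) simp_all
  show "word_weight (u @ [False]) + word_weight (u @ [True]) = word_weight u" for u
  proof (cases u)
    case Nil
    then show ?thesis using mean_length_ge_1
      by (simp add: add_divide_distrib[symmetric] mean_length_def[symmetric] del: One_nat_def)
  next
    case (Cons s v)
    then show ?thesis using first_weight_snoc[of 1 v s] by (simp add: add_divide_distrib[symmetric])
  qed
  show "word_weight (False # u) + word_weight (True # u) = word_weight u" for u
  proof (cases u)
    case Nil
    then show ?thesis using mean_length_ge_1
      by (simp add: add_divide_distrib[symmetric] mean_length_def[symmetric] del: One_nat_def)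
  next
    case (Cons s v)
    then show ?thesis using first_weight_step[of 1 v s] r_1
      by (cases s) (simp_all add: add_divide_distrib[symmetric] add.commute)
  qed
qed (rule that)

end

text \<open>
  Comparison with a geometric series. By the last conclusion the tail sums decay at the same rate,
  so that the lemma applies to them again.
\<close>

lemma decaying_tail:
  fixes w :: "nat \<Rightarrow> real"
  assumes w: "\<And>k. 0 \<le> w k" and decay: "\<And>k. k \<ge> 1 \<Longrightarrow> w (Suc k) \<le> \<theta> * w k"
    and \<theta>: "0 \<le> \<theta>" "\<theta> < 1" and k: "k \<ge> 1"
  shows "summable (\<lambda>j. w (k + j))"
    and "(\<Sum>j. w (k + j)) = w k + (\<Sum>j. w (Suc k + j))"
    and "(\<Sum>j. w (k + j)) \<le> w k / (1 - \<theta>)"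
    and "(\<Sum>j. w (Suc k + j)) \<le> \<theta> * (\<Sum>j. w (k + j))"
proof -
  have geom: "w (n + j) \<le> w n * \<theta> ^ j" if "n \<ge> 1" for n j
  proof (induction j)
    case (Suc j)
    have "w (n + Suc j) \<le> \<theta> * w (n + j)" using decay[of "n + j"] that by simp
    also have "\<dots> \<le> \<theta> * (w n * \<theta> ^ j)" by (rule mult_left_mono[OF Suc \<theta>(1)])
    finally show ?case by (simp add: mult_ac)
  qed simp
  have gs: "summable (\<lambda>j. c * \<theta> ^ j)" for c
    using \<theta> by (intro summable_mult summable_geometric) simp
  have sm: "summable (\<lambda>j. w (n + j))" if "n \<ge> 1" for n
    by (rule summable_comparison_test'[OF gs[of "w n"], of 0]) (use geom[OF that] w in simp)
  show "summable (\<lambda>j. w (k + j))" by (rule sm[OF k])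
  show "(\<Sum>j. w (k + j)) = w k + (\<Sum>j. w (Suc k + j))"
    using suminf_split_head[OF sm[OF k]] by simp
  have "(\<Sum>j. w (k + j)) \<le> (\<Sum>j. w k * \<theta> ^ j)"
    by (rule suminf_le[OF geom[OF k] sm[OF k] gs])
  also have "\<dots> = w k / (1 - \<theta>)"
    using \<theta> by (simp add: suminf_mult suminf_geometric)
  finally show "(\<Sum>j. w (k + j)) \<le> w k / (1 - \<theta>)" .
  have "(\<Sum>j. w (Suc k + j)) \<le> (\<Sum>j. \<theta> * w (k + j))"
    by (rule suminf_le[OF _ sm summable_mult[OF sm[OF k]]]) (use decay[of "k + _"] k in simp_all)
  also have "\<dots> = \<theta> * (\<Sum>j. w (k + j))" by (rule suminf_mult[OF sm[OF k]])
  finally show "(\<Sum>j. w (Suc k + j)) \<le> \<theta> * (\<Sum>j. w (k + j))" .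
qed

lemma birkhoff_sum_add:
  "birkhoff_sum f (m + n) x = birkhoff_sum f m x + birkhoff_sum f n ((shift ^^ m) x)"
  by (induction m arbitrary: x) (simp_all add: funpow_swap1)

lemma birkhoff_sum_scale: "birkhoff_sum (\<lambda>x. c * f x) n x = c * birkhoff_sum f n x"
  by (induction n arbitrary: x) (simp_all add: distrib_left)

lemma double_hofbauer_initial_run:
  assumes "n \<ge> 1" "x \<in> initial_run s n"
  shows "double_hofbauer \<gamma> \<delta> x = hofbauer_value (run_exponent \<gamma> \<delta> s) n"
proof -
  have "x 0 = s" using assms by (simp add: initial_run_def)
  moreover have "run_length s x = Some n" using assms by (simp add: run_length_Some)
  ultimately show ?thesis by (simp add: double_hofbauer_eq)
qed

lemma shift_initial_run: "x \<in> initial_run s (Suc n) \<Longrightarrow> shift x \<in> initial_run s n"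
  by (simp add: initial_run_def shift_def)

lemma birkhoff_sum_run:
  assumes "k \<le> n" "n \<ge> 1" "x \<in> initial_run s n"
  shows "birkhoff_sum (double_hofbauer \<gamma> \<delta>) k x =
    (if k = n then - run_cost (run_exponent \<gamma> \<delta> s) n
     else - run_exponent \<gamma> \<delta> s * (ln (real n) - ln (real (n - k))))"
  using assms
proof (induction k arbitrary: n x)
  case 0
  then show ?case by simp
next
  case (Suc k)
  let ?e = "run_exponent \<gamma> \<delta> s"
  from Suc.prems obtain m where m: "n = Suc m" by (cases n) auto
  have g: "double_hofbauer \<gamma> \<delta> x = hofbauer_value ?e n"
    by (rule double_hofbauer_initial_run) (use Suc.prems in auto)
  show ?case
  proof (cases "m = 0")
    case True
    then show ?thesis using Suc.prems g by (simp add: m hofbauer_value_def run_cost_def)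
  next
    case False
    have "shift x \<in> initial_run s m" by (rule shift_initial_run) (use Suc.prems m in simp)
    then have IH: "birkhoff_sum (double_hofbauer \<gamma> \<delta>) k (shift x) =
      (if k = m then - run_cost ?e m else - ?e * (ln (real m) - ln (real (m - k))))"
      using Suc.prems False m by (intro Suc.IH) auto
    have "hofbauer_value ?e n = - ?e * (ln (real n) - ln (real m))"
      using False by (simp add: hofbauer_value_def m ln_div)
    then show ?thesis
      using g IH by (simp add: m run_cost_def algebra_simps)
  qed
qed

lemma birkhoff_sum_constant: "birkhoff_sum (double_hofbauer \<gamma> \<delta>) k (\<lambda>_. s) = 0"
proof (induction k)
  case (Suc k)
  have "shift (\<lambda>_. s) = (\<lambda>_. s)" by (simp add: shift_def)
  then show ?case using Suc by (simp add: double_hofbauer_fixed)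
qed simp

text \<open>
  If the run is longer than \<open>k\<close>, say of length \<open>n\<close>, then its first
  \<open>k\<close> symbols cost \<open>ln (n / (n - k))\<close> times the exponent, and \<open>n /
  (n - k) \<le> 2 k\<close>. So up to a constant a partial run costs at most as much as a complete
  one.
\<close>

lemma birkhoff_sum_partial_run:
  assumes \<gamma>\<delta>: "\<gamma> > 1" "\<delta> > 1" and k: "k \<ge> 1" and x: "\<And>i. i < k \<Longrightarrow> x i = s"
  shows "birkhoff_sum (double_hofbauer \<gamma> \<delta>) k x
    \<ge> - run_cost (run_exponent \<gamma> \<delta> s) k - (\<gamma> + \<delta>) * ln 2"
proof (cases "run_length s x")
  case None
  then have "birkhoff_sum (double_hofbauer \<gamma> \<delta>) k x = 0"
    using birkhoff_sum_constant by (simp only: run_length_None)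
  moreover have "0 \<le> run_cost (run_exponent \<gamma> \<delta> s) k" using \<gamma>\<delta> k by (intro run_cost_nonneg) auto
  moreover have "0 \<le> (\<gamma> + \<delta>) * ln 2" using \<gamma>\<delta> by simp
  ultimately show ?thesis by linarith
next
  case (Some n)
  let ?e = "run_exponent \<gamma> \<delta> s"
  have n: "x \<in> initial_run s n" using Some by (simp only: run_length_Some)
  have "k \<le> n"
  proof (rule ccontr)
    assume "\<not> k \<le> n"
    then have "x n = s" by (intro x) simp
    then show False using n by (simp add: initial_run_def)
  qed
  have e: "1 < ?e" "?e \<le> \<gamma> + \<delta>" using \<gamma>\<delta> by auto
  have E: "0 \<le> (\<gamma> + \<delta>) * ln 2" "?e * ln 2 \<le> (\<gamma> + \<delta>) * ln 2"
    using \<gamma>\<delta> e by (simp, intro mult_right_mono, auto)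
  show ?thesis
  proof (cases "k = n")
    case True
    then show ?thesis using birkhoff_sum_run[OF \<open>k \<le> n\<close> _ n] k E by simp
  next
    case False
    then have kn: "k < n" using \<open>k \<le> n\<close> by simp
    have "real n / real (n - k) \<le> 2 * real k"
    proof -
      have "real n = real k + real (n - k)" using kn by simp
      also have "\<dots> \<le> real k * real (n - k) + real k * real (n - k)"
        using k kn by (intro add_mono) (auto simp: mult_le_cancel_left1 mult_le_cancel_right1)
      finally show ?thesis using kn by (simp add: divide_le_eq mult_ac)
    qed
    then have "ln (real n / real (n - k)) \<le> ln (2 * real k)"
      using kn k by (intro ln_mono) auto
    then have "ln (real n) - ln (real (n - k)) \<le> ln 2 + ln (real k)"
      using kn k by (simp add: ln_div ln_mult)
    then have "?e * (ln (real n) - ln (real (n - k))) \<le> ?e * (ln 2 + ln (real k))"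
      using e by (intro mult_left_mono) auto
    also have "\<dots> \<le> run_cost ?e k + (\<gamma> + \<delta>) * ln 2"
      unfolding run_cost_def distrib_left using E(2) ln_gt_zero[OF zeta_gt_1[OF e(1)]] by linarith
    finally have "- run_cost ?e k - (\<gamma> + \<delta>) * ln 2 \<le> - ?e * (ln (real n) - ln (real (n - k)))"
      by linarith
    then show ?thesis using birkhoff_sum_run[OF \<open>k \<le> n\<close> _ n] k kn by simp
  qed
qed

text \<open>
  In the renewal process with run length weights \<open>w s k = exp (- k p - \<beta> run_cost k) /
  A s\<close>, where \<open>A s\<close> is the run sum, the mass of a cylinder is a product over
  the runs of the word. Each complete run contributes the exponential of its Birkhoff sum minus
  \<open>k p\<close>, up to the factor \<open>1 / A s\<close>. These factors cancel pairwise
  because the runs alternate and the product of the run sums is 1. The first and the last run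
  contribute tail sums, which geometric decay bounds by a constant times the first term.
\<close>

theorem double_hofbauer_pressure_ge:
  assumes \<gamma>\<delta>: "\<gamma> > 1" "\<delta> > 1" and \<beta>: "\<beta> \<ge> 0" and p: "p > 0"
    and eq: "run_sum \<gamma> \<beta> p * run_sum \<delta> \<beta> p = 1"
  shows "ereal p \<le> topological_pressure (\<lambda>x. \<beta> * double_hofbauer \<gamma> \<delta> x)"
proof -
  let ?g = "double_hofbauer \<gamma> \<delta>" and ?e = "run_exponent \<gamma> \<delta>"
  let ?f = "\<lambda>x. \<beta> * ?g x"
  interpret G: regular_potential ?g "\<lambda>k. run_variation \<gamma> k + run_variation \<delta> k"
    by (rule double_hofbauer_regular[OF \<gamma>\<delta>])
  interpret F: regular_potential ?f "\<lambda>k. \<bar>\<beta>\<bar> * (run_variation \<gamma> k + run_variation \<delta> k)"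
    by (rule G.scale)
  have e1: "?e s > 1" for s using \<gamma>\<delta> by simp
  define A where "A s = run_sum (?e s) \<beta> p" for s
  have A0: "A s > 0" for s unfolding A_def by (rule run_sum_pos[OF e1 \<beta> p])
  have AA: "A s * A (\<not> s) = 1" for s using eq by (cases s) (simp_all add: A_def mult.commute)
  define \<theta> where "\<theta> = exp (- p)"
  have \<theta>: "0 \<le> \<theta>" "\<theta> < 1" using p by (simp_all add: \<theta>_def)
  define \<rho> where "\<rho> = 1 / (1 - \<theta>)"
  have \<rho>: "\<rho> \<ge> 1" using \<theta> by (simp add: \<rho>_def)
  define a where "a s k = exp (- real k * p - \<beta> * run_cost (?e s) k)" for s k
  define w where "w s k = a s k / A s" for s k
  define r where "r s k = (\<Sum>j. w s (k + j))" for s k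
  define R where "R s k = (\<Sum>j. r s (k + j))" for s k
  have w0: "0 \<le> w s k" for s k using A0[of s] by (simp add: w_def a_def)
  have w_decay: "w s (Suc k) \<le> \<theta> * w s k" if k: "k \<ge> 1" for s k
  proof -
    have "run_cost (?e s) k \<le> run_cost (?e s) (Suc k)"
      using k e1[of s] unfolding run_cost_def by (intro add_right_mono mult_left_mono ln_mono) auto
    then have "\<beta> * run_cost (?e s) k \<le> \<beta> * run_cost (?e s) (Suc k)"
      using \<beta> by (rule mult_left_mono)
    then have "a s (Suc k) \<le> \<theta> * a s k"
      by (simp add: a_def \<theta>_def exp_add[symmetric] algebra_simps)
    then show ?thesis using A0[of s] by (simp add: w_def divide_right_mono)
  qed
  have w_tail: "summable (\<lambda>j. w s (k + j))"
      "(\<Sum>j. w s (k + j)) = w s k + (\<Sum>j. w s (Suc k + j))"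
      "(\<Sum>j. w s (k + j)) \<le> w s k / (1 - \<theta>)"
      "(\<Sum>j. w s (Suc k + j)) \<le> \<theta> * (\<Sum>j. w s (k + j))" if "k \<ge> 1" for s k
    by (rule decaying_tail[OF w0 _ \<theta> that], erule w_decay)+
  have r0: "0 \<le> r s k" for s k
  proof (cases "k = 0")
    case False
    then have "summable (\<lambda>j. w s (k + j))" by (intro w_tail) auto
    then show ?thesis unfolding r_def using w0 by (intro suminf_nonneg)
  next
    case True
    have "summable (\<lambda>j. w s (1 + j))" by (rule w_tail) auto
    then have "summable (\<lambda>j. w s j)" using summable_Suc_iff[of "w s"] by simp
    then show ?thesis unfolding r_def True using w0 by (intro suminf_nonneg) auto
  qed
  have r_decay: "r s (Suc k) \<le> \<theta> * r s k" if "k \<ge> 1" for s k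
    unfolding r_def by (rule w_tail(4)[OF that])
  have r_tail: "summable (\<lambda>j. r s (k + j))"
      "(\<Sum>j. r s (k + j)) = r s k + (\<Sum>j. r s (Suc k + j))"
      "(\<Sum>j. r s (k + j)) \<le> r s k / (1 - \<theta>)" if "k \<ge> 1" for s k
    by (rule decaying_tail[OF r0 _ \<theta> that], erule r_decay)+
  have R0: "0 \<le> R s k" for s k
  proof (cases "k = 0")
    case False
    then have "summable (\<lambda>j. r s (k + j))" by (intro r_tail) auto
    then show ?thesis unfolding R_def using r0 by (intro suminf_nonneg)
  next
    case True
    have "summable (\<lambda>j. r s (1 + j))" by (rule r_tail) auto
    then have "summable (\<lambda>j. r s j)" using summable_Suc_iff[of "r s"] by simp
    then show ?thesis unfolding R_def True using r0 by (intro suminf_nonneg) auto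
  qed
  have r1: "r s 1 = 1" for s
  proof -
    have "(\<Sum>j. a s (Suc j)) = A s" by (simp add: A_def run_sum_def a_def)
    moreover have "summable (\<lambda>j. a s (Suc j))" unfolding a_def by (rule run_sum_summable[OF e1 \<beta> p])
    ultimately show ?thesis using A0[of s] by (simp add: r_def w_def suminf_divide)
  qed
  interpret alternating_renewal w r R
    by unfold_locales (use w0 r0 R0 r1 w_tail(2) r_tail(2) in \<open>auto simp: r_def R_def\<close>)
  obtain M where M: "M \<in> invariant_measures" and M_cyl: "\<And>u. measure M (cylinder u) = word_weight u"
    using word_weight_measure by blast
  have r_le: "r s k \<le> \<rho> * w s k" if "k \<ge> 1" for s k
    using w_tail(3)[OF that, of s] by (simp add: r_def \<rho>_def)
  have R_le: "R s k \<le> \<rho> * r s k" if "k \<ge> 1" for s k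
    using r_tail(3)[OF that, of s] by (simp add: R_def \<rho>_def)
  \<comment> \<open>The bound for the mass of the cylinder of the first \<open>n\<close> symbols of \<open>x\<close>, up to a constant.\<close>
  define S where "S n x = exp (birkhoff_sum ?f n x - real n * p)" for n x
  have S_pos: "S n x > 0" for n x by (simp add: S_def)
  have S_add: "S (k + j) x = S k x * S j ((shift ^^ k) x)" for k j x
    unfolding S_def birkhoff_sum_add exp_add[symmetric] by (simp add: algebra_simps)
  define c where "c = exp (\<beta> * ((\<gamma> + \<delta>) * ln 2))"
  have c: "c > 0" by (simp add: c_def)
  have partial_run: "a s k \<le> c * S k x" if "k \<ge> 1" "\<And>i. i < k \<Longrightarrow> x i = s" for s k x
  proof -
    have "\<beta> * (- run_cost (?e s) k - (\<gamma> + \<delta>) * ln 2) \<le> \<beta> * birkhoff_sum ?g k x"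
      by (rule mult_left_mono[OF birkhoff_sum_partial_run[OF \<gamma>\<delta> that] \<beta>])
    then show ?thesis
      unfolding a_def S_def c_def exp_add[symmetric] birkhoff_sum_scale exp_le_cancel_iff
      by (simp add: algebra_simps)
  qed
  have full_run: "a s k = S k x" if "k \<ge> 1" "x \<in> initial_run s k" for s k x
    using birkhoff_sum_run[OF order_refl that, of \<gamma> \<delta>]
    by (simp add: a_def S_def birkhoff_sum_scale)
  \<comment> \<open>The run sums are not 1 separately; \<open>D\<close> keeps track of the factor \<open>1 / A s\<close> of the current run.\<close>
  define D where "D s = (if s then A False else 1)" for s
  have D0: "D s > 0" for s using A0 by (simp add: D_def)
  have DA: "D (\<not> s) / A s = D s" for s
    using AA[of s] A0[of s] by (cases s) (simp_all add: D_def field_simps)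
  define B where "B = 1 + A False + A True"
  have B1: "B \<ge> 1" using A0[of False] A0[of True] by (simp add: B_def)
  have inv: "1 / A s = A (\<not> s)" for s using AA[of s] A0[of s] by (simp add: field_simps)
  have AB: "1 / A s \<le> B" for s
    unfolding inv using A0[of False] A0[of True] by (cases s) (simp_all add: B_def)
  have DB: "D s \<le> B" for s using A0[of False] A0[of True] by (cases s) (simp_all add: D_def B_def)
  have ABD: "1 / A s \<le> B * D s" for s
    unfolding inv using A0[of False] A0[of True] B1
    by (cases s) (simp_all add: D_def B_def mult_le_cancel_right1)
  define K where "K = c * \<rho> * B"
  have K: "K \<ge> 0" using c \<rho> B1 by (simp add: K_def)
  have later: "later_weight u s k \<le> K * D s * S (k + length u) x"
    if "k \<ge> 1" "\<And>i. i < k \<Longrightarrow> x i = s" "initial_word (length u) ((shift ^^ k) x) = u" for u s k x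
    using that
  proof (induction u arbitrary: s k x)
    case Nil
    have "r s k \<le> \<rho> * (a s k / A s)" using r_le[OF Nil(1), of s] by (simp add: w_def)
    also have "\<dots> = \<rho> * (1 / A s) * a s k" by simp
    also have "\<dots> \<le> \<rho> * (B * D s) * (c * S k x)"
      using \<rho> ABD[of s] partial_run[OF Nil(1,2)] D0[of s] B1 A0[of s]
      by (intro mult_mono) (auto simp: a_def)
    finally show ?case by (simp add: K_def mult_ac)
  next
    case (Cons b u)
    have word: "((shift ^^ k) x) 0 # initial_word (length u) (shift ((shift ^^ k) x)) = b # u"
      using Cons.prems(3) by (simp add: initial_word_Suc)
    then have xk: "x k = b" by (simp add: shift_funpow)
    from word have rest: "initial_word (length u) ((shift ^^ Suc k) x) = u" by simp
    show ?case
    proof (cases "b = s")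
      case True
      have "later_weight u s (Suc k) \<le> K * D s * S (Suc k + length u) x"
      proof (rule Cons.IH)
        fix i assume "i < Suc k"
        then show "x i = s" using Cons.prems(2)[of i] xk True by (cases "i = k") auto
      qed (use rest in simp_all)
      then show ?thesis using True by simp
    next
      case False
      then have b: "b = (\<not> s)" by auto
      have run: "x \<in> initial_run s k" using Cons.prems(2) xk b by (simp add: initial_run_def)
      let ?y = "(shift ^^ k) x"
      have "later_weight u b 1 \<le> K * D b * S (1 + length u) ?y"
      proof (rule Cons.IH)
        show "?y i = b" if "i < 1" for i using that xk by (simp add: shift_funpow)
        show "initial_word (length u) ((shift ^^ 1) ?y) = u" using rest by simp
      qed simp
      then have "w s k * later_weight u b 1 \<le> w s k * (K * D b * S (1 + length u) ?y)"
        by (rule mult_left_mono[OF _ w0])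
      also have "\<dots> = K * (D (\<not> s) / A s) * (S k x * S (1 + length u) ?y)"
        using full_run[OF Cons.prems(1) run] by (simp add: w_def b)
      also have "\<dots> = K * D s * S (k + length (b # u)) x" unfolding DA S_add[symmetric] by simp
      finally show ?thesis using False by simp
    qed
  qed
  have first: "first_weight u s k \<le> \<rho> * K * B * S (k + length u) x"
    if "k \<ge> 1" "\<And>i. i < k \<Longrightarrow> x i = s" "initial_word (length u) ((shift ^^ k) x) = u" for u s k x
    using that
  proof (induction u arbitrary: s k x)
    case Nil
    have "R s k \<le> \<rho> * (\<rho> * w s k)"
      by (rule order_trans[OF R_le[OF Nil(1)] mult_left_mono[OF r_le[OF Nil(1)]]]) (use \<rho> in simp)
    also have "\<dots> = \<rho> * (\<rho> * (1 / A s) * a s k)" by (simp add: w_def)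
    also have "\<dots> \<le> \<rho> * (\<rho> * B * (c * S k x))"
      using \<rho> AB[of s] partial_run[OF Nil(1,2)] B1 A0[of s]
      by (intro mult_left_mono mult_mono) (auto simp: a_def)
    also have "\<dots> = \<rho> * K * 1 * S k x" by (simp add: K_def mult_ac)
    also have "\<dots> \<le> \<rho> * K * B * S k x"
      using \<rho> K B1 S_pos[of k x] by (intro mult_right_mono mult_left_mono) auto
    finally show ?case by simp
  next
    case (Cons b u)
    have word: "((shift ^^ k) x) 0 # initial_word (length u) (shift ((shift ^^ k) x)) = b # u"
      using Cons.prems(3) by (simp add: initial_word_Suc)
    then have xk: "x k = b" by (simp add: shift_funpow)
    from word have rest: "initial_word (length u) ((shift ^^ Suc k) x) = u" by simp
    show ?case
    proof (cases "b = s")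
      case True
      have "first_weight u s (Suc k) \<le> \<rho> * K * B * S (Suc k + length u) x"
      proof (rule Cons.IH)
        fix i assume "i < Suc k"
        then show "x i = s" using Cons.prems(2)[of i] xk True by (cases "i = k") auto
      qed (use rest in simp_all)
      then show ?thesis using True by simp
    next
      case False
      then have b: "b = (\<not> s)" by auto
      have run: "x \<in> initial_run s k" using Cons.prems(2) xk b by (simp add: initial_run_def)
      let ?y = "(shift ^^ k) x"
      have "later_weight u b 1 \<le> K * D b * S (1 + length u) ?y"
      proof (rule later)
        show "?y i = b" if "i < 1" for i using that xk by (simp add: shift_funpow)
        show "initial_word (length u) ((shift ^^ 1) ?y) = u" using rest by simp
      qed simp
      then have "r s k * later_weight u b 1 \<le> (\<rho> * w s k) * (K * D b * S (1 + length u) ?y)"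
        using r_le[OF Cons.prems(1), of s] \<rho> w0[of s k] later_weight_nonneg[of u b 1]
        by (intro mult_mono) auto
      also have "\<dots> = \<rho> * K * (D (\<not> s) / A s) * (S k x * S (1 + length u) ?y)"
        using full_run[OF Cons.prems(1) run] by (simp add: w_def b)
      also have "\<dots> = \<rho> * K * D s * S (k + length (b # u)) x" unfolding DA S_add[symmetric] by simp
      also have "\<dots> \<le> \<rho> * K * B * S (k + length (b # u)) x"
        using \<rho> K DB[of s] S_pos[of "k + length (b # u)" x] by (intro mult_right_mono mult_left_mono) auto
      finally show ?thesis using False by simp
    qed
  qed
  show ?thesis
  proof (rule F.topological_pressure_ge[OF M])
    fix x :: omega and n :: nat
    assume "n > 0"
    then obtain j where n: "n = Suc j" by (cases n) auto
    have "measure M (cylinder (initial_word n x)) = first_weight (initial_word j (shift x)) (x 0) 1 / mean_length"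
      unfolding M_cyl n initial_word_Suc by simp
    also have "\<dots> \<le> first_weight (initial_word j (shift x)) (x 0) 1 / 1"
      using mean_length_ge_1 first_weight_nonneg by (intro divide_left_mono) auto
    also have "\<dots> = first_weight (initial_word j (shift x)) (x 0) 1" by simp
    also have "\<dots> \<le> \<rho> * K * B * S (1 + length (initial_word j (shift x))) x"
      by (rule first) simp_all
    finally show "measure M (cylinder (initial_word n x)) \<le> \<rho> * K * B * exp (birkhoff_sum ?f n x - real n * p)"
      by (simp add: S_def n)
  qed
qed

section \<open>The pressure equation\<close>

text \<open>
  Divided by \<open>run_sum\<close>, this and the next moment are the means of the length and of
  the cost of a run; they are minus the partial derivatives of \<open>run_sum\<close> with respect
  to \<open>p\<close> and \<open>\<beta>\<close>.
\<close>

definition length_moment :: "real \<Rightarrow> real \<Rightarrow> real \<Rightarrow> real" where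
  "length_moment a \<beta> p = (\<Sum>n. real (Suc n) * exp (- real (Suc n) * p - \<beta> * run_cost a (Suc n)))"

definition cost_moment :: "real \<Rightarrow> real \<Rightarrow> real \<Rightarrow> real" where
  "cost_moment a \<beta> p = (\<Sum>n. run_cost a (Suc n) * exp (- real (Suc n) * p - \<beta> * run_cost a (Suc n)))"

lemma run_cost_le_linear:
  assumes "a > 1" shows "run_cost a (Suc n) \<le> (a + ln (zeta a)) * real (Suc n)"
proof -
  have "a * ln (real (Suc n)) \<le> a * real (Suc n)"
  proof (rule mult_left_mono)
    show "ln (real (Suc n)) \<le> real (Suc n)" using ln_le_minus_one[of "real (Suc n)"] by linarith
  qed (use assms in simp)
  moreover have "ln (zeta a) * 1 \<le> ln (zeta a) * real (Suc n)"
    using zeta_gt_1[OF assms] by (intro mult_left_mono) auto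
  ultimately show ?thesis unfolding run_cost_def distrib_right by linarith
qed

lemma linear_geometric_summable:
  assumes p: "p > (0::real)" shows "summable (\<lambda>n. real (Suc n) * exp (- real (Suc n) * p))"
proof (rule summable_comparison_test'[OF summable_mult[OF geometric_summable(1)[of "p / 2"], of "2 / p"], of 0])
  fix n
  have "real (Suc n) * (p / 2) \<le> exp (real (Suc n) * (p / 2))"
    using exp_ge_add_one_self[of "real (Suc n) * (p / 2)"] by linarith
  then have "real (Suc n) \<le> 2 / p * exp (real (Suc n) * (p / 2))"
    using p by (simp add: field_simps)
  then have "real (Suc n) * exp (- real (Suc n) * p) \<le> 2 / p * exp (real (Suc n) * (p / 2)) * exp (- real (Suc n) * p)"
    by (rule mult_right_mono) simp
  also have "\<dots> = 2 / p * exp (- real (Suc n) * (p / 2))"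
    unfolding mult.assoc exp_add[symmetric] by (simp add: field_simps)
  finally show "norm (real (Suc n) * exp (- real (Suc n) * p)) \<le> 2 / p * exp (- real (Suc n) * (p / 2))"
    by simp
qed (use p in simp)

lemma weighted_term_le:
  assumes a: "a > 1" and \<beta>: "\<beta> \<ge> 0" and p: "\<epsilon> \<le> p"
    and \<phi>: "\<bar>\<phi> n\<bar> \<le> K * real (Suc n)"
  shows "\<bar>\<phi> n * exp (- real (Suc n) * p - \<beta> * run_cost a (Suc n))\<bar> \<le> K * (real (Suc n) * exp (- real (Suc n) * \<epsilon>))"
proof -
  have "real (Suc n) * \<epsilon> \<le> real (Suc n) * p" using p by (intro mult_left_mono) auto
  then have "exp (- real (Suc n) * p) \<le> exp (- real (Suc n) * \<epsilon>)"
    by (simp only: exp_le_cancel_iff mult_minus_left neg_le_iff_le)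
  then have "exp (- real (Suc n) * p - \<beta> * run_cost a (Suc n)) \<le> exp (- real (Suc n) * \<epsilon>)"
    using run_term_le[OF a \<beta>, of n p] by linarith
  then have "\<bar>\<phi> n\<bar> * exp (- real (Suc n) * p - \<beta> * run_cost a (Suc n)) \<le> K * real (Suc n) * exp (- real (Suc n) * \<epsilon>)"
    using \<phi> by (intro mult_mono) (auto intro: order_trans[OF abs_ge_zero])
  then show ?thesis by (simp add: abs_mult mult.assoc)
qed

lemma weighted_summable:
  assumes "a > 1" "\<beta> \<ge> 0" "p > 0" "\<And>n. \<bar>\<phi> n\<bar> \<le> K * real (Suc n)"
  shows "summable (\<lambda>n. \<phi> n * exp (- real (Suc n) * p - \<beta> * run_cost a (Suc n)))"
proof (rule summable_comparison_test'[OF summable_mult[OF linear_geometric_summable[OF assms(3)], of K], of 0])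
  fix n
  show "norm (\<phi> n * exp (- real (Suc n) * p - \<beta> * run_cost a (Suc n))) \<le> K * (real (Suc n) * exp (- real (Suc n) * p))"
    using weighted_term_le[where \<phi> = \<phi>, OF assms(1,2) order_refl assms(4)[of n]] by simp
qed

text \<open>
  The Weierstrass M-test: away from \<open>p = 0\<close> the terms are dominated by \<open>K n exp
  (- n \<epsilon>)\<close>, uniformly in \<open>\<beta> \<ge> 0\<close>.
\<close>

lemma weighted_continuous:
  fixes b q :: "real \<Rightarrow> real"
  assumes a: "a > 1" and b: "continuous_on A b" "\<And>x. x \<in> A \<Longrightarrow> 0 \<le> b x"
    and q: "continuous_on A q" "\<And>x. x \<in> A \<Longrightarrow> \<epsilon> \<le> q x" and \<epsilon>: "\<epsilon> > 0"
    and \<phi>: "\<And>n. \<bar>\<phi> n\<bar> \<le> K * real (Suc n)"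
  shows "continuous_on A (\<lambda>x. \<Sum>n. \<phi> n * exp (- real (Suc n) * q x - b x * run_cost a (Suc n)))"
proof (rule uniform_limit_theorem)
  show "uniform_limit A (\<lambda>m x. \<Sum>n<m. \<phi> n * exp (- real (Suc n) * q x - b x * run_cost a (Suc n)))
      (\<lambda>x. \<Sum>n. \<phi> n * exp (- real (Suc n) * q x - b x * run_cost a (Suc n))) sequentially"
  proof (rule Weierstrass_m_test)
    show "summable (\<lambda>n. K * (real (Suc n) * exp (- real (Suc n) * \<epsilon>)))"
      by (rule summable_mult[OF linear_geometric_summable[OF \<epsilon>]])
    fix n x assume x: "x \<in> A"
    show "norm (\<phi> n * exp (- real (Suc n) * q x - b x * run_cost a (Suc n)))
        \<le> K * (real (Suc n) * exp (- real (Suc n) * \<epsilon>))"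
      using weighted_term_le[where \<phi> = \<phi>, OF a b(2)[OF x] q(2)[OF x] \<phi>[of n]] by simp
  qed
  show "\<forall>\<^sub>F m in sequentially. continuous_on A (\<lambda>x. \<Sum>n<m. \<phi> n * exp (- real (Suc n) * q x - b x * run_cost a (Suc n)))"
    by (intro always_eventually allI continuous_intros b q)
qed simp

lemma moment_coefficients:
  assumes "a > 1"
  shows "\<bar>1\<bar> \<le> 1 * real (Suc n)" "\<bar>real (Suc n)\<bar> \<le> 1 * real (Suc n)"
    "\<bar>run_cost a (Suc n)\<bar> \<le> (a + ln (zeta a)) * real (Suc n)"
  using run_cost_le_linear[OF assms, of n] run_cost_nonneg[OF assms, of "Suc n"] by simp_all

lemma moments_summable:
  assumes "a > 1" "\<beta> \<ge> 0" "p > 0"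
  shows "summable (\<lambda>n. real (Suc n) * exp (- real (Suc n) * p - \<beta> * run_cost a (Suc n)))"
    and "summable (\<lambda>n. run_cost a (Suc n) * exp (- real (Suc n) * p - \<beta> * run_cost a (Suc n)))"
  by (rule weighted_summable[OF assms], rule moment_coefficients[OF assms(1)])+

lemma moments_continuous:
  fixes b q :: "real \<Rightarrow> real"
  assumes a: "a > 1" and b: "continuous_on A b" "\<And>x. x \<in> A \<Longrightarrow> 0 \<le> b x"
    and q: "continuous_on A q" "\<And>x. x \<in> A \<Longrightarrow> \<epsilon> \<le> q x" and \<epsilon>: "\<epsilon> > 0"
  shows "continuous_on A (\<lambda>x. run_sum a (b x) (q x))"
    and "continuous_on A (\<lambda>x. length_moment a (b x) (q x))"
    and "continuous_on A (\<lambda>x. cost_moment a (b x) (q x))"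
proof -
  have cont: "continuous_on A (\<lambda>x. \<Sum>n. \<phi> n * exp (- real (Suc n) * q x - b x * run_cost a (Suc n)))"
    if "\<And>n. \<bar>\<phi> n\<bar> \<le> K * real (Suc n)" for \<phi> :: "nat \<Rightarrow> real" and K
  proof (rule weighted_continuous)
    show "0 \<le> b x" if "x \<in> A" for x by (rule b(2)[OF that])
    show "\<epsilon> \<le> q x" if "x \<in> A" for x by (rule q(2)[OF that])
    show "\<bar>\<phi> n\<bar> \<le> K * real (Suc n)" for n by (rule that)
  qed (fact a b(1) q(1) \<epsilon>)+
  show "continuous_on A (\<lambda>x. run_sum a (b x) (q x))"
    using cont[of "\<lambda>_. 1", OF moment_coefficients(1)[OF a]] by (simp add: run_sum_def)
  show "continuous_on A (\<lambda>x. length_moment a (b x) (q x))"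
    unfolding length_moment_def by (rule cont[OF moment_coefficients(2)[OF a]])
  show "continuous_on A (\<lambda>x. cost_moment a (b x) (q x))"
    unfolding cost_moment_def by (rule cont[OF moment_coefficients(3)[OF a]])
qed

lemma length_moment_pos:
  assumes "a > 1" "\<beta> \<ge> 0" "p > 0" shows "length_moment a \<beta> p > 0"
  unfolding length_moment_def by (rule suminf_pos[OF moments_summable(1)[OF assms]]) simp

lemma cost_moment_nonneg:
  assumes "a > 1" "\<beta> \<ge> 0" "p > 0" shows "cost_moment a \<beta> p \<ge> 0"
  unfolding cost_moment_def
  by (rule suminf_nonneg[OF moments_summable(2)[OF assms]]) (use run_cost_nonneg[OF assms(1)] in simp)

text \<open>
  The logarithm of a sum of exponentials of affine functions is convex; this is its supporting
  plane. The proof is Jensen's inequality for the exponential function: use \<open>exp x \<ge> exp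
  m * (1 + x - m)\<close> in each term, where \<open>m\<close> is the mean of the exponents
  \<open>x\<close>.
\<close>

lemma ln_run_sum_tangent:
  assumes a: "a > 1" and \<beta>: "\<beta> \<ge> 0" "\<beta>' \<ge> 0" and p: "p > 0" "p' > 0"
  shows "ln (run_sum a \<beta>' p') - ln (run_sum a \<beta> p)
    \<ge> - (p' - p) * (length_moment a \<beta> p / run_sum a \<beta> p) - (\<beta>' - \<beta>) * (cost_moment a \<beta> p / run_sum a \<beta> p)"
proof -
  let ?F = "run_sum a \<beta> p" and ?N = "length_moment a \<beta> p" and ?C = "cost_moment a \<beta> p"
  define m where "m = (- (p' - p) * ?N - (\<beta>' - \<beta>) * ?C) / ?F"
  define t where "t n = exp (- real (Suc n) * p - \<beta> * run_cost a (Suc n))" for n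
  have F: "?F > 0" "run_sum a \<beta>' p' > 0" using run_sum_pos a \<beta> p by auto
  have sums: "t sums ?F" "(\<lambda>n. real (Suc n) * t n) sums ?N" "(\<lambda>n. run_cost a (Suc n) * t n) sums ?C"
    unfolding t_def run_sum_def length_moment_def cost_moment_def
    using run_sum_summable[OF a \<beta>(1) p(1)] moments_summable[OF a \<beta>(1) p(1)] by (auto intro: summable_sums)
  have lower: "(\<lambda>n. exp m * ((1 - m) * t n + (- (p' - p)) * (real (Suc n) * t n) + (- (\<beta>' - \<beta>)) * (run_cost a (Suc n) * t n)))
      sums (exp m * ((1 - m) * ?F + (- (p' - p)) * ?N + (- (\<beta>' - \<beta>)) * ?C))"
    by (intro sums_mult sums_add sums)
  have "exp m * ((1 - m) * ?F + (- (p' - p)) * ?N + (- (\<beta>' - \<beta>)) * ?C) \<le> run_sum a \<beta>' p'"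
  proof (rule sums_le[OF _ lower])
    show "(\<lambda>n. exp (- real (Suc n) * p' - \<beta>' * run_cost a (Suc n))) sums run_sum a \<beta>' p'"
      unfolding run_sum_def by (rule summable_sums[OF run_sum_summable[OF a \<beta>(2) p(2)]])
    fix n
    define x where "x = - (p' - p) * real (Suc n) - (\<beta>' - \<beta>) * run_cost a (Suc n)"
    have "exp (- real (Suc n) * p' - \<beta>' * run_cost a (Suc n)) = t n * (exp m * exp (x - m))"
      unfolding t_def x_def exp_add[symmetric] by (rule arg_cong[where f = exp]) (simp add: algebra_simps)
    moreover have "t n * (exp m * (1 + (x - m))) \<le> t n * (exp m * exp (x - m))"
      using exp_ge_add_one_self[of "x - m"] by (intro mult_left_mono) (simp_all add: t_def)
    moreover have "exp m * ((1 - m) * t n + (- (p' - p)) * (real (Suc n) * t n) + (- (\<beta>' - \<beta>)) * (run_cost a (Suc n) * t n))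
        = t n * (exp m * (1 + (x - m)))"
      unfolding x_def by (simp add: algebra_simps)
    ultimately show "exp m * ((1 - m) * t n + (- (p' - p)) * (real (Suc n) * t n) + (- (\<beta>' - \<beta>)) * (run_cost a (Suc n) * t n))
        \<le> exp (- real (Suc n) * p' - \<beta>' * run_cost a (Suc n))" by (simp only:)
  qed
  moreover have "(1 - m) * ?F + (- (p' - p)) * ?N + (- (\<beta>' - \<beta>)) * ?C = ?F"
  proof -
    have "m * ?F = - (p' - p) * ?N - (\<beta>' - \<beta>) * ?C" using F by (simp add: m_def)
    then show ?thesis by (simp add: left_diff_distrib)
  qed
  ultimately have "exp m * ?F \<le> run_sum a \<beta>' p'" by simp
  then have "ln (exp m * ?F) \<le> ln (run_sum a \<beta>' p')" using F by (intro ln_mono) auto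
  then have "m \<le> ln (run_sum a \<beta>' p') - ln ?F" using F by (simp add: ln_mult)
  moreover have "m = - (p' - p) * (?N / ?F) - (\<beta>' - \<beta>) * (?C / ?F)"
    by (simp add: m_def diff_divide_distrib)
  ultimately show ?thesis by simp
qed

text \<open>
  The terms \<open>exp (- \<beta> c)\<close> at \<open>p = 0\<close> are at least \<open>exp (-
  c)\<close>, the terms of a series with sum 1, and the first one is strictly larger. So a finite
  partial sum exceeds 1 already, and it depends continuously on \<open>p\<close>; the full series
  may diverge at \<open>p = 0\<close>.
\<close>

lemma run_sum_gt_1_near_0:
  assumes a: "a > 1" and \<beta>: "0 \<le> \<beta>" "\<beta> < 1"
  shows "\<forall>\<^sub>F p in at_right 0. run_sum a \<beta> p > 1"
proof -
  define d where "d = exp (- \<beta> * run_cost a 1) - exp (- run_cost a 1)"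
  have c1: "run_cost a 1 > 0" using zeta_gt_1[OF a] by (simp add: run_cost_def)
  have "\<beta> * run_cost a 1 < 1 * run_cost a 1" by (rule mult_strict_right_mono[OF \<beta>(2) c1])
  then have d: "d > 0" by (simp add: d_def)
  have "(\<lambda>m. \<Sum>n<m. exp (- run_cost a (Suc n))) \<longlonglongrightarrow> 1"
    using run_cost_sums_1[OF a] by (simp add: sums_def)
  then have "\<forall>\<^sub>F m in sequentially. 1 - d < (\<Sum>n<m. exp (- run_cost a (Suc n)))"
    using d by (intro order_tendstoD(1)) auto
  then obtain m where m: "m \<ge> 1" "1 - d < (\<Sum>n<m. exp (- run_cost a (Suc n)))"
    by (metis eventually_sequentially nle_le)
  have term_mono: "exp (- run_cost a (Suc n)) \<le> exp (- \<beta> * run_cost a (Suc n))" for n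
    using mult_right_mono[OF less_imp_le[OF \<beta>(2)] run_cost_nonneg[OF a, of "Suc n"]] by simp
  have "1 < (\<Sum>n<m. exp (- \<beta> * run_cost a (Suc n)))"
  proof -
    have split: "sum f {..<m} = f 0 + sum f {1..<m}" for f :: "nat \<Rightarrow> real"
      using m(1) sum.atLeast_Suc_lessThan[of 0 m f] by (simp add: atLeast0LessThan)
    have "(\<Sum>n\<in>{1..<m}. exp (- run_cost a (Suc n))) \<le> (\<Sum>n\<in>{1..<m}. exp (- \<beta> * run_cost a (Suc n)))"
      by (intro sum_mono term_mono)
    then show ?thesis using m(2) unfolding split[of "\<lambda>n. exp (- run_cost a (Suc n))"]
        split[of "\<lambda>n. exp (- \<beta> * run_cost a (Suc n))"] by (simp add: d_def)
  qed
  moreover have "((\<lambda>p. \<Sum>n<m. exp (- real (Suc n) * p - \<beta> * run_cost a (Suc n))) \<longlongrightarrow>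
      (\<Sum>n<m. exp (- real (Suc n) * 0 - \<beta> * run_cost a (Suc n)))) (at_right 0)"
    by (intro tendsto_intros)
  ultimately have "\<forall>\<^sub>F p in at_right 0. 1 < (\<Sum>n<m. exp (- real (Suc n) * p - \<beta> * run_cost a (Suc n)))"
    by (intro order_tendstoD(1)) auto
  moreover have "\<forall>\<^sub>F p in at_right 0. (p::real) > 0" by (rule eventually_at_right_less)
  ultimately show ?thesis
  proof eventually_elim
    case (elim p)
    have "(\<Sum>n<m. exp (- real (Suc n) * p - \<beta> * run_cost a (Suc n))) \<le> run_sum a \<beta> p"
      unfolding run_sum_def by (rule sum_le_suminf[OF run_sum_summable[OF a \<beta>(1) elim(2)]]) simp_all
    with elim(1) show ?case by linarith
  qed
qed

lemma run_sum_ln2_le_1: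
  assumes "a > 1" "\<beta> \<ge> 0" shows "run_sum a \<beta> (ln 2) \<le> 1"
proof -
  have p: "ln 2 > (0::real)" by simp
  have "run_sum a \<beta> (ln 2) \<le> (\<Sum>n. exp (- real (Suc n) * ln 2))"
    unfolding run_sum_def
    by (rule suminf_le[OF run_term_le[OF assms] run_sum_summable[OF assms p] geometric_summable(1)[OF p]])
  then show ?thesis using geometric_summable(2)[OF p] by simp
qed

text \<open>
  Intermediate value theorem. The upper end is \<open>ln 2\<close> because there the dominating
  geometric series has the sum 1.
\<close>

lemma pressure_equation_solvable:
  assumes \<gamma>\<delta>: "\<gamma> > 1" "\<delta> > 1" and \<beta>: "0 \<le> \<beta>" "\<beta> < 1"
  obtains p where "0 < p" "p \<le> ln 2" "run_sum \<gamma> \<beta> p * run_sum \<delta> \<beta> p = 1"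
proof -
  have "\<forall>\<^sub>F p in at_right 0. run_sum \<gamma> \<beta> p > 1 \<and> run_sum \<delta> \<beta> p > 1 \<and> p < ln 2"
    by (intro eventually_conj run_sum_gt_1_near_0 \<gamma>\<delta> \<beta> eventually_at_right_real[THEN eventually_mono]) auto
  moreover have "\<forall>\<^sub>F p in at_right 0. (p::real) > 0" by (rule eventually_at_right_less)
  ultimately have "\<forall>\<^sub>F p in at_right 0. run_sum \<gamma> \<beta> p > 1 \<and> run_sum \<delta> \<beta> p > 1 \<and> p < ln 2 \<and> (p::real) > 0"
    by eventually_elim simp
  then obtain q where q: "run_sum \<gamma> \<beta> q > 1" "run_sum \<delta> \<beta> q > 1" "q < ln 2" "q > 0"
    using eventually_happens'[of "at_right (0::real)"] by (auto simp: trivial_limit_at_right_real)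
  have cont: "continuous_on {q..ln 2} (\<lambda>p. run_sum a \<beta> p)" if "a > 1" for a
    by (rule moments_continuous(1)[OF that, of _ "\<lambda>_. \<beta>" "\<lambda>p. p" q])
      (use \<beta> q in \<open>auto intro: continuous_intros\<close>)
  have "\<exists>p. q \<le> p \<and> p \<le> ln 2 \<and> run_sum \<gamma> \<beta> p * run_sum \<delta> \<beta> p = 1"
  proof (rule IVT2')
    have pos: "0 < run_sum a \<beta> (ln 2)" if "a > 1" for a by (rule run_sum_pos[OF that \<beta>(1)]) simp
    show "run_sum \<gamma> \<beta> (ln 2) * run_sum \<delta> \<beta> (ln 2) \<le> 1"
      by (intro mult_le_one run_sum_ln2_le_1 \<gamma>\<delta> \<beta> less_imp_le[OF pos])
    have "1 * 1 \<le> run_sum \<gamma> \<beta> q * run_sum \<delta> \<beta> q" using q by (intro mult_mono) auto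
    then show "1 \<le> run_sum \<gamma> \<beta> q * run_sum \<delta> \<beta> q" by simp
    show "q \<le> ln 2" using q by simp
    show "continuous_on {q..ln 2} (\<lambda>p. run_sum \<gamma> \<beta> p * run_sum \<delta> \<beta> p)"
      by (intro continuous_on_mult cont \<gamma>\<delta>)
  qed
  then show thesis using that q by (metis order_less_le_trans)
qed

text \<open>
  The difference quotient lies between \<open>d x\<close> and \<open>d y\<close>.
\<close>

lemma derivative_of_subgradients:
  fixes f d :: "real \<Rightarrow> real"
  assumes A: "open A" "x \<in> A"
    and sub: "\<And>y z. y \<in> A \<Longrightarrow> z \<in> A \<Longrightarrow> f z - f y \<ge> d y * (z - y)"
    and d: "continuous_on A d"
  shows "(f has_real_derivative d x) (at x)"
proof -
  have dx: "(d \<longlongrightarrow> d x) (at x)"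
    using d A continuous_on_eq_continuous_at[OF A(1)] isCont_def by blast
  have near: "\<forall>\<^sub>F y in at x. y \<in> A \<and> y \<noteq> x"
    using A by (simp add: eventually_at_topological) blast
  have "((\<lambda>y. (f y - f x) / (y - x)) \<longlongrightarrow> d x) (at x)"
  proof (rule LIM_zero_cancel, rule Lim_null_comparison)
    show "\<forall>\<^sub>F y in at x. norm ((f y - f x) / (y - x) - d x) \<le> \<bar>d y - d x\<bar>"
      using near
    proof eventually_elim
      case (elim y)
      have 1: "f y - f x - d x * (y - x) \<ge> 0" using sub[of x y] A elim by simp
      have 2: "f y - f x - d x * (y - x) \<le> (d y - d x) * (y - x)"
        using sub[of y x] A elim by (simp add: algebra_simps)
      have "\<bar>(f y - f x) - d x * (y - x)\<bar> \<le> \<bar>d y - d x\<bar> * \<bar>y - x\<bar>"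
        using 1 2 by (simp add: abs_mult[symmetric])
      then have "\<bar>(f y - f x) - d x * (y - x)\<bar> / \<bar>y - x\<bar> \<le> \<bar>d y - d x\<bar>"
        using elim by (simp add: divide_le_eq)
      moreover have "(f y - f x) / (y - x) - d x = ((f y - f x) - d x * (y - x)) / (y - x)"
        using elim by (simp add: field_simps)
      ultimately show ?case by (simp add: abs_divide)
    qed
    show "((\<lambda>y. \<bar>d y - d x\<bar>) \<longlongrightarrow> 0) (at x)"
      by (rule tendsto_rabs_zero[OF LIM_zero[OF dx]])
  qed
  then show ?thesis by (simp add: has_field_derivative_iff)
qed

lemma run_cost_power_summable:
  assumes "a > 1" "a * b > 1" shows "summable (\<lambda>n. exp (- b * run_cost a (Suc n)))"
proof -
  have "exp (- b * run_cost a (Suc n)) = exp (- b * ln (zeta a)) * (1 / real (Suc n) powr (a * b))" for n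
  proof -
    have "1 / real (Suc n) powr (a * b) = exp (- (a * b * ln (real (Suc n))))"
      by (simp add: powr_def exp_minus field_simps)
    then show ?thesis
      by (simp only: exp_add[symmetric]) (simp add: run_cost_def algebra_simps)
  qed
  then show ?thesis using summable_mult[OF zeta_summable[OF assms(2)]] by simp
qed

text \<open>
  The factor \<open>c\<close> is absorbed by lowering the exponent from \<open>b\<close> to some
  \<open>b - \<eta>\<close> with \<open>a * (b - \<eta>) > 1\<close>.
\<close>

lemma run_cost_times_power_summable:
  assumes a: "a > 1" "a * b > 1"
  shows "summable (\<lambda>n. run_cost a (Suc n) * exp (- b * run_cost a (Suc n)))"
proof -
  \<comment> \<open>Half of the largest admissible value: \<open>a * (b - \<eta>) = (a * b + 1) / 2\<close>.\<close>
  define \<eta> where "\<eta> = (a * b - 1) / (2 * a)"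
  have \<eta>: "\<eta> > 0" "a * (b - \<eta>) > 1"
    using a by (simp_all add: \<eta>_def field_simps)
  show ?thesis
  proof (rule summable_comparison_test'[OF summable_mult[OF run_cost_power_summable[OF a(1) \<eta>(2)], of "1 / \<eta>"], of 0])
    fix n
    let ?c = "run_cost a (Suc n)"
    have "\<eta> * ?c \<le> exp (\<eta> * ?c)" using exp_ge_add_one_self[of "\<eta> * ?c"] by linarith
    then have "?c \<le> 1 / \<eta> * exp (\<eta> * ?c)" using \<eta> by (simp add: field_simps)
    then have "?c * exp (- b * ?c) \<le> 1 / \<eta> * exp (\<eta> * ?c) * exp (- b * ?c)"
      by (rule mult_right_mono) simp
    also have "\<dots> = 1 / \<eta> * exp (- (b - \<eta>) * ?c)"
      unfolding mult.assoc exp_add[symmetric] by (simp add: algebra_simps)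
    finally show "norm (?c * exp (- b * ?c)) \<le> 1 / \<eta> * exp (- (b - \<eta>) * ?c)"
      using run_cost_nonneg[OF a(1), of "Suc n"] by simp
  qed
qed

text \<open>
  At \<open>\<beta> = 1\<close> and \<open>p = 0\<close> the terms are \<open>n powr (1 - a) /
  zeta a\<close>, which are not summable for \<open>a < 2\<close>. A finite partial sum that
  exceeds a given bound continues to do so near that point.
\<close>

lemma length_moment_diverges:
  assumes a: "1 < a" "a < 2" and p: "(p \<longlongrightarrow> 0) (at_left 1)" and p_pos: "\<And>\<beta>. 0 \<le> \<beta> \<Longrightarrow> \<beta> < 1 \<Longrightarrow> 0 < p \<beta>"
  shows "filterlim (\<lambda>\<beta>. length_moment a \<beta> (p \<beta>)) at_top (at_left 1)"
  unfolding filterlim_at_top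
proof
  fix Z :: real
  let ?u = "\<lambda>n. real (Suc n) * exp (- run_cost a (Suc n))"
  have "\<not> summable ?u"
  proof
    assume "summable ?u"
    then have "summable (\<lambda>n. ?u n * zeta a)" by (rule summable_mult2)
    moreover have "?u n * zeta a = real (Suc n) powr (1 - a)" for n
      using zeta_gt_1[OF a(1)] exp_run_cost[of "Suc n" a] a(1)
      by (simp add: powr_diff powr_minus field_simps)
    ultimately have "summable (\<lambda>n. real (Suc n) powr (1 - a))" by simp
    then have "summable (\<lambda>n. real n powr (1 - a))" by (subst (asm) summable_Suc_iff)
    then show False using a by (simp add: summable_real_powr_iff)
  qed
  have "\<exists>m. sum ?u {..<m} > Z"
  proof (rule ccontr)
    assume "\<nexists>m. sum ?u {..<m} > Z"
    then have "summable ?u" by (intro bounded_imp_summable[of _ Z]) (auto simp: not_less lessThan_Suc_atMost[symmetric] simp del: sum.lessThan_Suc)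
    with \<open>\<not> summable ?u\<close> show False by contradiction
  qed
  then obtain m where m: "sum ?u {..<m} > Z" by blast
  have "((\<lambda>\<beta>. \<Sum>n<m. real (Suc n) * exp (- real (Suc n) * p \<beta> - \<beta> * run_cost a (Suc n))) \<longlongrightarrow>
      (\<Sum>n<m. real (Suc n) * exp (- real (Suc n) * 0 - 1 * run_cost a (Suc n)))) (at_left 1)"
    by (intro tendsto_intros p)
  then have "\<forall>\<^sub>F \<beta> in at_left 1. Z < (\<Sum>n<m. real (Suc n) * exp (- real (Suc n) * p \<beta> - \<beta> * run_cost a (Suc n)))"
    using m by (intro order_tendstoD(1)) auto
  moreover have "\<forall>\<^sub>F \<beta> in at_left 1. \<beta> \<in> {0<..<(1::real)}" by (rule eventually_at_left_real) simp
  ultimately show "\<forall>\<^sub>F \<beta> in at_left 1. Z \<le> length_moment a \<beta> (p \<beta>)"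
  proof eventually_elim
    case (elim \<beta>)
    have "(\<Sum>n<m. real (Suc n) * exp (- real (Suc n) * p \<beta> - \<beta> * run_cost a (Suc n))) \<le> length_moment a \<beta> (p \<beta>)"
      unfolding length_moment_def
      by (rule sum_le_suminf[OF moments_summable(1)[OF a(1)]]) (use elim p_pos[of \<beta>] in simp_all)
    with elim(1) show ?case by linarith
  qed
qed

text \<open>
  The upper bounds are the series at \<open>b\<close> and \<open>p = 0\<close>, which converge for
  \<open>b\<close> close enough to 1. The lower bound is the first term, with the extreme values
  \<open>p = ln 2\<close> and \<open>\<beta> = 1\<close>.
\<close>

lemma moment_bounds:
  assumes a: "a > 1" "a * b > 1" and \<beta>: "0 \<le> b" "b \<le> \<beta>" "\<beta> \<le> 1" and p: "0 < p" "p \<le> ln 2"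
  shows "run_sum a \<beta> p \<le> (\<Sum>n. exp (- b * run_cost a (Suc n)))"
    and "cost_moment a \<beta> p \<le> (\<Sum>n. run_cost a (Suc n) * exp (- b * run_cost a (Suc n)))"
    and "exp (- run_cost a 1) / 2 \<le> run_sum a \<beta> p"
proof -
  have \<beta>0: "\<beta> \<ge> 0" using \<beta> by simp
  have le: "exp (- real (Suc n) * p - \<beta> * run_cost a (Suc n)) \<le> exp (- b * run_cost a (Suc n))" for n
  proof -
    have "b * run_cost a (Suc n) \<le> \<beta> * run_cost a (Suc n)"
      by (rule mult_right_mono[OF \<beta>(2) run_cost_nonneg[OF a(1)]]) simp
    moreover have "- real (Suc n) * p \<le> 0" using p by (intro mult_nonpos_nonneg) auto
    ultimately show ?thesis unfolding exp_le_cancel_iff by linarith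
  qed
  show "run_sum a \<beta> p \<le> (\<Sum>n. exp (- b * run_cost a (Suc n)))"
    unfolding run_sum_def
    by (rule suminf_le[OF le run_sum_summable[OF a(1) \<beta>0 p(1)] run_cost_power_summable[OF a]])
  show "cost_moment a \<beta> p \<le> (\<Sum>n. run_cost a (Suc n) * exp (- b * run_cost a (Suc n)))"
    unfolding cost_moment_def
    by (rule suminf_le[OF mult_left_mono[OF le run_cost_nonneg[OF a(1)]] moments_summable(2)[OF a(1) \<beta>0 p(1)]
          run_cost_times_power_summable[OF a]]) simp
  have c: "run_cost a 1 \<ge> 0" by (rule run_cost_nonneg[OF a(1)]) simp
  have "exp (- run_cost a 1) / 2 = exp (- ln 2 - run_cost a 1)" by (simp add: exp_diff exp_minus field_simps)
  also have "\<dots> \<le> exp (- p - \<beta> * run_cost a 1)"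
    using p mult_right_mono[OF \<beta>(3) c] unfolding exp_le_cancel_iff by linarith
  also have "\<dots> \<le> run_sum a \<beta> p"
    using sum_le_suminf[OF run_sum_summable[OF a(1) \<beta>0 p(1)], of "{..<1}"] by (simp add: run_sum_def)
  finally show "exp (- run_cost a 1) / 2 \<le> run_sum a \<beta> p" .
qed

section \<open>The phase transition\<close>

text \<open>
  A power series with a non-zero coefficient of positive degree that vanishes at its centre has no
  other zero nearby.
\<close>

lemma one_sided_zero_of_analytic:
  assumes analytic: "real_analytic_at f c" and zero: "\<And>x. x \<ge> c \<Longrightarrow> f x = 0"
  shows "\<exists>r>0. \<forall>x. \<bar>x - c\<bar> < r \<longrightarrow> f x = 0"
proof -
  obtain a r where r: "r > 0"
    and series: "\<And>x. \<bar>x - c\<bar> < r \<Longrightarrow> (\<lambda>n. a n * (x - c) ^ n) sums f x"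
    using analytic unfolding real_analytic_at_def by blast
  have a: "a m = 0" if m: "m > 0" for m
  proof (rule ccontr)
    assume "a m \<noteq> 0"
    have "\<exists>s>0. \<forall>z \<in> cball c s - {c}. f z \<noteq> 0"
      by (rule powser_0_nonzero[of r c a f m])
        (use r series zero[of c] m \<open>a m \<noteq> 0\<close> in auto)
    then obtain s where s: "0 < s" "\<And>z. z \<in> cball c s - {c} \<Longrightarrow> f z \<noteq> 0"
      by blast
    have "c + s \<in> cball c s - {c}" using s(1) by (simp add: dist_real_def)
    then show False using s(2) zero[of "c + s"] s(1) by simp
  qed
  have "f x = f c" if "\<bar>x - c\<bar> < r" for x
  proof -
    have const: "(\<lambda>n. a n * (y - c) ^ n) sums a 0" for y
      using sums_finite[of "{0}" "\<lambda>n. a n * (y - c) ^ n"] a by simp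
    show ?thesis
      using sums_unique2[OF series[OF that] const] sums_unique2[OF series[of c] const] r by simp
  qed
  then show ?thesis using r zero[of c] by auto
qed

lemma real_of_ereal_bounds:
  assumes "ereal a \<le> x" "x \<le> ereal b"
  shows "a \<le> real_of_ereal x" "real_of_ereal x \<le> b" "x = ereal (real_of_ereal x)"
  using assms by (cases x; simp)+

lemma tendsto_0_at_left_1:
  fixes f :: "real \<Rightarrow> real"
  assumes "\<And>\<beta>. 0 < \<beta> \<Longrightarrow> \<beta> < 1 \<Longrightarrow> 0 \<le> f \<beta> \<and> f \<beta> \<le> \<bar>\<beta> - 1\<bar> * K"
  shows "(f \<longlongrightarrow> 0) (at_left 1)"
proof (rule tendsto_sandwich)
  have near: "\<forall>\<^sub>F \<beta> in at_left 1. \<beta> \<in> {0<..<(1::real)}" by (rule eventually_at_left_real) simp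
  show "\<forall>\<^sub>F \<beta> in at_left 1. 0 \<le> f \<beta>" using near by eventually_elim (use assms in simp)
  show "\<forall>\<^sub>F \<beta> in at_left 1. f \<beta> \<le> \<bar>\<beta> - 1\<bar> * K" using near by eventually_elim (use assms in simp)
  have "((\<lambda>\<beta>. \<bar>\<beta> - 1\<bar> * K) \<longlongrightarrow> \<bar>1 - 1\<bar> * K) (at_left (1::real))"
    by (intro tendsto_intros)
  then show "((\<lambda>\<beta>. \<bar>\<beta> - 1\<bar> * K) \<longlongrightarrow> 0) (at_left (1::real))" by simp
qed simp

lemma hofbauer_pressure_tendsto_0:
  assumes a: "a > 1"
  shows "((\<lambda>\<beta>. P (\<lambda>x. \<beta> * hofbauer a x)) \<longlongrightarrow> 0) (at_left 1)"
proof -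
  interpret F: regular_potential "hofbauer a" "run_variation a" by (rule hofbauer_regular[OF a])
  let ?K = "\<bar>hofbauer a (\<lambda>_. False)\<bar> + run_variation a 0"
  have "run_length False (\<lambda>_. False) = None" by (simp add: run_length_None)
  then have fix0: "hofbauer a (\<lambda>_. False) = 0" by (simp add: hofbauer_eq)
  have top: "topological_pressure (hofbauer a) \<le> 0"
    by (rule ereal_le_epsilon2) (use hofbauer_pressure_le[OF a] in simp)
  show ?thesis
  proof (rule tendsto_0_at_left_1)
    fix \<beta> :: real assume "0 < \<beta>" "\<beta> < 1"
    interpret B: regular_potential "\<lambda>x. \<beta> * hofbauer a x" "\<lambda>k. \<bar>\<beta>\<bar> * run_variation a k"
      by (rule F.scale)
    have "ereal 0 \<le> topological_pressure (\<lambda>x. \<beta> * hofbauer a x)"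
      using B.topological_pressure_ge_fixed_point[of "\<lambda>_. False"] fix0 by (simp add: shift_def)
    moreover have "topological_pressure (\<lambda>x. \<beta> * hofbauer a x) \<le> ereal (\<bar>\<beta> - 1\<bar> * ?K)"
    proof -
      have "topological_pressure (\<lambda>x. \<beta> * hofbauer a x)
          \<le> topological_pressure (\<lambda>x. 1 * hofbauer a x) + ereal (\<bar>\<beta> - 1\<bar> * ?K)"
        by (rule topological_pressure_scale_lipschitz[OF F.measurable F.bounded])
      also have "\<dots> \<le> 0 + ereal (\<bar>\<beta> - 1\<bar> * ?K)"
        using top by (intro add_right_mono) simp
      finally show ?thesis by simp
    qed
    ultimately show "0 \<le> P (\<lambda>x. \<beta> * hofbauer a x) \<and> P (\<lambda>x. \<beta> * hofbauer a x) \<le> \<bar>\<beta> - 1\<bar> * ?K"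
      unfolding P_def using real_of_ereal_bounds by blast
  qed
qed

definition double_pressure :: "real \<Rightarrow> real \<Rightarrow> real \<Rightarrow> real" where
  "double_pressure \<gamma> \<delta> \<beta> = P (\<lambda>x. \<beta> * double_hofbauer \<gamma> \<delta> x)"

context
  fixes \<gamma> \<delta> :: real
  assumes \<gamma>\<delta>: "\<gamma> > 1" "\<delta> > 1"
begin

private abbreviation "p \<equiv> double_pressure \<gamma> \<delta>"

lemma pressure_root:
  assumes \<beta>: "0 \<le> \<beta>" "\<beta> < 1"
  shows "0 < p \<beta>" "p \<beta> \<le> ln 2" "run_sum \<gamma> \<beta> (p \<beta>) * run_sum \<delta> \<beta> (p \<beta>) = 1"
    "topological_pressure (\<lambda>x. \<beta> * double_hofbauer \<gamma> \<delta> x) = ereal (p \<beta>)"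
proof -
  obtain q where q: "0 < q" "q \<le> ln 2" "run_sum \<gamma> \<beta> q * run_sum \<delta> \<beta> q = 1"
    by (rule pressure_equation_solvable[OF \<gamma>\<delta> \<beta>])
  have "topological_pressure (\<lambda>x. \<beta> * double_hofbauer \<gamma> \<delta> x) = ereal q"
    using double_hofbauer_pressure_le[OF \<gamma>\<delta> \<beta>(1) q(1)] double_hofbauer_pressure_ge[OF \<gamma>\<delta> \<beta>(1) q(1) q(3)] q(3)
    by (intro antisym) simp_all
  then show "0 < p \<beta>" "p \<beta> \<le> ln 2" "run_sum \<gamma> \<beta> (p \<beta>) * run_sum \<delta> \<beta> (p \<beta>) = 1"
    "topological_pressure (\<lambda>x. \<beta> * double_hofbauer \<gamma> \<delta> x) = ereal (p \<beta>)"
    using q by (simp_all add: double_pressure_def P_def)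
qed

lemma pressure_zero:
  assumes \<beta>: "1 \<le> \<beta>"
  shows "p \<beta> = 0" "topological_pressure (\<lambda>x. \<beta> * double_hofbauer \<gamma> \<delta> x) = ereal 0"
proof -
  interpret G: regular_potential "double_hofbauer \<gamma> \<delta>" "\<lambda>k. run_variation \<gamma> k + run_variation \<delta> k"
    by (rule double_hofbauer_regular[OF \<gamma>\<delta>])
  interpret F: regular_potential "\<lambda>x. \<beta> * double_hofbauer \<gamma> \<delta> x" "\<lambda>k. \<bar>\<beta>\<bar> * (run_variation \<gamma> k + run_variation \<delta> k)"
    by (rule G.scale)
  have \<beta>0: "0 \<le> \<beta>" using \<beta> by simp
  have "topological_pressure (\<lambda>x. \<beta> * double_hofbauer \<gamma> \<delta> x) \<le> ereal 0"
  proof (rule ereal_le_epsilon2)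
    fix q :: real assume q: "0 < q"
    have "run_sum \<gamma> \<beta> q * run_sum \<delta> \<beta> q \<le> 1"
      by (intro mult_le_one run_sum_le_1 less_imp_le[OF run_sum_pos] \<gamma>\<delta> \<beta> \<beta>0 q)
    from double_hofbauer_pressure_le[OF \<gamma>\<delta> \<beta>0 q this]
    show "topological_pressure (\<lambda>x. \<beta> * double_hofbauer \<gamma> \<delta> x) \<le> ereal 0 + ereal q" by simp
  qed
  moreover have "ereal 0 \<le> topological_pressure (\<lambda>x. \<beta> * double_hofbauer \<gamma> \<delta> x)"
    using F.topological_pressure_ge_fixed_point[of "\<lambda>_. False"] by (simp add: shift_def double_hofbauer_fixed)
  ultimately show "topological_pressure (\<lambda>x. \<beta> * double_hofbauer \<gamma> \<delta> x) = ereal 0" by (rule antisym)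
  then show "p \<beta> = 0" by (simp add: double_pressure_def P_def)
qed

lemma pressure_lipschitz:
  obtains K where "\<And>\<beta> \<beta>'. 0 \<le> \<beta> \<Longrightarrow> 0 \<le> \<beta>' \<Longrightarrow> \<bar>p \<beta> - p \<beta>'\<bar> \<le> \<bar>\<beta> - \<beta>'\<bar> * K"
proof -
  interpret G: regular_potential "double_hofbauer \<gamma> \<delta>" "\<lambda>k. run_variation \<gamma> k + run_variation \<delta> k"
    by (rule double_hofbauer_regular[OF \<gamma>\<delta>])
  let ?K = "\<bar>double_hofbauer \<gamma> \<delta> (\<lambda>_. False)\<bar> + (run_variation \<gamma> 0 + run_variation \<delta> 0)"
  have tp: "topological_pressure (\<lambda>x. \<beta> * double_hofbauer \<gamma> \<delta> x) = ereal (p \<beta>)" if "0 \<le> \<beta>" for \<beta>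
    using pressure_root(4)[of \<beta>] pressure_zero[of \<beta>] that by (cases "\<beta> < 1") auto
  have "p \<beta> \<le> p \<beta>' + \<bar>\<beta> - \<beta>'\<bar> * ?K" if "0 \<le> \<beta>" "0 \<le> \<beta>'" for \<beta> \<beta>'
    using topological_pressure_scale_lipschitz[OF G.measurable G.bounded, of \<beta> \<beta>'] that by (simp add: tp)
  then have "\<bar>p \<beta> - p \<beta>'\<bar> \<le> \<bar>\<beta> - \<beta>'\<bar> * ?K" if "0 \<le> \<beta>" "0 \<le> \<beta>'" for \<beta> \<beta>'
    using that by (smt (verit, best) abs_minus_commute)
  then show thesis by (rule that)
qed

lemma pressure_tendsto_0: "(p \<longlongrightarrow> 0) (at_left 1)"
proof -
  obtain K where K: "\<And>\<beta> \<beta>'. 0 \<le> \<beta> \<Longrightarrow> 0 \<le> \<beta>' \<Longrightarrow> \<bar>p \<beta> - p \<beta>'\<bar> \<le> \<bar>\<beta> - \<beta>'\<bar> * K"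
    using pressure_lipschitz by blast
  show ?thesis
  proof (rule tendsto_0_at_left_1)
    fix \<beta> :: real assume "0 < \<beta>" "\<beta> < 1"
    then show "0 \<le> p \<beta> \<and> p \<beta> \<le> \<bar>\<beta> - 1\<bar> * K"
      using K[of \<beta> 1] pressure_root(1)[of \<beta>] pressure_zero(1)[of 1] by auto
  qed
qed

lemma pressure_continuous: "continuous_on {0<..<1} p"
proof -
  obtain K where K: "\<And>\<beta> \<beta>'. 0 \<le> \<beta> \<Longrightarrow> 0 \<le> \<beta>' \<Longrightarrow> \<bar>p \<beta> - p \<beta>'\<bar> \<le> \<bar>\<beta> - \<beta>'\<bar> * K"
    using pressure_lipschitz by blast
  have "(p \<longlongrightarrow> p x) (at x within {0<..<1})" if x: "x \<in> {0<..<1}" for x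
  proof (rule LIM_zero_cancel, rule Lim_null_comparison)
    show "\<forall>\<^sub>F y in at x within {0<..<1}. norm (p y - p x) \<le> \<bar>y - x\<bar> * K"
      unfolding eventually_at_filter using K x by (intro always_eventually) auto
    have "((\<lambda>y. \<bar>y - x\<bar> * K) \<longlongrightarrow> \<bar>x - x\<bar> * K) (at x within {0<..<1})"
      by (intro tendsto_intros)
    then show "((\<lambda>y. \<bar>y - x\<bar> * K) \<longlongrightarrow> 0) (at x within {0<..<1})" by simp
  qed
  then show ?thesis by (simp add: continuous_on_def)
qed

definition mean_cycle_length :: "real \<Rightarrow> real" where
  "mean_cycle_length \<beta> = length_moment \<gamma> \<beta> (p \<beta>) / run_sum \<gamma> \<beta> (p \<beta>) + length_moment \<delta> \<beta> (p \<beta>) / run_sum \<delta> \<beta> (p \<beta>)"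

definition mean_cycle_cost :: "real \<Rightarrow> real" where
  "mean_cycle_cost \<beta> = cost_moment \<gamma> \<beta> (p \<beta>) / run_sum \<gamma> \<beta> (p \<beta>) + cost_moment \<delta> \<beta> (p \<beta>) / run_sum \<delta> \<beta> (p \<beta>)"

lemma mean_cycle_length_pos:
  assumes "0 \<le> \<beta>" "\<beta> < 1" shows "mean_cycle_length \<beta> > 0"
  unfolding mean_cycle_length_def
  using \<gamma>\<delta> assms pressure_root(1)[OF assms] by (intro add_pos_pos divide_pos_pos length_moment_pos run_sum_pos)

text \<open>
  The sum of the two logarithms of run sums vanishes at both points of the graph, so the sum of
  their tangent planes at one point is at most 0 at the other one.
\<close>

lemma pressure_subgradient:
  assumes "0 \<le> \<beta>" "\<beta> < 1" "0 \<le> \<beta>'" "\<beta>' < 1"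
  shows "p \<beta>' - p \<beta> \<ge> - mean_cycle_cost \<beta> / mean_cycle_length \<beta> * (\<beta>' - \<beta>)"
proof -
  have log: "ln (run_sum \<gamma> b (p b)) + ln (run_sum \<delta> b (p b)) = 0" if "0 \<le> b" "b < 1" for b
  proof -
    have "ln (run_sum \<gamma> b (p b) * run_sum \<delta> b (p b)) = ln (run_sum \<gamma> b (p b)) + ln (run_sum \<delta> b (p b))"
      using run_sum_pos[OF \<gamma>\<delta>(1) that(1) pressure_root(1)[OF that]]
        run_sum_pos[OF \<gamma>\<delta>(2) that(1) pressure_root(1)[OF that]] by (intro ln_mult_pos)
    then show ?thesis using pressure_root(3)[OF that] by simp
  qed
  note tangent = ln_run_sum_tangent[OF _ assms(1,3) pressure_root(1)[OF assms(1,2)] pressure_root(1)[OF assms(3,4)]]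
  have "- (p \<beta>' - p \<beta>) * mean_cycle_length \<beta> - (\<beta>' - \<beta>) * mean_cycle_cost \<beta> \<le> 0"
    using tangent[OF \<gamma>\<delta>(1)] tangent[OF \<gamma>\<delta>(2)] log[OF assms(1,2)] log[OF assms(3,4)]
    unfolding mean_cycle_length_def mean_cycle_cost_def distrib_left by linarith
  then show ?thesis using mean_cycle_length_pos[OF assms(1,2)] by (simp add: field_simps)
qed

lemma pressure_derivative:
  assumes \<beta>: "0 < \<beta>" "\<beta> < 1"
  shows "(p has_real_derivative - mean_cycle_cost \<beta> / mean_cycle_length \<beta>) (at \<beta>)"
proof -
  define \<epsilon> where "\<epsilon> = p \<beta> / 2"
  have \<epsilon>: "0 < \<epsilon>" "\<epsilon> < p \<beta>" using pressure_root(1)[of \<beta>] \<beta> by (simp_all add: \<epsilon>_def)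
  \<comment> \<open>A neighbourhood in which the pressure stays away from 0, as the continuity of the moments requires.\<close>
  define A where "A = {0<..<1} \<inter> p -` {\<epsilon><..}"
  have A: "open A" "\<beta> \<in> A"
    using continuous_open_preimage[OF pressure_continuous, of "{\<epsilon><..}"] \<beta> \<epsilon> by (auto simp: A_def)
  have inA: "0 < x \<and> x < 1 \<and> \<epsilon> \<le> p x" if "x \<in> A" for x using that by (auto simp: A_def)
  have pc: "continuous_on A p" by (rule continuous_on_subset[OF pressure_continuous]) (auto simp: A_def)
  have cont: "continuous_on A (\<lambda>x. run_sum a x (p x))" "continuous_on A (\<lambda>x. length_moment a x (p x))"
      "continuous_on A (\<lambda>x. cost_moment a x (p x))" if "a > 1" for a
    by (rule moments_continuous[OF that, of A "\<lambda>x. x" p \<epsilon>]; use inA pc \<epsilon> in \<open>auto intro: continuous_on_id less_imp_le\<close>)+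
  have F: "run_sum a x (p x) \<noteq> 0" if "a > 1" "x \<in> A" for a x
    using run_sum_pos[OF that(1), of x "p x"] inA[OF that(2)] \<epsilon> by force
  have "continuous_on A (\<lambda>x. - mean_cycle_cost x / mean_cycle_length x)"
    unfolding mean_cycle_cost_def mean_cycle_length_def
  proof (intro continuous_on_divide continuous_on_minus continuous_on_add cont \<gamma>\<delta> ballI F)
    fix x assume "x \<in> A"
    then show "length_moment \<gamma> x (p x) / run_sum \<gamma> x (p x) + length_moment \<delta> x (p x) / run_sum \<delta> x (p x) \<noteq> 0"
      using mean_cycle_length_pos[of x] inA[of x] by (simp add: mean_cycle_length_def)
  qed
  then show ?thesis
  proof (rule derivative_of_subgradients[OF A, rotated])
    fix y z assume "y \<in> A" "z \<in> A"
    with inA[of y] inA[of z]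
    show "- mean_cycle_cost y / mean_cycle_length y * (z - y) \<le> p z - p y"
      by (intro pressure_subgradient) auto
  qed
qed

text \<open>
  The mean cost of a cycle is bounded near 1, whereas its mean length is at least the mean length
  of a run of ones, which tends to infinity.
\<close>

lemma derivative_tendsto_0:
  assumes \<delta>2: "\<delta> < 2"
  shows "((\<lambda>\<beta>. - mean_cycle_cost \<beta> / mean_cycle_length \<beta>) \<longlongrightarrow> 0) (at_left 1)"
proof -
  define m where "m = min \<gamma> \<delta>"
  have m: "1 < m" "m \<le> \<gamma>" "m \<le> \<delta>" using \<gamma>\<delta> by (simp_all add: m_def)
  \<comment> \<open>The aim is some \<open>b < 1\<close> with \<open>\<gamma> * b > 1\<close> and \<open>\<delta> * b > 1\<close>.\<close>
  define i where "i = 1 / m"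
  have i: "0 < i" "i < 1" "m * i = 1" using m(1) by (simp_all add: i_def)
  define b where "b = (1 + i) / 2"
  have b: "0 < b" "b < 1" using i by (simp_all add: b_def)
  have "m * b = (m + m * i) / 2" by (simp add: b_def algebra_simps)
  then have mb: "m * b > 1" using m(1) i(3) by simp
  have ab: "\<gamma> * b > 1" "\<delta> * b > 1"
    using mb mult_right_mono[OF m(2), of b] mult_right_mono[OF m(3), of b] b(1) by - (linarith+)
  define S where "S a = (\<Sum>n. exp (- b * run_cost a (Suc n)))" for a
  define C where "C a = (\<Sum>n. run_cost a (Suc n) * exp (- b * run_cost a (Suc n)))" for a
  define k where "k a = exp (- run_cost a 1) / 2" for a
  define Q where "Q = (C \<gamma> / k \<gamma> + C \<delta> / k \<delta>) * S \<delta>"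
  have div: "filterlim (\<lambda>\<beta>. length_moment \<delta> \<beta> (p \<beta>)) at_top (at_left 1)"
    by (rule length_moment_diverges[OF \<gamma>\<delta>(2) \<delta>2 pressure_tendsto_0 pressure_root(1)])
  show ?thesis
  proof (rule Lim_null_comparison)
    show "((\<lambda>\<beta>. Q / length_moment \<delta> \<beta> (p \<beta>)) \<longlongrightarrow> 0) (at_left 1)"
      by (rule real_tendsto_divide_at_top[OF tendsto_const div])
    have "\<forall>\<^sub>F \<beta> in at_left 1. \<beta> \<in> {b<..<1}" by (rule eventually_at_left_real) (fact b(2))
    then show "\<forall>\<^sub>F \<beta> in at_left 1. norm (- mean_cycle_cost \<beta> / mean_cycle_length \<beta>) \<le> Q / length_moment \<delta> \<beta> (p \<beta>)"
    proof eventually_elim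
      case (elim \<beta>)
      have \<beta>: "0 \<le> \<beta>" "\<beta> < 1" "b \<le> \<beta>" "\<beta> \<le> 1" using elim b by auto
      have p: "0 < p \<beta>" "p \<beta> \<le> ln 2" by (rule pressure_root[OF \<beta>(1,2)])+
      note mb = moment_bounds[OF _ _ less_imp_le[OF b(1)] \<beta>(3,4) p]
      have N: "length_moment \<delta> \<beta> (p \<beta>) > 0" "length_moment \<gamma> \<beta> (p \<beta>) > 0"
        by (rule length_moment_pos[OF _ \<beta>(1) p(1)], fact \<gamma>\<delta>)+
      have F: "run_sum a \<beta> (p \<beta>) > 0" if "a > 1" for a by (rule run_sum_pos[OF that \<beta>(1) p(1)])
      have kpos: "k a > 0" for a by (simp add: k_def)
      have C0: "cost_moment a \<beta> (p \<beta>) \<ge> 0" if "a > 1" for a by (rule cost_moment_nonneg[OF that \<beta>(1) p(1)])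
      have ratio: "cost_moment a \<beta> (p \<beta>) / run_sum a \<beta> (p \<beta>) \<le> C a / k a" if "a > 1" "a * b > 1" for a
        using mb(2,3)[OF that] C0[OF that(1)] F[OF that(1)] kpos[of a]
        by (intro frac_le) (auto simp: C_def k_def)
      have mc: "mean_cycle_cost \<beta> \<le> C \<gamma> / k \<gamma> + C \<delta> / k \<delta>" "0 \<le> mean_cycle_cost \<beta>"
        unfolding mean_cycle_cost_def using ratio \<gamma>\<delta> ab C0 F by (auto intro!: add_mono add_nonneg_nonneg divide_nonneg_pos)
      have "run_sum \<delta> \<beta> (p \<beta>) \<le> S \<delta>" unfolding S_def by (rule mb(1)[OF \<gamma>\<delta>(2) ab(2)])
      then have "length_moment \<delta> \<beta> (p \<beta>) / S \<delta> \<le> length_moment \<delta> \<beta> (p \<beta>) / run_sum \<delta> \<beta> (p \<beta>)"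
        using N F[OF \<gamma>\<delta>(2)] by (intro divide_left_mono) auto
      also have "\<dots> \<le> mean_cycle_length \<beta>"
        unfolding mean_cycle_length_def using N F[OF \<gamma>\<delta>(1)] by simp
      finally have ml: "length_moment \<delta> \<beta> (p \<beta>) / S \<delta> \<le> mean_cycle_length \<beta>" .
      have S: "S \<delta> > 0" using \<open>run_sum \<delta> \<beta> (p \<beta>) \<le> S \<delta>\<close> F[OF \<gamma>\<delta>(2)] by linarith
      have "mean_cycle_cost \<beta> / mean_cycle_length \<beta> \<le> (C \<gamma> / k \<gamma> + C \<delta> / k \<delta>) / (length_moment \<delta> \<beta> (p \<beta>) / S \<delta>)"
        using mc ml N S by (intro frac_le) auto
      also have "\<dots> = Q / length_moment \<delta> \<beta> (p \<beta>)" using S by (simp add: Q_def)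
      finally show ?case using mc(2) mean_cycle_length_pos[OF \<beta>(1,2)] by simp
    qed
  qed
qed

lemma pressure_not_analytic: "\<not> real_analytic_at p 1"
proof
  assume "real_analytic_at p 1"
  then obtain r where r: "r > 0" "\<And>x. \<bar>x - 1\<bar> < r \<Longrightarrow> p x = 0"
    using one_sided_zero_of_analytic[of p 1] pressure_zero(1) by blast
  define x where "x = 1 - min r 1 / 2"
  have "\<bar>x - 1\<bar> < r" "0 \<le> x" "x < 1" using r(1) by (auto simp: x_def)
  then show False using r(2)[of x] pressure_root(1)[of x] by simp
qed

end

theorem theorem7:
  fixes \<gamma> \<delta> :: real and p p1 p2 :: "real \<Rightarrow> real"
  assumes "1 < \<delta>" and "\<delta> < \<gamma>"
  defines "p \<equiv> \<lambda>\<beta>. P (\<lambda>x. \<beta> * double_hofbauer \<gamma> \<delta> x)"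
    and "p1 \<equiv> \<lambda>\<beta>. P (\<lambda>x. \<beta> * hofbauer \<gamma> x)"
    and "p2 \<equiv> \<lambda>\<beta>. P (\<lambda>x. \<beta> * hofbauer \<delta> x)"
  shows "(\<gamma> < 2 \<longrightarrow>
            (\<exists>p'. (\<forall>\<^sub>F \<beta> in at_left 1. (p has_real_derivative p' \<beta>) (at \<beta>)) \<and>
                  (p' \<longlongrightarrow> 0) (at_left 1))) \<and>
         (\<delta> > 2 \<longrightarrow>
            (\<exists>l1 l2. (p1 \<longlongrightarrow> l1) (at_left 1) \<and> (p2 \<longlongrightarrow> l2) (at_left 1) \<and>
                     (p \<longlongrightarrow> (l1 + l2) / 2) (at_left 1))) \<and>
         (\<forall>\<beta>>1. p \<beta> = 0) \<and>
         (\<gamma> < 2 \<or> \<delta> > 2 \<longrightarrow> \<not> real_analytic_at p 1)"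
proof -
  have \<gamma>\<delta>: "\<gamma> > 1" "\<delta> > 1" using assms(1,2) by simp_all
  have p: "p = double_pressure \<gamma> \<delta>" by (rule ext) (simp add: p_def double_pressure_def)
  have near: "\<forall>\<^sub>F \<beta> in at_left 1. \<beta> \<in> {0<..<(1::real)}" by (rule eventually_at_left_real) simp
  have part1: "\<exists>p'. (\<forall>\<^sub>F \<beta> in at_left 1. (p has_real_derivative p' \<beta>) (at \<beta>)) \<and> (p' \<longlongrightarrow> 0) (at_left 1)"
    if "\<gamma> < 2"
  proof (intro exI conjI)
    show "\<forall>\<^sub>F \<beta> in at_left 1. (p has_real_derivative - mean_cycle_cost \<gamma> \<delta> \<beta> / mean_cycle_length \<gamma> \<delta> \<beta>) (at \<beta>)"
      using near by eventually_elim (use pressure_derivative[OF \<gamma>\<delta>] in \<open>simp add: p\<close>)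
    show "((\<lambda>\<beta>. - mean_cycle_cost \<gamma> \<delta> \<beta> / mean_cycle_length \<gamma> \<delta> \<beta>) \<longlongrightarrow> 0) (at_left 1)"
      by (rule derivative_tendsto_0[OF \<gamma>\<delta>]) (use that assms(2) in simp)
  qed
  have "(p1 \<longlongrightarrow> 0) (at_left 1)" "(p2 \<longlongrightarrow> 0) (at_left 1)" "(p \<longlongrightarrow> (0 + 0) / 2) (at_left 1)"
    unfolding p1_def p2_def p using hofbauer_pressure_tendsto_0 \<gamma>\<delta> pressure_tendsto_0[OF \<gamma>\<delta>] by simp_all
  then have part2: "\<exists>l1 l2. (p1 \<longlongrightarrow> l1) (at_left 1) \<and> (p2 \<longlongrightarrow> l2) (at_left 1) \<and>
      (p \<longlongrightarrow> (l1 + l2) / 2) (at_left 1)" by blast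
  have part3: "\<forall>\<beta>>1. p \<beta> = 0" using pressure_zero(1)[OF \<gamma>\<delta>] by (simp add: p)
  have part4: "\<not> real_analytic_at p 1" unfolding p by (rule pressure_not_analytic[OF \<gamma>\<delta>])
  show ?thesis using part1 part2 part3 part4 by blast
qed

end
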